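(* Let $G$ be a connected Lie group acting freely and properly on the left on a smooth manifold $Q$, let $h:T^*Q\to\mathbb{R}$ be a $G$-invariant Hamiltonian (with respect to the cotangent-lifted action), and fix a principal connection $A$ on $\pi_G:Q\to Q/G$. Let $\gamma$ be a 1-form on $Q$ such that $L=\mathrm{Im}(\gamma)$ is a $G$-invariant solution of the Hamilton-Jacobi problem for $h$ with $J(L)=\{\mu\}$, and let $\tilde\gamma$ be the 1-form on $Q/G$ whose image is the reduced solution $\tilde L=\Psi(\pi(L))\subset T^*(Q/G)$. Define the projected vector fields $$X_h^\gamma=T\pi_Q\circ X_h\circ\gamma\ \text{ on } Q,\qquad X_{\tilde h_\mu}^{\tilde\gamma}=T\pi_{Q/G}\circ X_{\tilde h_\mu}\circ\tilde\gamma\ \text{ on } Q/G,$$ where $X_h$ is the Hamiltonian vector field of $h$ on $(T^*Q,\omega_Q)$ and $X_{\tilde h_\mu}$ is the Hamiltonian vector field of $\tilde h_\mu$ on $(T^*(Q/G),\ \omega_{Q/G}+B_\mu)$. Then $X_h^\gamma$ projects onto $X_{\tilde h_\mu}^{\tilde\gamma}$ via $\pi_G$, i.e. $T\pi_G\circ X_h^\gamma=X_{\tilde h_\mu}^{\tilde\gamma}\circ\pi_G$, and $X_h^\gamma$ is $G$-invariant.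
   Context: All manifolds and maps are $C^\infty$. Lifted action: writing $\Phi_g(q)=g\cdot q$, the lifted action on $T^*Q$ is $\Phi^{T^*}_g(\alpha_q)=\alpha_q\circ T\Phi_{g^{-1}}(gq)\in T^*_{gq}Q$. A submanifold $L\subset T^*Q$ is $G$-invariant if $\Phi^{T^*}_g(L)=L$ for all $g\in G$. Symplectic forms: for a manifold $N$, $\omega_N$ is the canonical symplectic form of $T^*N$, with the sign convention $\omega_N=d\theta_N$, where $\theta_N$ is the Liouville (tautological) 1-form. The Hamiltonian vector field $X_f$ on a symplectic manifold $(M,\Omega)$ is defined by $i_{X_f}\Omega=df$. The maps $\pi_Q:T^*Q\to Q$ and $\pi_{Q/G}:T^*(Q/G)\to Q/G$ are the cotangent projections. Momentum map: $J:T^*Q\to\mathfrak{g}^*$, $J(\alpha_q)(\xi)=\alpha_q(\xi_Q(q))$, where $\xi_Q$ is the infinitesimal generator of $\xi\in\mathfrak g$ (its integral curve through $q$ is $t\mapsto \exp(t\xi)\cdot q$). $J$ is equivariant for the coadjoint action $g\cdot\mu=\mu\circ \mathrm{Ad}_{g^{-1}}$. Hence if $L\neq\emptyset$ is $G$-invariant and $J(L)=\{\mu\}$, then $\mu$ is a fixed point of the coadjoint action. Solutions: a solution of the Hamilton-Jacobi problem for $h$ is a Lagrangian submanifold $L$ of $(T^*Q,\omega_Q)$ such that $h$ is constant along $L$. Reduced space: let $\pi:T^*Q\to T^*Q/G$ and $\pi_G:Q\to Q/G$ be the quotient projections, $\tilde{\mathfrak g}^*=Q\times_G\mathfrak g^*$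 the bundle over $Q/G$ associated with the coadjoint action, and, for $q\in Q$, $\mathbf h_q:T_{\pi_G(q)}(Q/G)\to T_qQ$ the horizontal lift of $A$. The map $\Psi:T^*Q/G\to T^*(Q/G)\times_{Q/G}\tilde{\mathfrak g}^*$, $\Psi([\alpha_q])=(\alpha_q\circ\mathbf h_q,\ [q,J(\alpha_q)])$, is a diffeomorphism. For $\mu$ fixed by the coadjoint action, $\Psi$ maps $J^{-1}(\mu)/G$ onto the set of pairs $(\tilde\alpha_{\tilde q},[q,\mu])$ with $\pi_G(q)=\tilde q$; this set is identified with $T^*(Q/G)$ by forgetting the second component, which depends only on $\tilde q$. With this identification, the 1-form $\tilde\gamma$ is given by $\tilde\gamma(\pi_G(q))=\gamma(q)\circ\mathbf h_q$. Magnetic term: for such $\mu$ let $\alpha_\mu=\langle\mu,A\rangle$, where $A:TQ\to\mathfrak g$ is the connection 1-form. There is a unique 2-form $\beta_\mu$ on $Q/G$ with $\pi_G^*\beta_\mu=d\alpha_\mu$. Put $B_\mu=\pi_{Q/G}^*\beta_\mu$. Reduced Hamiltonian: let $h_G:T^*Q/G\to\mathbb R$ satisfy $h_G\circ\pi=h$; then $\tilde h_\mu:T^*(Q/G)\to\mathbb R$ is $\tilde h_\mu(\tilde\alpha_{\tilde q})=(h_G\circ\Psi^{-1})(\tilde\alpha_{\tilde q},[q,\mu])$ for any $q$ with $\pi_G(q)=\tilde q$. *)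

theory Defs
  imports "HOL-Analysis.Analysis" "HOL-Algebra.Group_Action"
begin

section \<open>Model spaces\<close>

text \<open>Manifolds are modelled on finite-dimensional inner product spaces. The class
  \<^class>\<open>euclidean_space\<close> is not used because it excludes dimension 0, which is needed here:
  \<open>Q/G\<close> is a point when the action is transitive. The inner product only serves to coordinatise
  covectors.\<close>

class fin_dim_inner = real_inner +
  assumes finite_span: "\<exists>B::'a set. finite B \<and> (\<forall>x. \<exists>r. x = (\<Sum>b\<in>B. r b *\<^sub>R b))"

subclass (in euclidean_space) fin_dim_inner
proof
  show "\<exists>B::'a set. finite B \<and> (\<forall>x. \<exists>r. x = (\<Sum>b\<in>B. r b *\<^sub>R b))"
    using finite_Basis euclidean_representation by metis
qed

instance prod :: (fin_dim_inner, fin_dim_inner) fin_dim_inner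
proof
  obtain A :: "'a set" where A: "finite A" "\<forall>x. \<exists>r. x = (\<Sum>b\<in>A. r b *\<^sub>R b)"
    using finite_span by blast
  obtain B :: "'b set" where B: "finite B" "\<forall>x. \<exists>r. x = (\<Sum>b\<in>B. r b *\<^sub>R b)"
    using finite_span by blast
  let ?C = "(\<lambda>x. (x, 0)) ` A \<union> (\<lambda>y. (0, y)) ` B :: ('a \<times> 'b) set"
  have fin: "finite ?C" using A B by simp
  have "(x, y) \<in> span ?C" for x y
  proof -
    obtain r s where r: "x = (\<Sum>b\<in>A. r b *\<^sub>R b)" and s: "y = (\<Sum>b\<in>B. s b *\<^sub>R b)"
      using A B by metis
    have "(x, y) = (\<Sum>b\<in>A. r b *\<^sub>R (b, 0)) + (\<Sum>b\<in>B. s b *\<^sub>R (0, b))"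
      unfolding r s by (simp add: prod_eq_iff fst_sum snd_sum)
    also have "\<dots> \<in> span ?C"
      by (intro span_add span_sum span_scale span_base) auto
    finally show ?thesis .
  qed
  then have "\<exists>r. x = (\<Sum>b\<in>?C. r b *\<^sub>R b)" for x
    using span_finite[OF fin] by (metis (no_types, lifting) rangeE surj_pair)
  with fin show "\<exists>C::('a \<times> 'b) set. finite C \<and> (\<forall>x. \<exists>r. x = (\<Sum>b\<in>C. r b *\<^sub>R b))"
    by blast
qed

text \<open>The 0-dimensional model space.\<close>

instantiation unit :: real_inner
begin

definition "zero_unit = ()"
definition "plus_unit (x::unit) (y::unit) = ()"
definition "minus_unit (x::unit) (y::unit) = ()"
definition "uminus_unit (x::unit) = ()"
definition "scaleR_unit (r::real) (x::unit) = ()"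
definition "norm_unit (x::unit) = (0::real)"
definition "sgn_unit (x::unit) = ()"
definition "dist_unit (x::unit) (y::unit) = (0::real)"
definition "inner_unit (x::unit) (y::unit) = (0::real)"
definition "uniformity_unit = (INF e\<in>{0<..}. principal {(x::unit, y::unit). dist x y < e})"
definition "open_unit (U::unit set) =
  (\<forall>x\<in>U. \<forall>\<^sub>F (x', y) in uniformity. x' = x \<longrightarrow> y \<in> U)"

instance
  by standard (auto simp: uniformity_unit_def open_unit_def dist_unit_def norm_unit_def inner_unit_def)

end

instance unit :: fin_dim_inner
  by standard (rule exI[of _ UNIV], simp)


section \<open>Smooth manifolds and smooth maps\<close>

primrec k_smooth_on :: "nat \<Rightarrow> 'e::real_normed_vector set \<Rightarrow> ('e \<Rightarrow> 'f::real_normed_vector) \<Rightarrow> bool"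
  where
  "k_smooth_on 0 U f \<longleftrightarrow> continuous_on U f"
| "k_smooth_on (Suc k) U f \<longleftrightarrow>
     (\<forall>x\<in>U. f differentiable (at x)) \<and> (\<forall>v. k_smooth_on k U (\<lambda>x. frechet_derivative f (at x) v))"

text \<open>Used for open subsets of finite-dimensional spaces only.\<close>

definition smooth_on :: "'e::real_normed_vector set \<Rightarrow> ('e \<Rightarrow> 'f::real_normed_vector) \<Rightarrow> bool" where
  "smooth_on U f \<longleftrightarrow> (\<forall>k. k_smooth_on k U f)"

text \<open>A manifold is given by an atlas; its point set and its topology are derived from the atlas.
  A chart consists of its domain and a map whose values outside the domain are irrelevant.\<close>

type_synonym ('a, 'e) chart = "'a set \<times> ('a \<Rightarrow> 'e)"
type_synonym ('a, 'e) atlas = "('a, 'e) chart set"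

definition chart_inv :: "('a, 'e) chart \<Rightarrow> 'e \<Rightarrow> 'a" where
  "chart_inv c = inv_into (fst c) (snd c)"

definition points :: "('a, 'e) atlas \<Rightarrow> 'a set" where
  "points M = \<Union> (fst ` M)"

definition mtop :: "('a, 'e::fin_dim_inner) atlas \<Rightarrow> 'a topology" where
  "mtop M = topology_generated_by {fst c \<inter> snd c -` W | c W. c \<in> M \<and> open W}"

definition is_chart :: "('a, 'e::fin_dim_inner) chart \<Rightarrow> bool" where
  "is_chart c \<longleftrightarrow> inj_on (snd c) (fst c) \<and> open (snd c ` fst c)"

definition compatible :: "('a, 'e::fin_dim_inner) chart \<Rightarrow> ('a, 'e) chart \<Rightarrow> bool" where
  "compatible c d \<longleftrightarrow>
     open (snd c ` (fst c \<inter> fst d)) \<and>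
     smooth_on (snd c ` (fst c \<inter> fst d)) (snd d \<circ> chart_inv c)"

definition smooth_manifold :: "('a, 'e::fin_dim_inner) atlas \<Rightarrow> bool" where
  "smooth_manifold M \<longleftrightarrow>
     (\<forall>c\<in>M. is_chart c) \<and> (\<forall>c\<in>M. \<forall>d\<in>M. compatible c d) \<and>
     Hausdorff_space (mtop M) \<and> second_countable (mtop M)"

definition smooth_map ::
  "('a, 'e::fin_dim_inner) atlas \<Rightarrow> ('b, 'f::fin_dim_inner) atlas \<Rightarrow> ('a \<Rightarrow> 'b) \<Rightarrow> bool" where
  "smooth_map M N f \<longleftrightarrow>
     continuous_map (mtop M) (mtop N) f \<and>
     (\<forall>c\<in>M. \<forall>d\<in>N. smooth_on (snd c ` (fst c \<inter> f -` fst d)) (snd d \<circ> f \<circ> chart_inv c))"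

definition vector_space_atlas :: "('e, 'e) atlas" where
  "vector_space_atlas = {(UNIV, id)}"

definition smooth_fun :: "('a, 'e::fin_dim_inner) atlas \<Rightarrow> ('a \<Rightarrow> real) \<Rightarrow> bool" where
  "smooth_fun M f \<longleftrightarrow> smooth_map M vector_space_atlas f"

definition prod_atlas :: "('a, 'e) atlas \<Rightarrow> ('b, 'f) atlas \<Rightarrow> ('a \<times> 'b, 'e \<times> 'f) atlas" where
  "prod_atlas M N = {(fst c \<times> fst d, map_prod (snd c) (snd d)) | c d. c \<in> M \<and> d \<in> N}"


section \<open>Tangent and cotangent spaces\<close>

definition charts_at :: "('a, 'e) atlas \<Rightarrow> 'a \<Rightarrow> ('a, 'e) chart set" where
  "charts_at M p = {c \<in> M. p \<in> fst c}"

definition chart_at :: "('a, 'e) atlas \<Rightarrow> 'a \<Rightarrow> ('a, 'e) chart" where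
  "chart_at M p = (SOME c. c \<in> charts_at M p)"

text \<open>A tangent vector at \<open>p\<close> is a family of components, indexed by the charts at \<open>p\<close>, that transforms
  by the derivatives of the chart transitions. Components at all other charts are set to 0, so
  that the vector space operations are pointwise.\<close>

type_synonym ('a, 'e) tvec = "('a, 'e) chart \<Rightarrow> 'e"

definition tspace :: "('a, 'e::fin_dim_inner) atlas \<Rightarrow> 'a \<Rightarrow> ('a, 'e) tvec set" where
  "tspace M p =
     {v. (\<forall>c\<in>charts_at M p. \<forall>d\<in>charts_at M p.
            v d = frechet_derivative (snd d \<circ> chart_inv c) (at (snd c p)) (v c)) \<and>
         (\<forall>c. c \<notin> charts_at M p \<longrightarrow> v c = 0)}"

definition lincomb :: "real \<Rightarrow> ('a, 'e::real_vector) tvec \<Rightarrow> real \<Rightarrow> ('a, 'e) tvec \<Rightarrow> ('a, 'e) tvec" where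
  "lincomb a v b w = (\<lambda>c. a *\<^sub>R v c + b *\<^sub>R w c)"

text \<open>The tangent vector with components \<open>y\<close> in the chart \<open>c\<close>.\<close>

definition chart_vec ::
  "('a, 'e::fin_dim_inner) atlas \<Rightarrow> 'a \<Rightarrow> ('a, 'e) chart \<Rightarrow> 'e \<Rightarrow> ('a, 'e) tvec" where
  "chart_vec M p c y =
     (\<lambda>d. if d \<in> charts_at M p
          then frechet_derivative (snd d \<circ> chart_inv c) (at (snd c p)) y else 0)"

text \<open>The tangent map \<open>T\<^sub>pf\<close>; for \<open>p\<close> in a smooth manifold and smooth \<open>f\<close>, the result does not depend
  on the chart chosen at \<open>p\<close>. The same holds for \<open>differential\<close> and \<open>ext_deriv\<close> below.\<close>

definition tmap ::
  "('a, 'e::fin_dim_inner) atlas \<Rightarrow> ('b, 'f::fin_dim_inner) atlas \<Rightarrow> ('a \<Rightarrow> 'b) \<Rightarrow> 'a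
     \<Rightarrow> ('a, 'e) tvec \<Rightarrow> ('b, 'f) tvec" where
  "tmap M N f p v =
     (let c = chart_at M p in
      (\<lambda>d. if d \<in> charts_at N (f p)
           then frechet_derivative (snd d \<circ> f \<circ> chart_inv c) (at (snd c p)) (v c) else 0))"

definition differential ::
  "('a, 'e::fin_dim_inner) atlas \<Rightarrow> ('a \<Rightarrow> real) \<Rightarrow> 'a \<Rightarrow> ('a, 'e) tvec \<Rightarrow> real" where
  "differential M f p v =
     (let c = chart_at M p in frechet_derivative (f \<circ> chart_inv c) (at (snd c p)) (v c))"

definition velocity :: "('a, 'e::fin_dim_inner) atlas \<Rightarrow> (real \<Rightarrow> 'a) \<Rightarrow> real \<Rightarrow> ('a, 'e) tvec" where
  "velocity M \<sigma> t =
     tmap vector_space_atlas M \<sigma> t (chart_vec vector_space_atlas t (UNIV, id) 1)"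

definition submersion ::
  "('a, 'e::fin_dim_inner) atlas \<Rightarrow> ('b, 'f::fin_dim_inner) atlas \<Rightarrow> ('a \<Rightarrow> 'b) \<Rightarrow> bool" where
  "submersion M N f \<longleftrightarrow>
     smooth_map M N f \<and> (\<forall>p\<in>points M. tmap M N f p ` tspace M p = tspace N (f p))"

text \<open>Covectors are extensional functions, so that equality of covectors is equality of linear
  functionals on the tangent space.\<close>

type_synonym ('a, 'e) covec = "('a, 'e) tvec \<Rightarrow> real"

definition cotspace :: "('a, 'e::fin_dim_inner) atlas \<Rightarrow> 'a \<Rightarrow> ('a, 'e) covec set" where
  "cotspace M p =
     {\<alpha> \<in> extensional (tspace M p).
        \<forall>v\<in>tspace M p. \<forall>w\<in>tspace M p. \<forall>a b. \<alpha> (lincomb a v b w) = a * \<alpha> v + b * \<alpha> w}"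

text \<open>The cotangent bundle; the chart induced by \<open>c\<close> is \<open>(q, \<Sum>\<^sub>i p\<^sub>i dq\<^sup>i) \<mapsto> (c q, p)\<close>.\<close>

definition cot_chart ::
  "('a, 'e::fin_dim_inner) atlas \<Rightarrow> ('a, 'e) chart \<Rightarrow> ('a \<times> ('a, 'e) covec, 'e \<times> 'e) chart" where
  "cot_chart M c =
     (SIGMA q : fst c. cotspace M q,
      \<lambda>(q, \<alpha>). (snd c q, THE a. \<forall>v\<in>tspace M q. \<alpha> v = a \<bullet> v c))"

definition cot_bundle ::
  "('a, 'e::fin_dim_inner) atlas \<Rightarrow> ('a \<times> ('a, 'e) covec, 'e \<times> 'e) atlas" where
  "cot_bundle M = cot_chart M ` M"


section \<open>Differential forms\<close>

definition one_form ::
  "('a, 'e::fin_dim_inner) atlas \<Rightarrow> ('a \<Rightarrow> ('a, 'e) covec) \<Rightarrow> bool" where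
  "one_form M \<alpha> \<longleftrightarrow> smooth_map M (cot_bundle M) (\<lambda>q. (q, \<alpha> q))"

definition form_image ::
  "('a, 'e::fin_dim_inner) atlas \<Rightarrow> ('a \<Rightarrow> ('a, 'e) covec) \<Rightarrow> ('a \<times> ('a, 'e) covec) set" where
  "form_image M \<alpha> = (\<lambda>q. (q, \<alpha> q)) ` points M"

definition two_form ::
  "('a, 'e::fin_dim_inner) atlas \<Rightarrow> ('a \<Rightarrow> ('a, 'e) tvec \<Rightarrow> ('a, 'e) tvec \<Rightarrow> real) \<Rightarrow> bool" where
  "two_form M \<beta> \<longleftrightarrow>
     (\<forall>p\<in>points M. \<forall>u\<in>tspace M p. \<forall>v\<in>tspace M p. \<beta> p u v = - \<beta> p v u) \<and>
     (\<forall>p\<in>points M. \<forall>u\<in>tspace M p. \<forall>v\<in>tspace M p. \<forall>w\<in>tspace M p. \<forall>a b.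
        \<beta> p (lincomb a u b v) w = a * \<beta> p u w + b * \<beta> p v w) \<and>
     (\<forall>c\<in>M. \<forall>x y. smooth_on (snd c ` fst c)
        (\<lambda>z. \<beta> (chart_inv c z) (chart_vec M (chart_inv c z) c x) (chart_vec M (chart_inv c z) c y)))"

text \<open>Exterior derivative of a 1-form, \<open>d\<alpha>(X,Y) = X(\<alpha>(Y)) - Y(\<alpha>(X)) - \<alpha>([X,Y])\<close>, evaluated on
  coordinate fields with constant components.\<close>

definition ext_deriv ::
  "('a, 'e::fin_dim_inner) atlas \<Rightarrow> ('a \<Rightarrow> ('a, 'e) covec)
     \<Rightarrow> 'a \<Rightarrow> ('a, 'e) tvec \<Rightarrow> ('a, 'e) tvec \<Rightarrow> real" where
  "ext_deriv M \<alpha> p u v =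
     (let c = chart_at M p;
          a = (\<lambda>y z. \<alpha> (chart_inv c z) (chart_vec M (chart_inv c z) c y))
      in frechet_derivative (a (v c)) (at (snd c p)) (u c)
         - frechet_derivative (a (u c)) (at (snd c p)) (v c))"

definition pullback2 ::
  "('a, 'e::fin_dim_inner) atlas \<Rightarrow> ('b, 'f::fin_dim_inner) atlas \<Rightarrow> ('a \<Rightarrow> 'b)
     \<Rightarrow> ('b \<Rightarrow> ('b, 'f) tvec \<Rightarrow> ('b, 'f) tvec \<Rightarrow> real)
     \<Rightarrow> 'a \<Rightarrow> ('a, 'e) tvec \<Rightarrow> ('a, 'e) tvec \<Rightarrow> real" where
  "pullback2 M N f \<beta> p u v = \<beta> (f p) (tmap M N f p u) (tmap M N f p v)"


section \<open>Symplectic geometry of cotangent bundles\<close>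

definition liouville_form ::
  "('a, 'e::fin_dim_inner) atlas
     \<Rightarrow> 'a \<times> ('a, 'e) covec \<Rightarrow> ('a \<times> ('a, 'e) covec, 'e \<times> 'e) covec" where
  "liouville_form M x =
     (\<lambda>V\<in>tspace (cot_bundle M) x. snd x (tmap (cot_bundle M) M fst x V))"

definition canonical_symplectic ::
  "('a, 'e::fin_dim_inner) atlas \<Rightarrow> 'a \<times> ('a, 'e) covec
     \<Rightarrow> ('a \<times> ('a, 'e) covec, 'e \<times> 'e) tvec \<Rightarrow> ('a \<times> ('a, 'e) covec, 'e \<times> 'e) tvec \<Rightarrow> real" where
  "canonical_symplectic M = ext_deriv (cot_bundle M) (liouville_form M)"

definition hamiltonian_vf ::
  "('a, 'e::fin_dim_inner) atlas \<Rightarrow> ('a \<Rightarrow> ('a, 'e) tvec \<Rightarrow> ('a, 'e) tvec \<Rightarrow> real)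
     \<Rightarrow> ('a \<Rightarrow> real) \<Rightarrow> 'a \<Rightarrow> ('a, 'e) tvec" where
  "hamiltonian_vf M \<Omega> f x =
     (THE v. v \<in> tspace M x \<and> (\<forall>w\<in>tspace M x. \<Omega> x v w = differential M f x w))"

text \<open>Embedded submanifolds, by slice charts of the maximal atlas.\<close>

definition submanifold :: "('a, 'e::fin_dim_inner) atlas \<Rightarrow> 'a set \<Rightarrow> bool" where
  "submanifold M L \<longleftrightarrow> L \<subseteq> points M \<and>
     (\<forall>x\<in>L. \<exists>c S. is_chart c \<and> fst c \<subseteq> points M \<and>
        (\<forall>d\<in>M. compatible c d \<and> compatible d c) \<and>
        x \<in> fst c \<and> subspace S \<and> snd c ` (fst c \<inter> L) = snd c ` fst c \<inter> S)"

definition tspace_sub :: "('a, 'e::fin_dim_inner) atlas \<Rightarrow> 'a set \<Rightarrow> 'a \<Rightarrow> ('a, 'e) tvec set" where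
  "tspace_sub M L x =
     {velocity M \<sigma> 0 | \<sigma>. smooth_map vector_space_atlas M \<sigma> \<and> range \<sigma> \<subseteq> L \<and> \<sigma> 0 = x}"

text \<open>Lagrangian: every tangent space is its own symplectic orthogonal.\<close>

definition lagrangian_submanifold ::
  "('a, 'e::fin_dim_inner) atlas \<Rightarrow> ('a \<Rightarrow> ('a, 'e) tvec \<Rightarrow> ('a, 'e) tvec \<Rightarrow> real)
     \<Rightarrow> 'a set \<Rightarrow> bool" where
  "lagrangian_submanifold M \<Omega> L \<longleftrightarrow> submanifold M L \<and>
     (\<forall>x\<in>L. tspace_sub M L x = {v \<in> tspace M x. \<forall>w\<in>tspace_sub M L x. \<Omega> x v w = 0})"

definition HJ_solution ::
  "('a, 'e::fin_dim_inner) atlas \<Rightarrow> ('a \<times> ('a, 'e) covec \<Rightarrow> real)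
     \<Rightarrow> ('a \<times> ('a, 'e) covec) set \<Rightarrow> bool" where
  "HJ_solution Q h L \<longleftrightarrow>
     lagrangian_submanifold (cot_bundle Q) (canonical_symplectic Q) L \<and>
     (\<exists>k. \<forall>x\<in>L. h x = k)"

text \<open>The projection \<open>T\<pi>\<^sub>M \<circ> X\<^sub>f \<circ> \<gamma>\<close> of a Hamiltonian vector field of \<open>(T\<^sup>*M, \<Omega>)\<close> along a 1-form.\<close>

definition projected_vf ::
  "('a, 'e::fin_dim_inner) atlas
     \<Rightarrow> ('a \<times> ('a, 'e) covec \<Rightarrow> ('a \<times> ('a, 'e) covec, 'e \<times> 'e) tvec
          \<Rightarrow> ('a \<times> ('a, 'e) covec, 'e \<times> 'e) tvec \<Rightarrow> real)
     \<Rightarrow> ('a \<times> ('a, 'e) covec \<Rightarrow> real) \<Rightarrow> ('a \<Rightarrow> ('a, 'e) covec) \<Rightarrow> 'a \<Rightarrow> ('a, 'e) tvec" where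
  "projected_vf M \<Omega> f \<gamma> q =
     tmap (cot_bundle M) M fst (q, \<gamma> q) (hamiltonian_vf (cot_bundle M) \<Omega> f (q, \<gamma> q))"


section \<open>Lie groups and their actions\<close>

definition lie_group :: "('g, 'm) monoid_scheme \<Rightarrow> ('g, 'l::fin_dim_inner) atlas \<Rightarrow> bool" where
  "lie_group G MG \<longleftrightarrow>
     group G \<and> smooth_manifold MG \<and> carrier G = points MG \<and>
     smooth_map (prod_atlas MG MG) MG (\<lambda>(x, y). x \<otimes>\<^bsub>G\<^esub> y) \<and>
     smooth_map MG MG (\<lambda>x. inv\<^bsub>G\<^esub> x)"

abbreviation lie_algebra ::
  "('g, 'm) monoid_scheme \<Rightarrow> ('g, 'l::fin_dim_inner) atlas \<Rightarrow> ('g, 'l) tvec set" where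
  "lie_algebra G MG \<equiv> tspace MG \<one>\<^bsub>G\<^esub>"

abbreviation lie_algebra_dual ::
  "('g, 'm) monoid_scheme \<Rightarrow> ('g, 'l::fin_dim_inner) atlas \<Rightarrow> ('g, 'l) covec set" where
  "lie_algebra_dual G MG \<equiv> cotspace MG \<one>\<^bsub>G\<^esub>"

text \<open>The exponential map is characterised by the property that, for every \<open>\<xi>\<close> in the Lie algebra,
  \<open>t \<mapsto> exp(t\<xi>)\<close> is the one-parameter subgroup with initial velocity \<open>\<xi>\<close>.\<close>

definition exponential_map ::
  "('g, 'm) monoid_scheme \<Rightarrow> ('g, 'l::fin_dim_inner) atlas \<Rightarrow> (('g, 'l) tvec \<Rightarrow> 'g) \<Rightarrow> bool" where
  "exponential_map G MG Exp \<longleftrightarrow>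
     (\<forall>\<xi>\<in>lie_algebra G MG.
        let \<sigma> = (\<lambda>t::real. Exp (\<lambda>c. t *\<^sub>R \<xi> c)) in
        smooth_map vector_space_atlas MG \<sigma> \<and> (\<forall>s t. \<sigma> (s + t) = \<sigma> s \<otimes>\<^bsub>G\<^esub> \<sigma> t) \<and>
        velocity MG \<sigma> 0 = \<xi>)"

definition Ad ::
  "('g, 'm) monoid_scheme \<Rightarrow> ('g, 'l::fin_dim_inner) atlas \<Rightarrow> 'g \<Rightarrow> ('g, 'l) tvec \<Rightarrow> ('g, 'l) tvec" where
  "Ad G MG g \<xi> = tmap MG MG (\<lambda>x. g \<otimes>\<^bsub>G\<^esub> x \<otimes>\<^bsub>G\<^esub> inv\<^bsub>G\<^esub> g) \<one>\<^bsub>G\<^esub> \<xi>"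

definition coAd ::
  "('g, 'm) monoid_scheme \<Rightarrow> ('g, 'l::fin_dim_inner) atlas \<Rightarrow> 'g \<Rightarrow> ('g, 'l) covec \<Rightarrow> ('g, 'l) covec" where
  "coAd G MG g \<nu> = (\<lambda>\<xi>\<in>lie_algebra G MG. \<nu> (Ad G MG (inv\<^bsub>G\<^esub> g) \<xi>))"

definition smooth_action ::
  "('g, 'm) monoid_scheme \<Rightarrow> ('g, 'l::fin_dim_inner) atlas \<Rightarrow> ('q, 'e::fin_dim_inner) atlas
     \<Rightarrow> ('g \<Rightarrow> 'q \<Rightarrow> 'q) \<Rightarrow> bool" where
  "smooth_action G MG Q \<Phi> \<longleftrightarrow>
     group_action G (points Q) \<Phi> \<and> smooth_map (prod_atlas MG Q) Q (\<lambda>(g, q). \<Phi> g q)"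

definition free_action :: "('g, 'm) monoid_scheme \<Rightarrow> ('q, 'e) atlas \<Rightarrow> ('g \<Rightarrow> 'q \<Rightarrow> 'q) \<Rightarrow> bool" where
  "free_action G Q \<Phi> \<longleftrightarrow> (\<forall>g\<in>carrier G. \<forall>q\<in>points Q. \<Phi> g q = q \<longrightarrow> g = \<one>\<^bsub>G\<^esub>)"

definition proper_action ::
  "('g, 'l::fin_dim_inner) atlas \<Rightarrow> ('q, 'e::fin_dim_inner) atlas \<Rightarrow> ('g \<Rightarrow> 'q \<Rightarrow> 'q) \<Rightarrow> bool" where
  "proper_action MG Q \<Phi> \<longleftrightarrow>
     proper_map (prod_topology (mtop MG) (mtop Q)) (prod_topology (mtop Q) (mtop Q))
       (\<lambda>(g, q). (\<Phi> g q, q))"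

text \<open>The orbit space with its smooth structure, which is the unique one for which the projection
  \<open>\<pi>\<^sub>G = orbit G \<Phi>\<close> is a submersion.\<close>

definition quotient_manifold ::
  "('g, 'm) monoid_scheme \<Rightarrow> ('q, 'e::fin_dim_inner) atlas \<Rightarrow> ('g \<Rightarrow> 'q \<Rightarrow> 'q)
     \<Rightarrow> ('q set, 'b::fin_dim_inner) atlas \<Rightarrow> bool" where
  "quotient_manifold G Q \<Phi> B \<longleftrightarrow>
     smooth_manifold B \<and> points B = orbits G (points Q) \<Phi> \<and> submersion Q B (orbit G \<Phi>)"

definition lifted_action ::
  "('g, 'm) monoid_scheme \<Rightarrow> ('q, 'e::fin_dim_inner) atlas \<Rightarrow> ('g \<Rightarrow> 'q \<Rightarrow> 'q)
     \<Rightarrow> 'g \<Rightarrow> 'q \<times> ('q, 'e) covec \<Rightarrow> 'q \<times> ('q, 'e) covec" where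
  "lifted_action G Q \<Phi> g = (\<lambda>(q, \<alpha>).
     (\<Phi> g q, \<lambda>v\<in>tspace Q (\<Phi> g q). \<alpha> (tmap Q Q (\<Phi> (inv\<^bsub>G\<^esub> g)) (\<Phi> g q) v)))"

definition inf_generator ::
  "(('g, 'l::fin_dim_inner) tvec \<Rightarrow> 'g) \<Rightarrow> ('q, 'e::fin_dim_inner) atlas \<Rightarrow> ('g \<Rightarrow> 'q \<Rightarrow> 'q)
     \<Rightarrow> ('g, 'l) tvec \<Rightarrow> 'q \<Rightarrow> ('q, 'e) tvec" where
  "inf_generator Exp Q \<Phi> \<xi> q = velocity Q (\<lambda>t. \<Phi> (Exp (\<lambda>c. t *\<^sub>R \<xi> c)) q) 0"

definition momentum_map ::
  "('g, 'm) monoid_scheme \<Rightarrow> ('g, 'l::fin_dim_inner) atlas \<Rightarrow> (('g, 'l) tvec \<Rightarrow> 'g)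
     \<Rightarrow> ('q, 'e::fin_dim_inner) atlas \<Rightarrow> ('g \<Rightarrow> 'q \<Rightarrow> 'q) \<Rightarrow> 'q \<times> ('q, 'e) covec \<Rightarrow> ('g, 'l) covec" where
  "momentum_map G MG Exp Q \<Phi> = (\<lambda>(q, \<alpha>).
     \<lambda>\<xi>\<in>lie_algebra G MG. \<alpha> (inf_generator Exp Q \<Phi> \<xi> q))"


section \<open>Principal connections\<close>

text \<open>\<open>\<langle>\<nu>, A\<rangle>\<close> for a Lie algebra valued 1-form \<open>A\<close>.\<close>

definition pair_form ::
  "('q, 'e::fin_dim_inner) atlas \<Rightarrow> ('g, 'l) covec
     \<Rightarrow> ('q \<Rightarrow> ('q, 'e) tvec \<Rightarrow> ('g, 'l) tvec) \<Rightarrow> 'q \<Rightarrow> ('q, 'e) covec" where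
  "pair_form Q \<nu> A q = (\<lambda>v\<in>tspace Q q. \<nu> (A q v))"

text \<open>Smoothness of the Lie algebra valued 1-form \<open>A\<close> is smoothness of its components \<open>\<langle>\<nu>, A\<rangle>\<close>.\<close>

definition principal_connection ::
  "('g, 'm) monoid_scheme \<Rightarrow> ('g, 'l::fin_dim_inner) atlas \<Rightarrow> (('g, 'l) tvec \<Rightarrow> 'g)
     \<Rightarrow> ('q, 'e::fin_dim_inner) atlas \<Rightarrow> ('g \<Rightarrow> 'q \<Rightarrow> 'q)
     \<Rightarrow> ('q \<Rightarrow> ('q, 'e) tvec \<Rightarrow> ('g, 'l) tvec) \<Rightarrow> bool" where
  "principal_connection G MG Exp Q \<Phi> A \<longleftrightarrow>
     (\<forall>q\<in>points Q. \<forall>v\<in>tspace Q q. A q v \<in> lie_algebra G MG) \<and>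
     (\<forall>q\<in>points Q. \<forall>v\<in>tspace Q q. \<forall>w\<in>tspace Q q. \<forall>a b.
        A q (lincomb a v b w) = lincomb a (A q v) b (A q w)) \<and>
     (\<forall>\<nu>\<in>lie_algebra_dual G MG. one_form Q (pair_form Q \<nu> A)) \<and>
     (\<forall>q\<in>points Q. \<forall>\<xi>\<in>lie_algebra G MG. A q (inf_generator Exp Q \<Phi> \<xi> q) = \<xi>) \<and>
     (\<forall>g\<in>carrier G. \<forall>q\<in>points Q. \<forall>v\<in>tspace Q q.
        A (\<Phi> g q) (tmap Q Q (\<Phi> g) q v) = Ad G MG g (A q v))"

definition horizontal_lift ::
  "('g, 'm) monoid_scheme \<Rightarrow> ('q, 'e::fin_dim_inner) atlas \<Rightarrow> ('g \<Rightarrow> 'q \<Rightarrow> 'q)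
     \<Rightarrow> ('q set, 'b::fin_dim_inner) atlas \<Rightarrow> ('q \<Rightarrow> ('q, 'e) tvec \<Rightarrow> ('g, 'l::fin_dim_inner) tvec)
     \<Rightarrow> 'q \<Rightarrow> ('q set, 'b) tvec \<Rightarrow> ('q, 'e) tvec" where
  "horizontal_lift G Q \<Phi> B A q w =
     (THE v. v \<in> tspace Q q \<and> A q v = (\<lambda>_. 0) \<and> tmap Q B (orbit G \<Phi>) q v = w)"


section \<open>Reduction\<close>

text \<open>The element \<open>[q, \<nu>]\<close> of the associated bundle \<open>Q \<times>\<^sub>G \<gg>\<^sup>*\<close>.\<close>

definition assoc_class ::
  "('g, 'm) monoid_scheme \<Rightarrow> ('g, 'l::fin_dim_inner) atlas \<Rightarrow> ('g \<Rightarrow> 'q \<Rightarrow> 'q)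
     \<Rightarrow> 'q \<Rightarrow> ('g, 'l) covec \<Rightarrow> ('q \<times> ('g, 'l) covec) set" where
  "assoc_class G MG \<Phi> q \<nu> = orbit G (\<lambda>g. map_prod (\<Phi> g) (coAd G MG g)) (q, \<nu>)"

text \<open>The map \<open>\<Psi>\<close> on orbits of the lifted action, by means of a representative.\<close>

definition reduction_map ::
  "('g, 'm) monoid_scheme \<Rightarrow> ('g, 'l::fin_dim_inner) atlas \<Rightarrow> (('g, 'l) tvec \<Rightarrow> 'g)
     \<Rightarrow> ('q, 'e::fin_dim_inner) atlas \<Rightarrow> ('g \<Rightarrow> 'q \<Rightarrow> 'q) \<Rightarrow> ('q set, 'b::fin_dim_inner) atlas
     \<Rightarrow> ('q \<Rightarrow> ('q, 'e) tvec \<Rightarrow> ('g, 'l) tvec)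
     \<Rightarrow> ('q \<times> ('q, 'e) covec) set
     \<Rightarrow> ('q set \<times> ('q set, 'b) covec) \<times> ('q \<times> ('g, 'l) covec) set" where
  "reduction_map G MG Exp Q \<Phi> B A X =
     (let (q, \<alpha>) = (SOME x. x \<in> X); b = orbit G \<Phi> q in
      ((b, \<lambda>w\<in>tspace B b. \<alpha> (horizontal_lift G Q \<Phi> B A q w)),
       assoc_class G MG \<Phi> q (momentum_map G MG Exp Q \<Phi> (q, \<alpha>))))"

definition cot_orbit ::
  "('g, 'm) monoid_scheme \<Rightarrow> ('q, 'e::fin_dim_inner) atlas \<Rightarrow> ('g \<Rightarrow> 'q \<Rightarrow> 'q)
     \<Rightarrow> 'q \<times> ('q, 'e) covec \<Rightarrow> ('q \<times> ('q, 'e) covec) set" where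
  "cot_orbit G Q \<Phi> = orbit G (lifted_action G Q \<Phi>)"

definition cot_orbits ::
  "('g, 'm) monoid_scheme \<Rightarrow> ('q, 'e::fin_dim_inner) atlas \<Rightarrow> ('g \<Rightarrow> 'q \<Rightarrow> 'q)
     \<Rightarrow> ('q \<times> ('q, 'e) covec) set set" where
  "cot_orbits G Q \<Phi> = orbits G (points (cot_bundle Q)) (lifted_action G Q \<Phi>)"

definition reduced_hamiltonian ::
  "('g, 'm) monoid_scheme \<Rightarrow> ('g, 'l::fin_dim_inner) atlas \<Rightarrow> (('g, 'l) tvec \<Rightarrow> 'g)
     \<Rightarrow> ('q, 'e::fin_dim_inner) atlas \<Rightarrow> ('g \<Rightarrow> 'q \<Rightarrow> 'q) \<Rightarrow> ('q set, 'b::fin_dim_inner) atlas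
     \<Rightarrow> ('q \<Rightarrow> ('q, 'e) tvec \<Rightarrow> ('g, 'l) tvec) \<Rightarrow> ('g, 'l) covec
     \<Rightarrow> (('q \<times> ('q, 'e) covec) set \<Rightarrow> real) \<Rightarrow> 'q set \<times> ('q set, 'b) covec \<Rightarrow> real" where
  "reduced_hamiltonian G MG Exp Q \<Phi> B A \<mu> hG x =
     (let q = (SOME q. q \<in> points Q \<and> orbit G \<Phi> q = fst x) in
      hG (inv_into (cot_orbits G Q \<Phi>) (reduction_map G MG Exp Q \<Phi> B A)
           (x, assoc_class G MG \<Phi> q \<mu>)))"

text \<open>\<open>\<Psi>(\<pi>(L))\<close> as a subset of \<open>T\<^sup>*(Q/G)\<close>, after forgetting the component \<open>[q, \<mu>]\<close>.\<close>

definition reduced_set ::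
  "('g, 'm) monoid_scheme \<Rightarrow> ('g, 'l::fin_dim_inner) atlas \<Rightarrow> (('g, 'l) tvec \<Rightarrow> 'g)
     \<Rightarrow> ('q, 'e::fin_dim_inner) atlas \<Rightarrow> ('g \<Rightarrow> 'q \<Rightarrow> 'q) \<Rightarrow> ('q set, 'b::fin_dim_inner) atlas
     \<Rightarrow> ('q \<Rightarrow> ('q, 'e) tvec \<Rightarrow> ('g, 'l) tvec)
     \<Rightarrow> ('q \<times> ('q, 'e) covec) set \<Rightarrow> ('q set \<times> ('q set, 'b) covec) set" where
  "reduced_set G MG Exp Q \<Phi> B A L =
     fst ` reduction_map G MG Exp Q \<Phi> B A ` cot_orbit G Q \<Phi> ` L"

text \<open>\<open>\<omega>\<^bsub>Q/G\<^esub> + \<pi>\<^sub>Q\<^sub>/\<^sub>G\<^sup>*\<beta>\<close>\<close>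

definition magnetic_symplectic ::
  "('a, 'e::fin_dim_inner) atlas \<Rightarrow> ('a \<Rightarrow> ('a, 'e) tvec \<Rightarrow> ('a, 'e) tvec \<Rightarrow> real)
     \<Rightarrow> 'a \<times> ('a, 'e) covec
     \<Rightarrow> ('a \<times> ('a, 'e) covec, 'e \<times> 'e) tvec \<Rightarrow> ('a \<times> ('a, 'e) covec, 'e \<times> 'e) tvec \<Rightarrow> real" where
  "magnetic_symplectic N \<beta> x u v =
     canonical_symplectic N x u v + pullback2 (cot_bundle N) N fst \<beta> x u v"

end

(* In coordinates the canonical form is dp /\ dq, so pairing the Hamiltonian vector field X_f with a
   vertical vector (0, e) gives e(T pi X_f) = - d/dt f(q, c(q) + t e) at t = 0 for a 1-form c: the
   projected vector field is minus the fibre derivative of f along c. The magnetic term vanishes on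
   vertical vectors and does not change this. Since gamma takes the value mu on infinitesimal
   generators, gamma(q) = gamma~(pi_G q) o T pi_G + <mu, A_q>, and the reduced Hamiltonian at (b, a)
   is h at (q, a o T pi_G + <mu, A_q>) for every q over b. Comparing fibre derivatives gives both
   claims. What needs work is that the kernel of T pi_G consists of generators (so that horizontal
   lifts exist) and that the reduced Hamiltonian is differentiable. *)

theory Submission
  imports Defs
begin

(* A chart is a pair; this keeps quantified charts from being split into domain and map. *)
declare split_paired_All [simp del] split_paired_Ex [simp del]

text \<open>The quotient is given only as a manifold whose points are the orbits and whose
  projection is a submersion. That a fibre has no tangent vectors beyond the generators is a global
  fact. The discrete reals translating the line, with one orbit and no nonzero generator, show the
  danger; here it is excluded by counting translates of an open set in a second countable group. The
  connection replaces a dimension count: it inverts the generator map and singles out a complement.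

  Both claims are equalities of tangent vectors, and covectors separate these. Paired with a
  covector, each side is minus the derivative at 0 of a function of one real variable, and the two
  functions coincide. This needs both Hamiltonians to be differentiable, because
  \<open>hamiltonian_vf\<close> is a definite description built on a Frechet derivative.

  Derivatives are only compared at single points. Hence atlases with differentiable transitions
  suffice as a framework, and strict differentiability at a point takes the place of the inverse
  function theorem.\<close>

section \<open>Finite-dimensional inner product spaces\<close>

text \<open>Gram-Schmidt on the finite spanning set that the class provides. The orthogonal set may
  contain 0, which is removed before normalising; in dimension 0 the basis is empty.\<close>

lemma ex_orthonormal_basis:
  "\<exists>B::'a::fin_dim_inner set. finite B \<and> (\<forall>b\<in>B. \<forall>c\<in>B. b \<bullet> c = (if b = c then 1 else 0)) \<and>
     (\<forall>x. (\<Sum>b\<in>B. (x \<bullet> b) *\<^sub>R b) = x)"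
proof -
  obtain A :: "'a set" where A: "finite A" "\<forall>x. \<exists>r. x = (\<Sum>b\<in>A. r b *\<^sub>R b)"
    using finite_span by blast
  obtain C where C: "finite C" "span C = span A" "pairwise orthogonal C"
    using basis_orthogonal[OF A(1)] by blast
  have "x \<in> span A" for x
  proof -
    obtain r where "x = (\<Sum>b\<in>A. r b *\<^sub>R b)" using A by blast
    then show ?thesis by (simp add: span_sum span_scale span_base)
  qed
  then have spanC: "span C = UNIV" using C by auto
  define B where "B = (\<lambda>b. b /\<^sub>R norm b) ` (C - {0})"
  have fin: "finite B" using C by (simp add: B_def)
  have ortho: "b \<bullet> c = (if b = c then 1 else 0)" if "b \<in> B" "c \<in> B" for b c
  proof -
    from that obtain b' c' where b': "b' \<in> C" "b' \<noteq> 0" "b = b' /\<^sub>R norm b'"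
      and c': "c' \<in> C" "c' \<noteq> 0" "c = c' /\<^sub>R norm c'"
      unfolding B_def by blast
    show ?thesis
    proof (cases "b' = c'")
      case True
      then show ?thesis using b' c' by (simp add: dot_square_norm power2_eq_square)
    next
      case False
      then have "b' \<bullet> c' = 0" using C(3) b' c' by (auto simp: pairwise_def orthogonal_def)
      then have "b \<bullet> c = 0" using b' c' by simp
      moreover have "b \<bullet> b \<noteq> 0" using b' by simp
      ultimately show ?thesis by auto
    qed
  qed
  have "C \<subseteq> span B"
  proof
    fix x assume "x \<in> C"
    show "x \<in> span B"
    proof (cases "x = 0")
      case False
      then have "norm x *\<^sub>R (x /\<^sub>R norm x) \<in> span B"
        using \<open>x \<in> C\<close> by (intro span_scale span_base) (auto simp: B_def)
      then show ?thesis using False by simp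
    qed (simp add: span_zero)
  qed
  then have spanB: "span B = UNIV"
    using spanC by (metis span_minimal subspace_span top.extremum_uniqueI)
  have "(\<Sum>b\<in>B. (x \<bullet> b) *\<^sub>R b) = x" for x
  proof -
    have "x \<in> span B" by (simp add: spanB)
    then show ?thesis
    proof (induction rule: span_induct_alt)
      case base
      then show ?case by simp
    next
      case (step c x y)
      have "(\<Sum>b\<in>B. (x \<bullet> b) *\<^sub>R b) = (\<Sum>b\<in>B. if b = x then x else 0)"
        using step by (intro sum.cong) (auto simp: ortho)
      also have "\<dots> = x" using step fin by simp
      finally show ?case
        using step by (simp add: inner_add_left scaleR_add_left sum.distrib flip: scaleR_scaleR scaleR_sum_right)
    qed
  qed
  then show ?thesis using fin ortho by blast
qed

definition onb :: "'a::fin_dim_inner set" where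
  "onb = (SOME B. finite B \<and> (\<forall>b\<in>B. \<forall>c\<in>B. b \<bullet> c = (if b = c then 1 else 0)) \<and>
     (\<forall>x. (\<Sum>b\<in>B. (x \<bullet> b) *\<^sub>R b) = x))"

lemma finite_onb: "finite (onb :: 'a::fin_dim_inner set)"
  and onb_inner: "b \<in> onb \<Longrightarrow> c \<in> onb \<Longrightarrow> (b::'a) \<bullet> c = (if b = c then 1 else 0)"
  and onb_expansion: "(\<Sum>b\<in>onb. (x \<bullet> b) *\<^sub>R b) = (x::'a)"
proof -
  note * = someI_ex[OF ex_orthonormal_basis[where ?'a = 'a], folded onb_def]
  show "finite (onb :: 'a set)" and "(\<Sum>b\<in>onb. (x \<bullet> b) *\<^sub>R b) = x"
    using * by blast+
  show "b \<bullet> c = (if b = c then 1 else 0)" if "b \<in> onb" "c \<in> onb"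
    using conjunct1[OF conjunct2[OF *]] that by fast
qed

lemma linear_onb_expansion:
  fixes f :: "'a::fin_dim_inner \<Rightarrow> 'b::real_vector"
  assumes "linear f"
  shows "f x = (\<Sum>b\<in>onb. (x \<bullet> b) *\<^sub>R f b)"
proof -
  have "f x = f (\<Sum>b\<in>onb. (x \<bullet> b) *\<^sub>R b)" by (simp add: onb_expansion)
  then show ?thesis by (simp add: linear_sum[OF assms] linear_scale[OF assms])
qed

lemma linear_imp_bounded_linear:
  fixes f :: "'a::fin_dim_inner \<Rightarrow> 'b::real_normed_vector"
  assumes "linear f"
  shows "bounded_linear f"
proof -
  have *: "(\<lambda>x. \<Sum>b\<in>onb. (x \<bullet> b) *\<^sub>R f b) = f"
    by (rule ext) (rule linear_onb_expansion[OF assms, symmetric])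
  have "bounded_linear (\<lambda>x. \<Sum>b\<in>onb. (x \<bullet> b) *\<^sub>R f b)"
    by (intro bounded_linear_sum bounded_linear_scaleR_const bounded_linear_inner_left)
  then show ?thesis by (simp only: *)
qed

text \<open>The representing vector is written out over \<open>onb\<close> so that, when the
  functional depends on a parameter, differentiability of the vector can be read off from its
  finitely many coefficients.\<close>

lemma riesz_representation:
  fixes f :: "'a::fin_dim_inner \<Rightarrow> real"
  assumes "linear f"
  shows "(\<Sum>b\<in>onb. f b *\<^sub>R b) \<bullet> y = f y"
  unfolding linear_onb_expansion[OF assms, of y]
  by (simp add: inner_sum_left inner_commute[of y] mult.commute)

text \<open>Coordinates of a Cauchy sequence converge in the reals. Completeness is what the
  contraction principle in \<open>strict_deriv_solvable\<close> requires.\<close>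

lemma complete_fin_dim: "complete (UNIV :: 'a::fin_dim_inner set)"
  unfolding complete_def
proof (intro allI impI)
  fix X :: "nat \<Rightarrow> 'a" assume "(\<forall>n. X n \<in> UNIV) \<and> Cauchy X"
  then have "Cauchy (\<lambda>n. X n \<bullet> b)" for b
    using bounded_linear.Cauchy[OF bounded_linear_inner_left] by blast
  then have "\<exists>l. (\<lambda>n. X n \<bullet> b) \<longlonglongrightarrow> l" for b
    by (meson Cauchy_convergent convergent_def)
  then obtain l where "\<And>b. (\<lambda>n. X n \<bullet> b) \<longlonglongrightarrow> l b" by metis
  then have "(\<lambda>n. \<Sum>b\<in>onb. (X n \<bullet> b) *\<^sub>R b) \<longlonglongrightarrow> (\<Sum>b\<in>onb. l b *\<^sub>R b)"
    by (intro tendsto_intros)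
  then show "\<exists>l\<in>UNIV. X \<longlonglongrightarrow> l" by (auto simp: onb_expansion)
qed

section \<open>Strict differentiability\<close>

text \<open>Strict differentiability: near \<open>x0\<close> the remainder \<open>f - D\<close> is
  Lipschitz with arbitrarily small constant. This is the form in which contraction arguments use a
  continuous derivative.\<close>

definition strict_deriv :: "('a::real_normed_vector \<Rightarrow> 'b::real_normed_vector) \<Rightarrow> ('a \<Rightarrow> 'b) \<Rightarrow> 'a \<Rightarrow> bool"
  where
  "strict_deriv f D x0 \<longleftrightarrow> bounded_linear D \<and>
     (\<forall>e>0. \<exists>d>0. \<forall>x\<in>ball x0 d. \<forall>y\<in>ball x0 d. norm (f y - f x - D (y - x)) \<le> e * norm (y - x))"

text \<open>Mean value inequality for the linearisation error on a small ball. Continuity of the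
  derivative is given only for each fixed direction; in finite dimension a sum over an orthonormal
  basis bounds the operator norm of the variation.\<close>

lemma strict_deriv_of_continuous_derivative:
  fixes f :: "'a::fin_dim_inner \<Rightarrow> 'b::real_normed_vector"
  assumes U: "open U" "x0 \<in> U" and f: "\<And>x. x \<in> U \<Longrightarrow> f differentiable (at x)"
    and cont: "\<And>v. continuous_on U (\<lambda>x. frechet_derivative f (at x) v)"
  shows "strict_deriv f (frechet_derivative f (at x0)) x0"
proof -
  let ?D = "\<lambda>x. frechet_derivative f (at x)"
  have D: "(f has_derivative ?D x) (at x)" if "x \<in> U" for x
    using f that frechet_derivative_works by blast
  have bl: "bounded_linear (?D x)" if "x \<in> U" for x
    using D[OF that] has_derivative_bounded_linear by blast
  have "\<exists>d>0. \<forall>x\<in>ball x0 d. \<forall>y\<in>ball x0 d. norm (f y - f x - ?D x0 (y - x)) \<le> e * norm (y - x)"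
    if that_pos: "e > 0" for e
  proof -
    note that = that_pos
    have "((\<lambda>x. \<Sum>b\<in>onb. norm (?D x b - ?D x0 b)) \<longlongrightarrow> (\<Sum>b\<in>(onb::'a set). norm (?D x0 b - ?D x0 b))) (at x0)"
      using cont U by (intro tendsto_intros) (auto simp: continuous_on_eq_continuous_at isCont_def)
    then have "\<forall>\<^sub>F x in at x0. (\<Sum>b\<in>onb. norm (?D x b - ?D x0 b)) < e"
      using that by (intro order_tendstoD(2)[where y="\<Sum>b\<in>(onb::'a set). norm (?D x0 b - ?D x0 b)"]) simp_all
    then have "\<forall>\<^sub>F x in nhds x0. (\<Sum>b\<in>onb. norm (?D x b - ?D x0 b)) < e \<and> x \<in> U"
    proof (intro eventually_conj)
      assume "\<forall>\<^sub>F x in at x0. (\<Sum>b\<in>onb. norm (?D x b - ?D x0 b)) < e"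
      then show "\<forall>\<^sub>F x in nhds x0. (\<Sum>b\<in>onb. norm (?D x b - ?D x0 b)) < e"
        unfolding eventually_at_filter by (rule eventually_mono) (use that in fastforce)
      show "\<forall>\<^sub>F x in nhds x0. x \<in> U" using U by (simp add: eventually_nhds_in_open)
    qed
    then obtain d where d: "d > 0" "\<And>x. x \<in> ball x0 d \<Longrightarrow> (\<Sum>b\<in>onb. norm (?D x b - ?D x0 b)) < e \<and> x \<in> U"
      by (auto simp: eventually_nhds_metric dist_commute)
    have "norm (f y - f x - ?D x0 (y - x)) \<le> e * norm (y - x)" if xy: "x \<in> ball x0 d" "y \<in> ball x0 d" for x y
    proof -
      have "norm (f y - f x - ?D x0 (y - x)) \<le> norm (y - x) * e"
      proof (rule differentiable_bound_linearization[where S = "ball x0 d" and f' = ?D])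
        fix t :: real assume t: "t \<in> {0..1}"
        have "convex (ball x0 d)" by simp
        then have "(1 - t) *\<^sub>R x + t *\<^sub>R y \<in> ball x0 d"
          using xy t by (simp add: convex_alt)
        then show "x + t *\<^sub>R (y - x) \<in> ball x0 d" by (simp add: algebra_simps)
      next
        fix z assume z: "z \<in> ball x0 d"
        then show "(f has_derivative ?D z) (at z within ball x0 d)"
          using D d has_derivative_at_withinI by blast
        have "norm ((?D z - ?D x0) v) \<le> e * norm v" for v
        proof -
          have lin: "linear (?D z - ?D x0)"
            using bl[of z] bl[OF U(2)] d z
            by (auto simp: fun_diff_def intro!: linear_compose_sub dest: bounded_linear.linear)
          have "norm ((?D z - ?D x0) v) \<le> (\<Sum>b\<in>onb. norm ((v \<bullet> b) *\<^sub>R (?D z - ?D x0) b))"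
            unfolding linear_onb_expansion[OF lin, of v] by (rule norm_sum)
          also have "\<dots> \<le> (\<Sum>b\<in>onb. norm v * norm (?D z b - ?D x0 b))"
          proof (rule sum_mono)
            fix b :: 'a assume "b \<in> onb"
            then have "norm b = 1" using onb_inner[of b b] by (simp add: norm_eq_sqrt_inner)
            then have "\<bar>v \<bullet> b\<bar> \<le> norm v" using Cauchy_Schwarz_ineq2[of v b] by simp
            then show "norm ((v \<bullet> b) *\<^sub>R (?D z - ?D x0) b) \<le> norm v * norm (?D z b - ?D x0 b)"
              by (simp add: mult_right_mono)
          qed
          also have "\<dots> \<le> e * norm v"
            using d(2)[OF z] unfolding sum_distrib_left[symmetric]
            by (subst mult.commute) (intro mult_right_mono, simp_all)
          finally show ?thesis .
        qed
        then show "onorm (?D z - ?D x0) \<le> e"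
          using onorm_bound[of e "?D z - ?D x0"] that_pos by (simp add: less_imp_le)
      qed (use d in simp)
      then show ?thesis by (simp add: mult.commute)
    qed
    then show ?thesis using d(1) by blast
  qed
  then show ?thesis using bl[OF U(2)] by (simp add: strict_deriv_def)
qed

text \<open>Solutions are sought only in the directions \<open>R y\<close>, where \<open>D\<close>
  becomes the identity; there the simplified Newton map is a contraction. The radius d is uniform in
  the starting point x, which lets the equation be solved from points that are not on the fibre
  themselves.\<close>

lemma strict_deriv_solvable:
  fixes f :: "'a::real_normed_vector \<Rightarrow> 'b::fin_dim_inner"
  assumes f: "strict_deriv f D x0" and R: "linear R" "\<And>y. D (R y) = y"
  shows "\<exists>d>0. \<forall>x\<in>ball x0 d. \<forall>w. norm (w - f x) < d \<longrightarrow> (\<exists>y. norm y \<le> 2 * norm (w - f x) \<and> f (x + R y) = w)"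
proof -
  obtain K where K: "K > 0" "\<And>y. norm (R y) \<le> norm y * K"
    using bounded_linear.pos_bounded[OF linear_imp_bounded_linear[OF R(1)]] by blast
  \<comment> \<open>\<open>R\<close> stretches by at most K, so the Lipschitz constant 1 / (2 K) of
    the remainder becomes a contraction factor 1/2.\<close>
  have "1 / (2 * K) > 0" using K by simp
  then obtain r where r: "r > 0"
    "\<And>x y. x \<in> ball x0 r \<Longrightarrow> y \<in> ball x0 r \<Longrightarrow> norm (f y - f x - D (y - x)) \<le> 1 / (2 * K) * norm (y - x)"
    using f unfolding strict_deriv_def by metis
  \<comment> \<open>With x within d of x0 and norm y at most 2 d, the point \<open>x + R y\<close>
    is within d + 2 d K of x0, and this has to stay below r.\<close>
  define d where "d = r / (2 * (1 + 2 * K))"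
  have d: "d > 0" "d + 2 * d * K < r"
    using r(1) K(1) by (auto simp: d_def field_simps add_pos_pos)
  have "\<exists>y. norm y \<le> 2 * norm (w - f x) \<and> f (x + R y) = w"
    if x: "x \<in> ball x0 d" and w: "norm (w - f x) < d" for x w
  proof -
    \<comment> \<open>\<open>T 0\<close> has norm \<rho> / 2 and \<open>T\<close> halves distances,
      so \<open>T\<close> maps the closed ball of radius \<rho> into itself.\<close>
    define \<rho> where "\<rho> = 2 * norm (w - f x)"
    define T where "T y = y - (f (x + R y) - w)" for y
    have in_ball: "x + R y \<in> ball x0 r" if "y \<in> cball 0 \<rho>" for y
    proof -
      have "norm (R y) \<le> 2 * d * K"
        using K(2)[of y] that w K(1) unfolding \<rho>_def
        by (smt (verit, best) mem_cball_0 mult_right_mono)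
      then show ?thesis using x d(2) norm_triangle_ineq4[of "x0 - x" "R y"]
        by (simp add: dist_norm algebra_simps)
    qed
    have lip: "norm (T y - T z) \<le> 1/2 * norm (y - z)" if "y \<in> cball 0 \<rho>" "z \<in> cball 0 \<rho>" for y z
    proof -
      have "D (R y - R z) = y - z"
        using R by (metis linear_diff)
      then have "T y - T z = - (f (x + R y) - f (x + R z) - D ((x + R y) - (x + R z)))"
        by (simp add: T_def)
      then have "norm (T y - T z) = norm (f (x + R y) - f (x + R z) - D ((x + R y) - (x + R z)))"
        by (metis norm_minus_cancel)
      also have "\<dots> \<le> 1 / (2 * K) * norm ((x + R y) - (x + R z))"
        using in_ball that by (intro r(2)) auto
      also have "\<dots> = 1 / (2 * K) * norm (R (y - z))"
        by (simp add: linear_diff[OF R(1)])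
      also have "\<dots> \<le> 1 / (2 * K) * (norm (y - z) * K)"
        using K by (intro mult_left_mono) auto
      finally show ?thesis using K(1) by simp
    qed
    have "\<exists>!y\<in>cball 0 \<rho>. T y = y"
    proof (rule Banach_fix[where c = "1/2"])
      show "complete (cball (0::'b) \<rho>)"
        using complete_closed_subset[OF closed_cball _ complete_fin_dim] by blast
      show "cball (0::'b) \<rho> \<noteq> {}" by (simp add: \<rho>_def)
      have T0: "norm (T 0) = \<rho> / 2"
        by (simp add: T_def \<rho>_def linear_0[OF R(1)] norm_minus_commute)
      show "T ` cball 0 \<rho> \<subseteq> cball 0 \<rho>"
      proof clarify
        fix y :: 'b assume y: "y \<in> cball 0 \<rho>"
        have "norm (T y - T 0) \<le> 1/2 * norm y" using lip[OF y, of 0] y by (simp add: \<rho>_def)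
        then show "T y \<in> cball 0 \<rho>"
          using T0 y norm_triangle_ineq[of "T y - T 0" "T 0"] by simp
      qed
    qed (use lip in \<open>auto simp: dist_norm\<close>)
    then obtain y where "y \<in> cball 0 \<rho>" "T y = y" by blast
    then show ?thesis by (intro exI[of _ y]) (auto simp: T_def \<rho>_def)
  qed
  then show ?thesis using d(1) by blast
qed

text \<open>The section is assembled from arbitrary solutions of
  \<open>strict_deriv_solvable\<close> started at x0. It may be discontinuous elsewhere, but the
  bound on the solutions and the strict estimate force differentiability at the one point
  \<open>f x0\<close>.\<close>

lemma strict_deriv_local_section:
  fixes f :: "'a::real_normed_vector \<Rightarrow> 'b::fin_dim_inner"
  assumes f: "strict_deriv f D x0" and R: "linear R" "\<And>y. D (R y) = y"
  shows "\<exists>\<sigma>. (\<sigma> has_derivative R) (at (f x0)) \<and> \<sigma> (f x0) = x0 \<and> (\<forall>\<^sub>F z in nhds (f x0). f (\<sigma> z) = z)"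
proof -
  obtain d where d: "d > 0"
    "\<forall>x\<in>ball x0 d. \<forall>w. norm (w - f x) < d \<longrightarrow> (\<exists>y. norm y \<le> 2 * norm (w - f x) \<and> f (x + R y) = w)"
    using strict_deriv_solvable[OF assms] by blast
  then have "\<forall>z. \<exists>y. norm (z - f x0) < d \<longrightarrow> norm y \<le> 2 * norm (z - f x0) \<and> f (x0 + R y) = z"
    by simp
  then obtain \<eta> where \<eta>: "\<And>z. norm (z - f x0) < d \<Longrightarrow> norm (\<eta> z) \<le> 2 * norm (z - f x0)"
    "\<And>z. norm (z - f x0) < d \<Longrightarrow> f (x0 + R (\<eta> z)) = z"
    by metis
  have \<eta>0: "\<eta> (f x0) = 0" using \<eta>(1)[of "f x0"] d(1) by simp
  obtain K where K: "K > 0" "\<And>y. norm (R y) \<le> norm y * K"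
    using bounded_linear.pos_bounded[OF linear_imp_bounded_linear[OF R(1)]] by blast
  \<comment> \<open>As \<open>D (R (\<eta> z)) = \<eta> z\<close> and
    \<open>f (x0 + R (\<eta> z)) = z\<close>, the error of \<eta> is the linearisation error of
    \<open>f\<close> along \<open>R (\<eta> z)\<close>, a vector of length at most 2 K times
    \<open>norm (z - f x0)\<close>. This explains the tolerance e / (2 K).\<close>
  have "(\<eta> has_derivative (\<lambda>z. z)) (at (f x0))"
    unfolding has_derivative_at_alt
  proof (intro conjI allI impI)
    fix e :: real assume "e > 0"
    then have "e / (2 * K) > 0" using K by simp
    then obtain r where r: "r > 0"
      "\<And>x y. x \<in> ball x0 r \<Longrightarrow> y \<in> ball x0 r \<Longrightarrow> norm (f y - f x - D (y - x)) \<le> e / (2 * K) * norm (y - x)"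
      using f unfolding strict_deriv_def by metis
    define s where "s = min d (r / (2 * K))"
    have "norm (\<eta> z - \<eta> (f x0) - (z - f x0)) \<le> e * norm (z - f x0)" if "norm (z - f x0) < s" for z
    proof -
      have z: "norm (z - f x0) < d" "norm (z - f x0) * (2 * K) < r"
        using that K by (auto simp: s_def field_simps)
      have Rz: "norm (R (\<eta> z)) \<le> norm (z - f x0) * (2 * K)"
      proof -
        have "norm (R (\<eta> z)) \<le> norm (\<eta> z) * K" by (rule K)
        also have "\<dots> \<le> 2 * norm (z - f x0) * K" using \<eta>(1)[OF z(1)] K by simp
        finally show ?thesis by (simp add: mult_ac)
      qed
      have "norm (\<eta> z - (z - f x0)) = norm (f (x0 + R (\<eta> z)) - f x0 - D ((x0 + R (\<eta> z)) - x0))"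
        using \<eta>(2)[OF z(1)] R(2) by (simp add: norm_minus_commute)
      also have "\<dots> \<le> e / (2 * K) * norm ((x0 + R (\<eta> z)) - x0)"
        using r(1) Rz z(2) by (intro r(2)) (auto simp: dist_norm)
      also have "\<dots> \<le> e / (2 * K) * (norm (z - f x0) * (2 * K))"
        using Rz K \<open>e > 0\<close> by (intro mult_left_mono) auto
      finally show ?thesis using K \<eta>0 by simp
    qed
    moreover have "s > 0" using d r K by (simp add: s_def)
    ultimately show "\<exists>s>0. \<forall>z. norm (z - f x0) < s \<longrightarrow> norm (\<eta> z - \<eta> (f x0) - (z - f x0)) \<le> e * norm (z - f x0)"
      by blast
  qed simp
  then have "((\<lambda>z. x0 + R (\<eta> z)) has_derivative R) (at (f x0))"
    using has_derivative_add[OF has_derivative_const[of x0] bounded_linear.has_derivative[OF linear_imp_bounded_linear[OF R(1)]]]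
    by simp
  moreover have "\<forall>\<^sub>F z in nhds (f x0). f (x0 + R (\<eta> z)) = z"
    unfolding eventually_nhds_metric using \<eta>(2) d(1) by (auto simp: dist_norm)
  ultimately show ?thesis
    by (intro exI[of _ "\<lambda>z. x0 + R (\<eta> z)"]) (simp add: \<eta>0 linear_0[OF R(1)])
qed

text \<open>If \<open>f u = f w\<close>, then \<open>D (u - w)\<close> is pure remainder, hence
  small compared with \<open>u - w\<close>; this contradicts the lower bound for \<open>D\<close> on
  V unless the points agree.\<close>

lemma strict_deriv_locally_inj:
  assumes f: "strict_deriv f D x0" and C: "\<And>u. u \<in> V \<Longrightarrow> norm u \<le> C * norm (D u)"
  shows "\<exists>d>0. \<forall>u\<in>ball x0 d. \<forall>w\<in>ball x0 d. u - w \<in> V \<longrightarrow> f u = f w \<longrightarrow> u = w"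
proof -
  \<comment> \<open>The factor 1/2 is what is left after multiplying by the lower bound constant;
    the added 1 keeps the denominator positive for every C.\<close>
  define e where "e = 1 / (2 * (\<bar>C\<bar> + 1))"
  have "e > 0" by (simp add: e_def add_nonneg_pos)
  then obtain d where d: "d > 0"
      "\<And>x y. x \<in> ball x0 d \<Longrightarrow> y \<in> ball x0 d \<Longrightarrow> norm (f y - f x - D (y - x)) \<le> e * norm (y - x)"
    using f unfolding strict_deriv_def by metis
  have "u = w" if u: "u \<in> ball x0 d" "w \<in> ball x0 d" "u - w \<in> V" "f u = f w" for u w
  proof -
    have "norm (D (u - w)) \<le> e * norm (u - w)"
      using d(2)[OF u(2,1)] u(4) by simp
    then have "norm (u - w) \<le> (\<bar>C\<bar> + 1) * (e * norm (u - w))"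
      using C[OF u(3)] by (smt (verit, ccfv_SIG) mult_mono norm_ge_zero mult_right_mono)
    also have "\<dots> = norm (u - w) / 2" by (simp add: e_def field_simps)
    finally show ?thesis by simp
  qed
  then show ?thesis using d(1) by blast
qed

lemma has_derivative_transform_nhds:
  assumes "(f has_derivative D) (at x)" "\<forall>\<^sub>F z in nhds x. f z = g z"
  shows "(g has_derivative D) (at x)"
proof (rule has_derivative_transform_eventually[OF assms(1)])
  show "\<forall>\<^sub>F z in at x. f z = g z"
    unfolding eventually_at_filter using assms(2) by (rule eventually_mono) simp
  show "f x = g x" using eventually_nhds_x_imp_x[OF assms(2)] .
qed simp

section \<open>Atlases with differentiable transitions\<close>

text \<open>Weaker than smooth compatibility because, unlike the latter, it passes to cotangent bundles
  and products without knowing that smooth maps compose.\<close>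

definition diff_atlas :: "('a, 'e::fin_dim_inner) atlas \<Rightarrow> bool" where
  "diff_atlas M \<longleftrightarrow> (\<forall>c\<in>M. is_chart c) \<and>
     (\<forall>c\<in>M. \<forall>d\<in>M. open (snd c ` (fst c \<inter> fst d)) \<and>
        (\<forall>x\<in>snd c ` (fst c \<inter> fst d). (snd d \<circ> chart_inv c) differentiable (at x)))"

lemma smooth_on_differentiable: "smooth_on U f \<Longrightarrow> x \<in> U \<Longrightarrow> f differentiable (at x)"
  unfolding smooth_on_def using k_smooth_on.simps(2)[of 0 U f] by blast

lemma smooth_on_frechet_derivative: "smooth_on U f \<Longrightarrow> smooth_on U (\<lambda>x. frechet_derivative f (at x) v)"
  unfolding smooth_on_def using k_smooth_on.simps(2) by blast

lemma smooth_on_continuous: "smooth_on U f \<Longrightarrow> continuous_on U f"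
  unfolding smooth_on_def using k_smooth_on.simps(1) by blast

lemma smooth_on_strict_deriv:
  fixes f :: "'a::fin_dim_inner \<Rightarrow> 'b::real_normed_vector"
  assumes "smooth_on U f" "open U" "x \<in> U"
  shows "strict_deriv f (frechet_derivative f (at x)) x"
  using assms by (intro strict_deriv_of_continuous_derivative[of U])
    (auto intro: smooth_on_differentiable smooth_on_continuous smooth_on_frechet_derivative)

lemma smooth_manifold_diff_atlas: "smooth_manifold M \<Longrightarrow> diff_atlas M"
  unfolding smooth_manifold_def diff_atlas_def compatible_def
  using smooth_on_differentiable by blast

lemma diff_atlasD:
  assumes "diff_atlas M" "c \<in> M"
  shows "is_chart c" "d \<in> M \<Longrightarrow> open (snd c ` (fst c \<inter> fst d))"
    "d \<in> M \<Longrightarrow> x \<in> fst c \<Longrightarrow> x \<in> fst d \<Longrightarrow> (snd d \<circ> chart_inv c) differentiable (at (snd c x))"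
    "open (snd c ` fst c)"
  using assms unfolding diff_atlas_def is_chart_def by auto

lemma chart_inv_chart: "is_chart c \<Longrightarrow> x \<in> fst c \<Longrightarrow> chart_inv c (snd c x) = x"
  by (simp add: chart_inv_def is_chart_def)

lemma chart_inv_image:
  assumes "z \<in> snd c ` fst c"
  shows "chart_inv c z \<in> fst c" "snd c (chart_inv c z) = z"
  using assms by (auto simp: chart_inv_def inv_into_into f_inv_into_f)

lemma charts_atD: "c \<in> charts_at M p \<Longrightarrow> c \<in> M" "c \<in> charts_at M p \<Longrightarrow> p \<in> fst c"
  by (auto simp: charts_at_def)

lemma charts_at_point: "c \<in> charts_at M p \<Longrightarrow> p \<in> points M"
  by (auto simp: charts_at_def points_def)

lemma chart_at_in: "p \<in> points M \<Longrightarrow> chart_at M p \<in> charts_at M p"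
  unfolding chart_at_def points_def charts_at_def by (rule someI_ex) auto

lemma eventually_in_chart:
  assumes "diff_atlas M" "c \<in> charts_at M p" "d \<in> charts_at M p"
  shows "\<forall>\<^sub>F z in nhds (snd c p). chart_inv c z \<in> fst c \<and> snd c (chart_inv c z) = z \<and> chart_inv c z \<in> fst d"
proof -
  let ?U = "snd c ` (fst c \<inter> fst d)"
  have "open ?U" "snd c p \<in> ?U"
    using assms by (auto simp: charts_at_def intro: diff_atlasD)
  then have "\<forall>\<^sub>F z in nhds (snd c p). z \<in> ?U" by (simp add: eventually_nhds_in_open)
  then show ?thesis
    by (rule eventually_mono)
      (use assms in \<open>auto simp: charts_at_def chart_inv_chart diff_atlasD(1)\<close>)
qed

section \<open>The topology generated by an atlas\<close>

lemma mtop_topspace: "topspace (mtop M) = points M"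
proof -
  have "\<exists>D W. fst c = fst D \<inter> snd D -` W \<and> D \<in> M \<and> open W" if "c \<in> M" for c
    using that by (intro exI[of _ c] exI[of _ UNIV]) auto
  then show ?thesis
    unfolding mtop_def points_def topology_generated_by_topspace by auto
qed

lemma openin_chart_vimage: "c \<in> M \<Longrightarrow> open W \<Longrightarrow> openin (mtop M) (fst c \<inter> snd c -` W)"
  unfolding mtop_def by (rule topology_generated_by_Basis) blast

lemma openin_chart_domain: "c \<in> M \<Longrightarrow> openin (mtop M) (fst c)"
  using openin_chart_vimage[of c M UNIV] by simp

text \<open>Induction over the generation of the topology. Intersections use injectivity of the
  chart, generating sets the continuity of the transition maps.\<close>

lemma open_chart_image:
  assumes M: "diff_atlas M" and c: "c \<in> M" and "openin (mtop M) U"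
  shows "open (snd c ` (fst c \<inter> U))"
proof -
  have inj: "inj_on (snd c) (fst c)"
    using diff_atlasD(1)[OF M c] by (simp add: is_chart_def)
  have "generate_topology_on {fst c \<inter> snd c -` W | c W. c \<in> M \<and> open W} U"
    using assms by (simp add: mtop_def openin_topology_generated_by_iff)
  then show ?thesis
  proof induction
    case Empty
    then show ?case by simp
  next
    case (Int U V)
    have "snd c ` (fst c \<inter> (U \<inter> V)) = snd c ` (fst c \<inter> U) \<inter> snd c ` (fst c \<inter> V)"
      using inj by (auto simp: inj_on_def)
    then show ?case using Int by auto
  next
    case (UN K)
    have "snd c ` (fst c \<inter> \<Union> K) = (\<Union>U\<in>K. snd c ` (fst c \<inter> U))" by auto
    then show ?case using UN by auto
  next
    case (Basis s)
    then obtain d W where d: "s = fst d \<inter> snd d -` W" "d \<in> M" "open W" by blast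
    let ?V = "snd c ` (fst c \<inter> fst d)"
    have "continuous_on ?V (snd d \<circ> chart_inv c)"
      using diff_atlasD(3)[OF M c d(2)]
      by (intro differentiable_imp_continuous_on) (auto simp: differentiable_on_def intro: differentiable_at_withinI)
    then have "open (?V \<inter> (snd d \<circ> chart_inv c) -` W)"
      using diff_atlasD(2)[OF M c d(2)] d(3) by (simp add: continuous_open_preimage)
    moreover have "?V \<inter> (snd d \<circ> chart_inv c) -` W = snd c ` (fst c \<inter> s)"
      using chart_inv_chart[OF diff_atlasD(1)[OF M c]] by (auto simp: d(1))
    ultimately show ?case by simp
  qed
qed

section \<open>Differentiability at a point and the chain rule\<close>

text \<open>A chart is arbitrary outside its domain, so the composite with \<open>f\<close> has
  meaning only if \<open>f\<close> stays in the domain of the target chart near the point. This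
  condition is the trace of continuity that the chain rule needs. All pairs of charts are
  quantified, so that any chart can be used later.\<close>

definition mdiff ::
  "('a, 'e::fin_dim_inner) atlas \<Rightarrow> ('b, 'f::fin_dim_inner) atlas \<Rightarrow> ('a \<Rightarrow> 'b) \<Rightarrow> 'a \<Rightarrow> bool" where
  "mdiff M N f p \<longleftrightarrow> p \<in> points M \<and> f p \<in> points N \<and>
     (\<forall>c\<in>charts_at M p. \<forall>d\<in>charts_at N (f p).
        (\<forall>\<^sub>F z in nhds (snd c p). f (chart_inv c z) \<in> fst d) \<and>
        (snd d \<circ> f \<circ> chart_inv c) differentiable (at (snd c p)))"

definition cderiv ::
  "('a, 'e::real_normed_vector) chart \<Rightarrow> ('b, 'f::real_normed_vector) chart \<Rightarrow> ('a \<Rightarrow> 'b) \<Rightarrow> 'a \<Rightarrow> 'e \<Rightarrow> 'f" where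
  "cderiv c d f p = frechet_derivative (snd d \<circ> f \<circ> chart_inv c) (at (snd c p))"

lemma mdiffD:
  assumes "mdiff M N f p"
  shows "p \<in> points M" "f p \<in> points N"
    "c \<in> charts_at M p \<Longrightarrow> d \<in> charts_at N (f p) \<Longrightarrow> \<forall>\<^sub>F z in nhds (snd c p). f (chart_inv c z) \<in> fst d"
    "c \<in> charts_at M p \<Longrightarrow> d \<in> charts_at N (f p) \<Longrightarrow>
      (snd d \<circ> f \<circ> chart_inv c has_derivative cderiv c d f p) (at (snd c p))"
  using assms unfolding mdiff_def cderiv_def by (auto simp: frechet_derivative_works)

lemma cderiv_linear:
  assumes "mdiff M N f p" "c \<in> charts_at M p" "d \<in> charts_at N (f p)"
  shows "linear (cderiv c d f p)"
  using mdiffD(4)[OF assms] has_derivative_linear by blast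

lemma cderivI: "(snd d \<circ> f \<circ> chart_inv c has_derivative D) (at (snd c p)) \<Longrightarrow> cderiv c d f p = D"
  unfolding cderiv_def by (rule frechet_derivative_at[symmetric])

text \<open>The two coordinate expressions of \<open>g \<circ> f\<close> agree only near the point,
  which is enough for derivatives. Since \<open>cderiv c d id p\<close> is the Jacobian of a chart
  transition, the case where one map is \<open>id\<close> yields all change of chart rules.\<close>

lemma mdiff_chain:
  assumes M: "diff_atlas M" and N: "diff_atlas N" and f: "mdiff M N f p" and g: "mdiff N P g (f p)"
  shows "mdiff M P (g \<circ> f) p"
    and "c \<in> charts_at M p \<Longrightarrow> d \<in> charts_at N (f p) \<Longrightarrow> e \<in> charts_at P (g (f p)) \<Longrightarrow>
      cderiv c e (g \<circ> f) p = cderiv d e g (f p) \<circ> cderiv c d f p"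
proof -
  have main: "(\<forall>\<^sub>F z in nhds (snd c p). (g \<circ> f) (chart_inv c z) \<in> fst e) \<and>
      (snd e \<circ> (g \<circ> f) \<circ> chart_inv c has_derivative cderiv d e g (f p) \<circ> cderiv c d f p) (at (snd c p))"
    if c: "c \<in> charts_at M p" and d: "d \<in> charts_at N (f p)" and e: "e \<in> charts_at P (g (f p))" for c d e
  proof -
    have inv_c: "chart_inv c (snd c p) = p" and inv_d: "\<And>x. x \<in> fst d \<Longrightarrow> chart_inv d (snd d x) = x"
      using M N c d by (auto simp: charts_at_def chart_inv_chart diff_atlasD(1))
    note f' = mdiffD(4)[OF f c d] and g' = mdiffD(4)[OF g d e]
    have near: "\<forall>\<^sub>F z in nhds (snd c p). f (chart_inv c z) \<in> fst d"
      using mdiffD(3)[OF f c d] .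
    have "((snd d \<circ> f \<circ> chart_inv c) \<longlongrightarrow> snd d (f p)) (nhds (snd c p))"
      using has_derivative_continuous[OF f', unfolded continuous_at tendsto_at_iff_tendsto_nhds]
      by (simp only: o_apply inv_c)
    then have "\<forall>\<^sub>F z in nhds (snd c p). g (chart_inv d ((snd d \<circ> f \<circ> chart_inv c) z)) \<in> fst e"
      by (rule eventually_compose_filterlim[OF mdiffD(3)[OF g d e]])
    with near have 1: "\<forall>\<^sub>F z in nhds (snd c p). (g \<circ> f) (chart_inv c z) \<in> fst e"
      by eventually_elim (simp add: inv_d)
    have eq: "\<forall>\<^sub>F z in nhds (snd c p). ((snd e \<circ> g \<circ> chart_inv d) \<circ> (snd d \<circ> f \<circ> chart_inv c)) z = (snd e \<circ> (g \<circ> f) \<circ> chart_inv c) z"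
      using near by eventually_elim (simp add: inv_d)
    have "((snd e \<circ> g \<circ> chart_inv d) \<circ> (snd d \<circ> f \<circ> chart_inv c) has_derivative cderiv d e g (f p) \<circ> cderiv c d f p) (at (snd c p))"
      using f' g' inv_c by (intro diff_chain_at) simp_all
    then have "(snd e \<circ> (g \<circ> f) \<circ> chart_inv c has_derivative cderiv d e g (f p) \<circ> cderiv c d f p) (at (snd c p))"
      using eq by (rule has_derivative_transform_nhds)
    with 1 show ?thesis by blast
  qed
  note d0 = chart_at_in[OF mdiffD(2)[OF f]]
  show "mdiff M P (g \<circ> f) p"
    unfolding mdiff_def differentiable_def comp_apply[of g f p]
    using mdiffD(1)[OF f] mdiffD(2)[OF g] main[OF _ d0] by blast
  show "cderiv c e (g \<circ> f) p = cderiv d e g (f p) \<circ> cderiv c d f p"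
    if "c \<in> charts_at M p" "d \<in> charts_at N (f p)" "e \<in> charts_at P (g (f p))"
    using main[OF that] by (intro cderivI) blast
qed

lemma mdiff_id:
  assumes "diff_atlas M" "p \<in> points M"
  shows "mdiff M M id p"
  unfolding mdiff_def
proof (intro conjI ballI)
  fix c d assume cd: "c \<in> charts_at M p" "d \<in> charts_at M (id p)"
  show "\<forall>\<^sub>F z in nhds (snd c p). id (chart_inv c z) \<in> fst d"
    using eventually_in_chart[OF assms(1) cd(1), of d] cd(2) by (auto elim: eventually_mono)
  show "snd d \<circ> id \<circ> chart_inv c differentiable at (snd c p)"
    using diff_atlasD(3)[OF assms(1)] cd by (simp add: charts_at_def)
qed (use assms in auto)

lemma cderiv_id_same:
  assumes "diff_atlas M" "c \<in> charts_at M p"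
  shows "cderiv c c id p = id"
proof (rule cderivI)
  have ev: "\<forall>\<^sub>F z in nhds (snd c p). id z = (snd c \<circ> id \<circ> chart_inv c) z"
    using eventually_in_chart[OF assms assms(2)] by eventually_elim simp
  have "(id has_derivative id) (at (snd c p))" by (simp add: id_def)
  then show "(snd c \<circ> id \<circ> chart_inv c has_derivative id) (at (snd c p))"
    using ev by (rule has_derivative_transform_nhds)
qed

lemma eventually_chart_points:
  assumes "diff_atlas M" "c \<in> charts_at M p" "\<And>x. x \<in> points M \<Longrightarrow> P x"
  shows "\<forall>\<^sub>F z in nhds (snd c p). P (chart_inv c z)"
  using eventually_in_chart[OF assms(1,2,2)]
  by eventually_elim (use assms(2,3) in \<open>auto simp: charts_at_def points_def\<close>)

text \<open>Identities for a group action hold on the points of the manifold only, while functions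
  are total; near \<open>snd c p\<close> the inverse chart takes values in
  \<open>points M\<close>.\<close>

lemma cderiv_cong:
  assumes "diff_atlas M" "c \<in> charts_at M p" "\<And>x. x \<in> points M \<Longrightarrow> f x = g x"
  shows "cderiv c d f p = cderiv c d g p"
    "(snd d \<circ> f \<circ> chart_inv c) differentiable (at (snd c p)) \<longleftrightarrow> (snd d \<circ> g \<circ> chart_inv c) differentiable (at (snd c p))"
proof -
  have ev: "\<forall>\<^sub>F z in nhds (snd c p). (snd d \<circ> f \<circ> chart_inv c) z = (snd d \<circ> g \<circ> chart_inv c) z"
    using eventually_chart_points[OF assms(1,2), of "\<lambda>x. f x = g x"] assms(3)
    by (auto elim!: eventually_mono)
  have ev': "\<forall>\<^sub>F z in nhds (snd c p). (snd d \<circ> g \<circ> chart_inv c) z = (snd d \<circ> f \<circ> chart_inv c) z"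
    using ev by eventually_elim simp
  have "(snd d \<circ> f \<circ> chart_inv c has_derivative D) (at (snd c p)) \<longleftrightarrow> (snd d \<circ> g \<circ> chart_inv c has_derivative D) (at (snd c p))" for D
    using has_derivative_transform_nhds[OF _ ev] has_derivative_transform_nhds[OF _ ev'] by blast
  then show "cderiv c d f p = cderiv c d g p"
    "(snd d \<circ> f \<circ> chart_inv c) differentiable (at (snd c p)) \<longleftrightarrow> (snd d \<circ> g \<circ> chart_inv c) differentiable (at (snd c p))"
    by (simp_all add: cderiv_def frechet_derivative_def differentiable_def)
qed

text \<open>Smoothness is stated on this coordinate domain; continuity with respect to
  \<open>mtop\<close> makes it open, so derivatives there are ordinary ones.\<close>

lemma smooth_map_chart_open:
  assumes "diff_atlas M" "smooth_map M N f" "c \<in> M" "d \<in> N"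
  shows "open (snd c ` (fst c \<inter> f -` fst d))"
proof -
  have "openin (mtop M) {x \<in> topspace (mtop M). f x \<in> fst d}"
    using assms openin_chart_domain openin_continuous_map_preimage unfolding smooth_map_def by blast
  then have "open (snd c ` (fst c \<inter> {x \<in> topspace (mtop M). f x \<in> fst d}))"
    using assms open_chart_image by blast
  moreover have "fst c \<inter> {x \<in> topspace (mtop M). f x \<in> fst d} = fst c \<inter> f -` fst d"
    using assms(3) by (auto simp: mtop_topspace points_def)
  ultimately show ?thesis by simp
qed

lemma smooth_map_points:
  assumes "smooth_map M N f" "p \<in> points M"
  shows "f p \<in> points N"
  using assms unfolding smooth_map_def continuous_map_def by (auto simp: mtop_topspace)

lemma smooth_map_mdiff:
  assumes M: "diff_atlas M" and f: "smooth_map M N f" and p: "p \<in> points M"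
  shows "mdiff M N f p"
  unfolding mdiff_def
proof (intro conjI ballI)
  show "p \<in> points M" "f p \<in> points N" using p smooth_map_points[OF f] by auto
  fix c d assume cd: "c \<in> charts_at M p" "d \<in> charts_at N (f p)"
  let ?U = "snd c ` (fst c \<inter> f -` fst d)"
  have U: "open ?U" "snd c p \<in> ?U" "smooth_on ?U (snd d \<circ> f \<circ> chart_inv c)"
    using smooth_map_chart_open[OF M f] cd f by (auto simp: charts_at_def smooth_map_def)
  then show "snd d \<circ> f \<circ> chart_inv c differentiable at (snd c p)"
    using smooth_on_differentiable by blast
  have "\<forall>\<^sub>F z in nhds (snd c p). z \<in> ?U" using U by (simp add: eventually_nhds_in_open)
  then show "\<forall>\<^sub>F z in nhds (snd c p). f (chart_inv c z) \<in> fst d"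
    by eventually_elim (use cd in \<open>auto simp: charts_at_def chart_inv_chart diff_atlasD(1)[OF M]\<close>)
qed

lemma smooth_map_strict_deriv:
  assumes M: "diff_atlas M" and f: "smooth_map M N f" and c: "c \<in> charts_at M p" and d: "d \<in> charts_at N (f p)"
  shows "strict_deriv (snd d \<circ> f \<circ> chart_inv c) (cderiv c d f p) (snd c p)"
  unfolding cderiv_def
  using smooth_map_chart_open[OF M f] c d f
  by (intro smooth_on_strict_deriv[of "snd c ` (fst c \<inter> f -` fst d)"]) (auto simp: charts_at_def smooth_map_def)

section \<open>Tangent spaces in coordinates\<close>

lemma tspace_iff:
  "v \<in> tspace M p \<longleftrightarrow> (\<forall>c\<in>charts_at M p. \<forall>d\<in>charts_at M p. v d = cderiv c d id p (v c)) \<and>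
     (\<forall>c. c \<notin> charts_at M p \<longrightarrow> v c = 0)"
  by (simp add: tspace_def cderiv_def)

lemma tspace_component:
  "v \<in> tspace M p \<Longrightarrow> c \<in> charts_at M p \<Longrightarrow> d \<in> charts_at M p \<Longrightarrow> v d = cderiv c d id p (v c)"
  unfolding tspace_iff by blast

lemma tspace_outside: "v \<in> tspace M p \<Longrightarrow> c \<notin> charts_at M p \<Longrightarrow> v c = 0"
  unfolding tspace_iff by blast

lemma tspace_eqI:
  assumes "v \<in> tspace M p" "w \<in> tspace M p" "c \<in> charts_at M p" "v c = w c"
  shows "v = w"
proof
  fix d show "v d = w d"
    using assms tspace_component[of v M p c d] tspace_component[of w M p c d]
      tspace_outside[of v M p d] tspace_outside[of w M p d] by (cases "d \<in> charts_at M p") auto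
qed

lemma chart_vec_component: "d \<in> charts_at M p \<Longrightarrow> chart_vec M p c y d = cderiv c d id p y"
  by (simp add: chart_vec_def cderiv_def)

lemma chart_vec_same:
  assumes "diff_atlas M" "c \<in> charts_at M p"
  shows "chart_vec M p c y c = y"
  using cderiv_id_same[OF assms] assms(2) by (simp add: chart_vec_component)

lemma chart_vec_in:
  assumes M: "diff_atlas M" and c: "c \<in> charts_at M p"
  shows "chart_vec M p c y \<in> tspace M p"
  unfolding tspace_iff
proof (intro conjI ballI allI impI)
  fix d e assume de: "d \<in> charts_at M p" "e \<in> charts_at M p"
  have id: "mdiff M M id p" using mdiff_id[OF M charts_at_point[OF c]] .
  have "cderiv c e (id \<circ> id) p = cderiv d e id (id p) \<circ> cderiv c d id p"
    by (rule mdiff_chain(2)[OF M M, where P = M]) (simp_all add: c de id)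
  then show "chart_vec M p c y e = cderiv d e id p (chart_vec M p c y d)"
    using de by (simp add: chart_vec_component fun_eq_iff)
qed (auto simp: chart_vec_def)

lemma chart_vec_of_component:
  assumes "diff_atlas M" "c \<in> charts_at M p" "v \<in> tspace M p"
  shows "chart_vec M p c (v c) = v"
  using assms by (intro tspace_eqI[of _ M p _ c]) (simp_all add: chart_vec_in chart_vec_same)

lemma lincomb_in:
  assumes M: "diff_atlas M" and p: "p \<in> points M" and "v \<in> tspace M p" "w \<in> tspace M p"
  shows "lincomb a v b w \<in> tspace M p"
  unfolding tspace_iff
proof (intro conjI ballI allI impI)
  fix c d assume cd: "c \<in> charts_at M p" "d \<in> charts_at M p"
  have "linear (cderiv c d id p)"
    using cderiv_linear[OF mdiff_id[OF M p]] cd by simp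
  then show "lincomb a v b w d = cderiv c d id p (lincomb a v b w c)"
    using tspace_component[OF assms(3) cd] tspace_component[OF assms(4) cd]
    by (simp add: lincomb_def linear_add linear_scale)
qed (use assms in \<open>auto simp: lincomb_def tspace_outside\<close>)

lemma lincomb_component: "lincomb a v b w c = a *\<^sub>R v c + b *\<^sub>R w c"
  by (simp add: lincomb_def)

lemma zero_in_tspace:
  assumes "diff_atlas M" "p \<in> points M"
  shows "(\<lambda>_. 0) \<in> tspace M p"
  using linear_0[OF cderiv_linear[OF mdiff_id[OF assms]]] by (auto simp: tspace_iff)

lemma chart_vec_lincomb:
  assumes "diff_atlas M" "c \<in> charts_at M p"
  shows "chart_vec M p c (a *\<^sub>R y + b *\<^sub>R z) = lincomb a (chart_vec M p c y) b (chart_vec M p c z)"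
  using assms by (intro tspace_eqI[of _ M p _ c])
    (simp_all add: chart_vec_in lincomb_in chart_vec_same lincomb_component charts_at_point[OF assms(2)])

text \<open>Independence of the chart chosen in \<open>tmap\<close>: the chain rule for
  \<open>f \<circ> id\<close> absorbs the transition from the chosen chart to c.\<close>

lemma tmap_component:
  assumes M: "diff_atlas M" and f: "mdiff M N f p" and v: "v \<in> tspace M p"
    and c: "c \<in> charts_at M p" and d: "d \<in> charts_at N (f p)"
  shows "tmap M N f p v d = cderiv c d f p (v c)"
proof -
  let ?c = "chart_at M p"
  have c': "?c \<in> charts_at M p" using chart_at_in[OF mdiffD(1)[OF f]] .
  have "cderiv ?c d (f \<circ> id) p = cderiv c d f (id p) \<circ> cderiv ?c c id p"
    by (rule mdiff_chain(2)[OF M M, where P = N]) (simp_all add: c c' d f mdiff_id[OF M mdiffD(1)[OF f]])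
  then have "cderiv ?c d f p (v ?c) = cderiv c d f p (v c)"
    using tspace_component[OF v c' c] by (simp add: fun_eq_iff)
  then show ?thesis using d by (simp add: tmap_def cderiv_def Let_def)
qed

lemma tmap_outside: "d \<notin> charts_at N (f p) \<Longrightarrow> tmap M N f p v d = 0"
  by (simp add: tmap_def Let_def)

lemma tmap_eqI:
  assumes "diff_atlas M" "mdiff M N f p" "v \<in> tspace M p" "c \<in> charts_at M p"
    and "d \<in> charts_at N (f p)" "w \<in> tspace N (f p)" "diff_atlas N"
    and "w d = cderiv c d f p (v c)"
  shows "tmap M N f p v = w"
proof
  fix e show "tmap M N f p v e = w e"
  proof (cases "e \<in> charts_at N (f p)")
    case True
    have "cderiv c e (id \<circ> f) p = cderiv d e id (f p) \<circ> cderiv c d f p"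
      by (rule mdiff_chain(2)[OF assms(1,7,2), where P = N])
        (simp_all add: assms True mdiff_id[OF assms(7) mdiffD(2)[OF assms(2)]])
    then show ?thesis
      using tmap_component[OF assms(1-4) True] tspace_component[OF assms(6,5) True] assms(8)
      by (simp add: fun_eq_iff)
  qed (use tmap_outside tspace_outside assms in metis)
qed

lemma tmap_in:
  assumes "diff_atlas M" "diff_atlas N" "mdiff M N f p" "v \<in> tspace M p"
  shows "tmap M N f p v \<in> tspace N (f p)"
proof -
  let ?c = "chart_at M p" and ?d = "chart_at N (f p)"
  have c: "?c \<in> charts_at M p" "?d \<in> charts_at N (f p)"
    using mdiffD(1,2)[OF assms(3)] by (simp_all add: chart_at_in)
  have "tmap M N f p v = chart_vec N (f p) ?d (cderiv ?c ?d f p (v ?c))"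
    using assms c by (intro tmap_eqI[of _ _ _ _ _ ?c ?d]) (simp_all add: chart_vec_in chart_vec_same)
  then show ?thesis using chart_vec_in[OF assms(2) c(2)] by simp
qed

lemma tmap_comp:
  assumes M: "diff_atlas M" "diff_atlas N" "diff_atlas P" and f: "mdiff M N f p" and g: "mdiff N P g (f p)"
    and v: "v \<in> tspace M p"
  shows "tmap M P (g \<circ> f) p v = tmap N P g (f p) (tmap M N f p v)"
proof -
  let ?c = "chart_at M p" and ?d = "chart_at N (f p)" and ?e = "chart_at P (g (f p))"
  have c: "?c \<in> charts_at M p" "?d \<in> charts_at N (f p)" "?e \<in> charts_at P (g (f p))"
    using mdiffD(1,2)[OF f] mdiffD(2)[OF g] by (simp_all add: chart_at_in)
  show ?thesis
    using M f g v c
    by (intro tmap_eqI[of _ _ _ _ _ ?c ?e])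
      (simp_all add: mdiff_chain(1)[OF M(1,2) f g] mdiff_chain(2)[OF M(1,2) f g c] tmap_in
        tmap_component[OF M(1) f v c(1,2)] tmap_component[OF M(2) g tmap_in[OF M(1,2) f v] c(2,3)])
qed

lemma tmap_cong:
  assumes "diff_atlas M" "p \<in> points M" "\<And>x. x \<in> points M \<Longrightarrow> f x = g x"
  shows "tmap M N f p = tmap M N g p"
proof (intro ext)
  fix v d
  show "tmap M N f p v d = tmap M N g p v d"
    using cderiv_cong(1)[OF assms(1) chart_at_in[OF assms(2)] assms(3), where d = d] assms(3)[OF assms(2)]
    unfolding tmap_def Let_def cderiv_def by simp
qed

lemma tmap_id:
  assumes "diff_atlas M" "p \<in> points M" "v \<in> tspace M p"
  shows "tmap M M id p v = v"
  using assms chart_at_in[OF assms(2)] mdiff_id cderiv_id_same[OF assms(1)]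
  by (intro tmap_eqI[of _ _ _ _ _ "chart_at M p" "chart_at M p"]) auto

lemma tmap_lincomb:
  assumes "diff_atlas M" "diff_atlas N" "mdiff M N f p" "v \<in> tspace M p" "w \<in> tspace M p"
  shows "tmap M N f p (lincomb a v b w) = lincomb a (tmap M N f p v) b (tmap M N f p w)"
proof -
  let ?c = "chart_at M p" and ?d = "chart_at N (f p)"
  have c: "?c \<in> charts_at M p" "?d \<in> charts_at N (f p)"
    using mdiffD(1,2)[OF assms(3)] by (simp_all add: chart_at_in)
  have p: "p \<in> points M" "f p \<in> points N" using mdiffD[OF assms(3)] by auto
  show ?thesis
    using assms c p
    by (intro tmap_eqI[of _ _ _ _ _ ?c ?d])
      (simp_all add: lincomb_in tmap_in tmap_component[OF assms(1,3) _ c] lincomb_component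
        linear_add[OF cderiv_linear[OF assms(3) c]] linear_scale[OF cderiv_linear[OF assms(3) c]])
qed

section \<open>Model spaces and products as manifolds\<close>

lemma vector_space_chart:
  "charts_at vector_space_atlas t = {(UNIV, id)}" "chart_inv (UNIV, id) = id"
  "points vector_space_atlas = UNIV"
  by (auto simp: vector_space_atlas_def charts_at_def chart_inv_def points_def)

lemma diff_atlas_vector_space: "diff_atlas (vector_space_atlas :: ('e::fin_dim_inner, 'e) atlas)"
  unfolding diff_atlas_def vector_space_atlas_def is_chart_def
  using differentiable_ident by (auto simp: vector_space_chart(2) simp flip: id_def)

lemma prod_chart_inv:
  assumes "x \<in> snd c ` fst c" "y \<in> snd d ` fst d" "is_chart c" "is_chart d"
  shows "chart_inv (fst c \<times> fst d, map_prod (snd c) (snd d)) (x, y) = (chart_inv c x, chart_inv d y)"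
  unfolding chart_inv_def[of "(_, _)"]
  using assms chart_inv_image[OF assms(1)] chart_inv_image[OF assms(2)]
  by (intro inv_into_f_eq) (auto simp: is_chart_def intro: map_prod_inj_on)

lemma points_prod: "points (prod_atlas M N) = points M \<times> points N"
  by (force simp: points_def prod_atlas_def)

lemma charts_at_prod:
  "charts_at (prod_atlas M N) (x, y) =
     {(fst c \<times> fst d, map_prod (snd c) (snd d)) | c d. c \<in> charts_at M x \<and> d \<in> charts_at N y}"
proof (intro equalityI subsetI)
  fix e assume "e \<in> charts_at (prod_atlas M N) (x, y)"
  then obtain c d where "e = (fst c \<times> fst d, map_prod (snd c) (snd d))" "c \<in> M" "d \<in> N" "(x, y) \<in> fst e"
    unfolding charts_at_def prod_atlas_def by blast
  then show "e \<in> {(fst c \<times> fst d, map_prod (snd c) (snd d)) | c d. c \<in> charts_at M x \<and> d \<in> charts_at N y}"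
    unfolding charts_at_def by auto
next
  fix e assume "e \<in> {(fst c \<times> fst d, map_prod (snd c) (snd d)) | c d. c \<in> charts_at M x \<and> d \<in> charts_at N y}"
  then obtain c d where "e = (fst c \<times> fst d, map_prod (snd c) (snd d))" "c \<in> M" "x \<in> fst c" "d \<in> N" "y \<in> fst d"
    unfolding charts_at_def by blast
  then show "e \<in> charts_at (prod_atlas M N) (x, y)"
    unfolding charts_at_def prod_atlas_def by auto
qed

lemma differentiable_Pair_at:
  assumes "f differentiable (at x)" "g differentiable (at x)"
  shows "(\<lambda>x. (f x, g x)) differentiable (at x)"
proof -
  obtain D E where "(f has_derivative D) (at x)" "(g has_derivative E) (at x)"
    using assms unfolding differentiable_def by blast
  from has_derivative_Pair[OF this] show ?thesis unfolding differentiable_def by blast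
qed

lemma differentiable_compose_fst:
  assumes "f differentiable (at (fst z))"
  shows "(\<lambda>z. f (fst z)) differentiable (at z)"
proof -
  obtain D where "(f has_derivative D) (at (fst z))" using assms unfolding differentiable_def by blast
  from has_derivative_compose[OF has_derivative_fst[OF has_derivative_ident] this] show ?thesis
    unfolding differentiable_def by blast
qed

lemma differentiable_compose_snd:
  assumes "f differentiable (at (snd z))"
  shows "(\<lambda>z. f (snd z)) differentiable (at z)"
proof -
  obtain D where "(f has_derivative D) (at (snd z))" using assms unfolding differentiable_def by blast
  from has_derivative_compose[OF has_derivative_snd[OF has_derivative_ident] this] show ?thesis
    unfolding differentiable_def by blast
qed

lemma differentiable_transform_eventually:
  assumes "f differentiable (at x)" "\<forall>\<^sub>F z in nhds x. f z = g z"
  shows "g differentiable (at x)"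
proof -
  obtain D where "(f has_derivative D) (at x)" using assms(1) differentiable_def by blast
  then have "(g has_derivative D) (at x)"
    using assms(2) by (rule has_derivative_transform_nhds)
  then show ?thesis using differentiable_def by blast
qed

lemma diff_atlas_prod:
  assumes M: "diff_atlas M" and N: "diff_atlas N"
  shows "diff_atlas (prod_atlas M N)"
proof -
  let ?pc = "\<lambda>c d. (fst c \<times> fst d, map_prod (snd c) (snd d))"
  have img: "map_prod f g ` (A \<times> B \<inter> A' \<times> B') = f ` (A \<inter> A') \<times> g ` (B \<inter> B')"
    for f :: "'a \<Rightarrow> 'b" and g :: "'c \<Rightarrow> 'd" and A B A' B'
    by (auto simp: map_prod_def)
  have "is_chart (?pc c d)" if "c \<in> M" "d \<in> N" for c d
    using diff_atlasD(1)[OF M that(1)] diff_atlasD(1)[OF N that(2)]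
    by (auto simp: is_chart_def map_prod_surj_on[OF refl refl] intro: map_prod_inj_on open_Times)
  moreover have "open (snd (?pc c d) ` (fst (?pc c d) \<inter> fst (?pc c' d'))) \<and>
      (\<forall>x\<in>snd (?pc c d) ` (fst (?pc c d) \<inter> fst (?pc c' d')). (snd (?pc c' d') \<circ> chart_inv (?pc c d)) differentiable (at x))"
    if c: "c \<in> M" "c' \<in> M" and d: "d \<in> N" "d' \<in> N" for c d c' d'
  proof -
    let ?U = "snd c ` (fst c \<inter> fst c') \<times> snd d ` (fst d \<inter> fst d')"
    have U: "snd (?pc c d) ` (fst (?pc c d) \<inter> fst (?pc c' d')) = ?U" by (simp add: img)
    have op: "open ?U" using diff_atlasD(2)[OF M c] diff_atlasD(2)[OF N d] by (rule open_Times)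
    have "(snd (?pc c' d') \<circ> chart_inv (?pc c d)) differentiable (at z)" if z: "z \<in> ?U" for z
    proof (rule differentiable_transform_eventually)
      show "(\<lambda>z. ((snd c' \<circ> chart_inv c) (fst z), (snd d' \<circ> chart_inv d) (snd z))) differentiable (at z)"
        using z diff_atlasD(3)[OF M c] diff_atlasD(3)[OF N d]
          differentiable_compose_fst[of "snd c' \<circ> chart_inv c" z] differentiable_compose_snd[of "snd d' \<circ> chart_inv d" z]
        by (intro differentiable_Pair_at) auto
      have "\<forall>\<^sub>F w in nhds z. w \<in> ?U" using op z by (simp add: eventually_nhds_in_open)
      then show "\<forall>\<^sub>F w in nhds z. ((snd c' \<circ> chart_inv c) (fst w), (snd d' \<circ> chart_inv d) (snd w)) =
          (snd (?pc c' d') \<circ> chart_inv (?pc c d)) w"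
      proof eventually_elim
        case (elim w)
        have "chart_inv (?pc c d) (fst w, snd w) = (chart_inv c (fst w), chart_inv d (snd w))"
          using elim diff_atlasD(1)[OF M c(1)] diff_atlasD(1)[OF N d(1)] by (intro prod_chart_inv) auto
        then show ?case by simp
      qed
    qed
    then show ?thesis using op unfolding U by blast
  qed
  ultimately show ?thesis unfolding diff_atlas_def prod_atlas_def by blast
qed

lemma mdiff_Pair_const:
  assumes M: "diff_atlas M" and N: "diff_atlas N" and a: "a \<in> points M" and b: "b \<in> points N"
  shows "mdiff N (prod_atlas M N) (Pair a) b" "mdiff M (prod_atlas M N) (\<lambda>x. (x, b)) a"
proof -
  show "mdiff N (prod_atlas M N) (Pair a) b"
    unfolding mdiff_def
  proof (intro conjI ballI)
    fix d e assume d: "d \<in> charts_at N b" and "e \<in> charts_at (prod_atlas M N) (a, b)"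
    then obtain c d' where e: "e = (fst c \<times> fst d', map_prod (snd c) (snd d'))" "c \<in> charts_at M a" "d' \<in> charts_at N b"
      by (auto simp: charts_at_prod)
    show "\<forall>\<^sub>F z in nhds (snd d b). (a, chart_inv d z) \<in> fst e"
      using eventually_in_chart[OF N d e(3)] by eventually_elim (simp add: e(1) charts_atD(2)[OF e(2)])
    have "(\<lambda>z. (snd c a, (snd d' \<circ> chart_inv d) z)) differentiable (at (snd d b))"
      using diff_atlasD(3)[OF N charts_atD(1)[OF d] charts_atD(1)[OF e(3)] charts_atD(2)[OF d] charts_atD(2)[OF e(3)]]
      by (intro differentiable_Pair_at) (simp_all add: o_def)
    then show "snd e \<circ> Pair a \<circ> chart_inv d differentiable at (snd d b)"
      by (simp add: e o_def)
  qed (use a b in \<open>auto simp: points_prod\<close>)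
  show "mdiff M (prod_atlas M N) (\<lambda>x. (x, b)) a"
    unfolding mdiff_def
  proof (intro conjI ballI)
    fix d e assume d: "d \<in> charts_at M a" and "e \<in> charts_at (prod_atlas M N) (a, b)"
    then obtain c d' where e: "e = (fst c \<times> fst d', map_prod (snd c) (snd d'))" "c \<in> charts_at M a" "d' \<in> charts_at N b"
      by (auto simp: charts_at_prod)
    show "\<forall>\<^sub>F z in nhds (snd d a). (chart_inv d z, b) \<in> fst e"
      using eventually_in_chart[OF M d e(2)] by eventually_elim (simp add: e(1) charts_atD(2)[OF e(3)])
    have "(\<lambda>z. ((snd c \<circ> chart_inv d) z, snd d' b)) differentiable (at (snd d a))"
      using diff_atlasD(3)[OF M charts_atD(1)[OF d] charts_atD(1)[OF e(2)] charts_atD(2)[OF d] charts_atD(2)[OF e(2)]]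
      by (intro differentiable_Pair_at) (simp_all add: o_def)
    then show "snd e \<circ> (\<lambda>x. (x, b)) \<circ> chart_inv d differentiable at (snd d a)"
      by (simp add: e o_def)
  qed (use a b in \<open>auto simp: points_prod\<close>)
qed

text \<open>Composition with the two slice inclusions. For an action the partial maps are the
  translation by a group element and the orbit map of a point.\<close>

lemma smooth_map_prod_partial:
  assumes M: "diff_atlas M" and N: "diff_atlas N" and f: "smooth_map (prod_atlas M N) P (\<lambda>(x, y). f x y)"
    and a: "a \<in> points M" and b: "b \<in> points N"
  shows "mdiff N P (f a) b" "mdiff M P (\<lambda>x. f x b) a"
proof -
  have "mdiff (prod_atlas M N) P (\<lambda>(x, y). f x y) (a, b)"
    using smooth_map_mdiff[OF diff_atlas_prod[OF M N] f] a b by (simp add: points_prod)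
  then show "mdiff N P (f a) b" "mdiff M P (\<lambda>x. f x b) a"
    using mdiff_chain(1)[OF N diff_atlas_prod[OF M N] mdiff_Pair_const(1)[OF M N a b], of P "\<lambda>(x, y). f x y"]
      mdiff_chain(1)[OF M diff_atlas_prod[OF M N] mdiff_Pair_const(2)[OF M N a b], of P "\<lambda>(x, y). f x y"]
    by (simp_all add: o_def)
qed

section \<open>The cotangent bundle in coordinates\<close>

definition cov ::
  "('a, 'e::fin_dim_inner) atlas \<Rightarrow> 'a \<Rightarrow> ('a, 'e) chart \<Rightarrow> 'e \<Rightarrow> ('a, 'e) covec" where
  "cov M q c a = (\<lambda>v\<in>tspace M q. a \<bullet> v c)"

text \<open>The fibre coordinate of \<open>cot_chart\<close>, isolated so that it can be computed at
  a fixed base point; \<open>cov\<close> is its inverse.\<close>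

definition cov_coord ::
  "('a, 'e::fin_dim_inner) atlas \<Rightarrow> 'a \<Rightarrow> ('a, 'e) chart \<Rightarrow> ('a, 'e) covec \<Rightarrow> 'e" where
  "cov_coord M q c \<alpha> = (THE a. \<forall>v\<in>tspace M q. \<alpha> v = a \<bullet> v c)"

lemma cotspace_lincomb:
  "\<alpha> \<in> cotspace M q \<Longrightarrow> v \<in> tspace M q \<Longrightarrow> w \<in> tspace M q \<Longrightarrow> \<alpha> (lincomb a v b w) = a * \<alpha> v + b * \<alpha> w"
  by (simp add: cotspace_def)

lemma cotspaceI:
  assumes "\<alpha> \<in> extensional (tspace M q)"
    and "\<And>v w a b. v \<in> tspace M q \<Longrightarrow> w \<in> tspace M q \<Longrightarrow> \<alpha> (lincomb a v b w) = a * \<alpha> v + b * \<alpha> w"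
  shows "\<alpha> \<in> cotspace M q"
  using assms by (simp add: cotspace_def)

lemma cotspace_eqI:
  assumes "\<alpha> \<in> cotspace M q" "\<beta> \<in> cotspace M q" "\<And>v. v \<in> tspace M q \<Longrightarrow> \<alpha> v = \<beta> v"
  shows "\<alpha> = \<beta>"
  using assms extensionalityI[of \<alpha> "tspace M q" \<beta>] by (simp add: cotspace_def)

lemma cov_apply: "v \<in> tspace M q \<Longrightarrow> cov M q c a v = a \<bullet> v c"
  by (simp add: cov_def)

lemma cov_in:
  assumes "diff_atlas M" "q \<in> points M"
  shows "cov M q c a \<in> cotspace M q"
  using assms by (intro cotspaceI)
    (auto simp: cov_apply lincomb_in lincomb_component inner_add_right cov_def[of M q c a] simp del: cov_apply)

lemma cov_coord_eqI:
  assumes M: "diff_atlas M" and c: "c \<in> charts_at M q"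
    and a: "\<And>v. v \<in> tspace M q \<Longrightarrow> \<alpha> v = a \<bullet> v c"
  shows "cov_coord M q c \<alpha> = a"
  unfolding cov_coord_def
proof (rule the_equality)
  fix b assume b: "\<forall>v\<in>tspace M q. \<alpha> v = b \<bullet> v c"
  have "b \<bullet> y = a \<bullet> y" for y
    using b[rule_format, OF chart_vec_in[OF M c]] a[OF chart_vec_in[OF M c]] by (simp add: chart_vec_same[OF M c])
  then show "b = a" by (metis vector_eq_rdot inner_commute)
qed (use a in blast)

lemma cov_coord_cov:
  assumes "diff_atlas M" "c \<in> charts_at M q"
  shows "cov_coord M q c (cov M q c a) = a"
  using assms by (intro cov_coord_eqI) (auto simp: cov_apply)

text \<open>Existence behind the definite description: Riesz representation of the covector as read
  in the chart c.\<close>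

lemma cov_coord_apply:
  assumes M: "diff_atlas M" and c: "c \<in> charts_at M q" and \<alpha>: "\<alpha> \<in> cotspace M q" and v: "v \<in> tspace M q"
  shows "\<alpha> v = cov_coord M q c \<alpha> \<bullet> v c"
proof -
  let ?f = "\<lambda>y. \<alpha> (chart_vec M q c y)"
  have "?f (a *\<^sub>R y + b *\<^sub>R z) = a * ?f y + b * ?f z" for a b y z
    using chart_vec_lincomb[OF M c] chart_vec_in[OF M c] cotspace_lincomb[OF \<alpha>] by simp
  from this[of 1 _ 1] this[of _ _ 0] have lin: "linear ?f"
    by (intro linearI) simp_all
  have eq: "\<alpha> w = (\<Sum>b\<in>onb. ?f b *\<^sub>R b) \<bullet> w c" if "w \<in> tspace M q" for w
    unfolding riesz_representation[OF lin] using chart_vec_of_component[OF M c that] by simp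
  then show ?thesis using cov_coord_eqI[OF M c, of \<alpha>] v by simp
qed

lemma cov_of_coord:
  assumes "diff_atlas M" "c \<in> charts_at M q" "\<alpha> \<in> cotspace M q"
  shows "cov M q c (cov_coord M q c \<alpha>) = \<alpha>"
  using assms by (intro cotspace_eqI[of _ M q])
    (simp_all add: cov_in charts_at_point cov_apply flip: cov_coord_apply)

lemma fst_cot_chart: "fst (cot_chart M c) = (SIGMA q : fst c. cotspace M q)"
  and snd_cot_chart: "snd (cot_chart M c) (q, \<alpha>) = (snd c q, cov_coord M q c \<alpha>)"
  by (simp_all add: cot_chart_def cov_coord_def)

lemma points_cot_bundle: "points (cot_bundle M) = (SIGMA q : points M. cotspace M q)"
  by (auto simp: points_def cot_bundle_def fst_cot_chart)

lemma charts_at_cot_bundle: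
  "\<alpha> \<in> cotspace M q \<Longrightarrow> charts_at (cot_bundle M) (q, \<alpha>) = cot_chart M ` charts_at M q"
  unfolding charts_at_def cot_bundle_def by (auto simp: fst_cot_chart)

lemma cot_chart_image:
  fixes M :: "('a, 'e::fin_dim_inner) atlas"
  assumes M: "diff_atlas M" and "c \<in> M" "U \<subseteq> fst c"
  shows "snd (cot_chart M c) ` (SIGMA q : U. cotspace M q) = snd c ` U \<times> UNIV"
proof (intro equalityI subsetI)
  fix z :: "'e \<times> 'e" assume "z \<in> snd c ` U \<times> UNIV"
  then obtain q where q: "q \<in> U" "fst z = snd c q" by auto
  then have c: "c \<in> charts_at M q" using assms by (auto simp: charts_at_def)
  have "z = snd (cot_chart M c) (q, cov M q c (snd z))"
    using q(2) cov_coord_cov[OF M c] by (simp add: snd_cot_chart prod_eq_iff)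
  then show "z \<in> snd (cot_chart M c) ` (SIGMA q : U. cotspace M q)"
    using q(1) cov_in[OF M charts_at_point[OF c]] by blast
qed (auto simp: snd_cot_chart)

lemma is_chart_cot_chart:
  assumes M: "diff_atlas M" and c: "c \<in> M"
  shows "is_chart (cot_chart M c)"
  unfolding is_chart_def
proof
  show "inj_on (snd (cot_chart M c)) (fst (cot_chart M c))"
  proof (rule inj_onI, clarsimp simp: fst_cot_chart snd_cot_chart)
    fix q \<alpha> q' \<alpha>' assume q: "q \<in> fst c" "q' \<in> fst c" "snd c q = snd c q'"
      and \<alpha>: "\<alpha> \<in> cotspace M q" "\<alpha>' \<in> cotspace M q'" "cov_coord M q c \<alpha> = cov_coord M q' c \<alpha>'"
    have "q = q'" using q diff_atlasD(1)[OF M c] by (auto simp: is_chart_def inj_on_def)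
    moreover have "c \<in> charts_at M q" using q c by (simp add: charts_at_def)
    ultimately show "q = q' \<and> \<alpha> = \<alpha>'" using cov_of_coord[OF M] \<alpha> by metis
  qed
  show "open (snd (cot_chart M c) ` fst (cot_chart M c))"
    unfolding fst_cot_chart cot_chart_image[OF M c subset_refl]
    using diff_atlasD(4)[OF M c] by (simp add: open_Times)
qed

lemma chart_inv_cot_chart:
  assumes M: "diff_atlas M" and c: "c \<in> M" and z: "z \<in> snd c ` fst c"
  shows "chart_inv (cot_chart M c) (z, a) = (chart_inv c z, cov M (chart_inv c z) c a)"
proof -
  have q: "chart_inv c z \<in> fst c" "snd c (chart_inv c z) = z"
    using chart_inv_image[OF z] by auto
  then have c': "c \<in> charts_at M (chart_inv c z)" using c by (simp add: charts_at_def)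
  show ?thesis
    unfolding chart_inv_def[of "cot_chart M c"]
    using is_chart_cot_chart[OF M c] q cov_in[OF M charts_at_point[OF c']] cov_coord_cov[OF M c']
    by (intro inv_into_f_eq) (auto simp: is_chart_def fst_cot_chart snd_cot_chart)
qed

text \<open>Covectors change by the transpose of the Jacobian of the opposite transition, here from
  d to c.\<close>

lemma cov_coord_change:
  assumes M: "diff_atlas M" and c: "c \<in> charts_at M q" and d: "d \<in> charts_at M q"
  shows "cov_coord M q d (cov M q c a) = (\<Sum>b\<in>onb. (a \<bullet> cderiv d c id q b) *\<^sub>R b)"
proof (rule cov_coord_eqI[OF M d])
  fix v assume v: "v \<in> tspace M q"
  have lin: "linear (cderiv d c id q)"
    using cderiv_linear[OF mdiff_id[OF M charts_at_point[OF c]]] c d by simp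
  then have "linear (\<lambda>y. a \<bullet> cderiv d c id q y)"
    by (intro linearI) (simp_all add: linear_add linear_scale inner_add_right)
  then show "cov M q c a v = (\<Sum>b\<in>onb. (a \<bullet> cderiv d c id q b) *\<^sub>R b) \<bullet> v d"
    using tspace_component[OF v d c] v by (simp add: riesz_representation cov_apply)
qed



lemma differentiable_inner_scaleR_onb:
  fixes f :: "'a::real_normed_vector \<Rightarrow> 'b::real_inner" and g :: "'a \<Rightarrow> 'c::fin_dim_inner \<Rightarrow> 'b"
  assumes "f differentiable (at x)" "\<And>b. (\<lambda>x. g x b) differentiable (at x)"
  shows "(\<lambda>x. \<Sum>b\<in>onb. (f x \<bullet> g x b) *\<^sub>R b) differentiable (at x)"
  using assms by (intro differentiable_sum finite_onb differentiable_scaleR differentiable_inner differentiable_const) auto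

lemma cderiv_id_eq:
  "cderiv d c id q = frechet_derivative (snd c \<circ> chart_inv d) (at (snd d q))"
  by (simp add: cderiv_def)

text \<open>A transition of the cotangent bundle contains first derivatives of a transition of
  \<open>M\<close> in its fibre part. Differentiating it uses second derivatives, which is why
  \<open>M\<close> is assumed smooth here.\<close>

lemma diff_atlas_cot_bundle:
  assumes "smooth_manifold M"
  shows "diff_atlas (cot_bundle M)"
proof -
  have M: "diff_atlas M" using assms by (rule smooth_manifold_diff_atlas)
  have "open (snd (cot_chart M c) ` (fst (cot_chart M c) \<inter> fst (cot_chart M d))) \<and>
      (\<forall>x\<in>snd (cot_chart M c) ` (fst (cot_chart M c) \<inter> fst (cot_chart M d)).
         (snd (cot_chart M d) \<circ> chart_inv (cot_chart M c)) differentiable (at x))"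
    if c: "c \<in> M" and d: "d \<in> M" for c d
  proof -
    let ?U = "snd c ` (fst c \<inter> fst d)"
    have int: "fst (cot_chart M c) \<inter> fst (cot_chart M d) = (SIGMA q : fst c \<inter> fst d. cotspace M q)"
      by (auto simp: fst_cot_chart)
    have img: "snd (cot_chart M c) ` (fst (cot_chart M c) \<inter> fst (cot_chart M d)) = ?U \<times> UNIV"
      unfolding int by (rule cot_chart_image[OF M c]) simp
    have op: "open (?U \<times> (UNIV :: 'b set))"
      using diff_atlasD(2)[OF M c d] by (intro open_Times) auto
    have "(snd (cot_chart M d) \<circ> chart_inv (cot_chart M c)) differentiable (at z)" if z: "z \<in> ?U \<times> UNIV" for z
    proof (rule differentiable_transform_eventually)
      let ?\<tau> = "snd d \<circ> chart_inv c" and ?\<sigma> = "snd c \<circ> chart_inv d"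
      obtain q where q: "q \<in> fst c" "q \<in> fst d" "fst z = snd c q" using z by auto
      have \<tau>: "?\<tau> differentiable (at (fst z))" using diff_atlasD(3)[OF M c d] q by simp
      have \<tau>q: "?\<tau> (fst z) = snd d q" using q chart_inv_chart[OF diff_atlasD(1)[OF M c]] by simp
      have \<sigma>: "(\<lambda>x. frechet_derivative ?\<sigma> (at x) b) differentiable (at (?\<tau> (fst z)))" for b
      proof -
        have "smooth_on (snd d ` (fst d \<inter> fst c)) ?\<sigma>"
          using assms c d by (auto simp: smooth_manifold_def compatible_def)
        then show ?thesis
          using q unfolding \<tau>q by (intro smooth_on_differentiable[OF smooth_on_frechet_derivative]) auto
      qed
      show "(\<lambda>w. (?\<tau> (fst w), \<Sum>b\<in>onb. (snd w \<bullet> frechet_derivative ?\<sigma> (at (?\<tau> (fst w))) b) *\<^sub>R b)) differentiable (at z)"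
      proof (intro differentiable_Pair_at differentiable_inner_scaleR_onb)
        show "(\<lambda>w. ?\<tau> (fst w)) differentiable (at z)"
          using \<tau> by (rule differentiable_compose_fst)
        show "snd differentiable (at z)"
          by (simp add: bounded_linear_imp_differentiable bounded_linear_snd)
        show "(\<lambda>w. frechet_derivative ?\<sigma> (at (?\<tau> (fst w))) b) differentiable (at z)" for b
          using differentiable_compose_fst[OF differentiable_chain_at[OF \<tau> \<sigma>[of b]]] by (simp add: o_def)
      qed
      have "\<forall>\<^sub>F w in nhds z. w \<in> ?U \<times> UNIV" using op z by (simp add: eventually_nhds_in_open)
      then show "\<forall>\<^sub>F w in nhds z. (?\<tau> (fst w), \<Sum>b\<in>onb. (snd w \<bullet> frechet_derivative ?\<sigma> (at (?\<tau> (fst w))) b) *\<^sub>R b) =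
          (snd (cot_chart M d) \<circ> chart_inv (cot_chart M c)) w"
      proof eventually_elim
        case (elim w)
        then obtain p where p: "p \<in> fst c" "p \<in> fst d" "fst w = snd c p" by auto
        then have cd: "c \<in> charts_at M p" "d \<in> charts_at M p" using c d by (auto simp: charts_at_def)
        have inv: "chart_inv c (fst w) = p" using p chart_inv_chart[OF diff_atlasD(1)[OF M c]] by simp
        have "chart_inv (cot_chart M c) (fst w, snd w) = (p, cov M p c (snd w))"
          unfolding inv[symmetric] using p by (intro chart_inv_cot_chart[OF M c]) auto
        then show ?case
          using cov_coord_change[OF M cd] inv by (simp add: snd_cot_chart cderiv_id_eq)
      qed
    qed
    then show ?thesis using op unfolding img by blast
  qed
  then show ?thesis
    unfolding diff_atlas_def cot_bundle_def using is_chart_cot_chart[OF M] by blast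
qed

section \<open>Symplectic form and projected Hamiltonian vector fields in cotangent charts\<close>

context
  fixes N :: "('a, 'e::fin_dim_inner) atlas"
  assumes N: "smooth_manifold N"
begin

lemma N_atlas: "diff_atlas N" "diff_atlas (cot_bundle N)"
  using N smooth_manifold_diff_atlas diff_atlas_cot_bundle by auto

lemma cot_projection_derivative:
  assumes c: "c \<in> charts_at N q" and d: "d \<in> charts_at N q" and \<alpha>: "\<alpha> \<in> cotspace N q"
  shows "((snd d \<circ> fst \<circ> chart_inv (cot_chart N c)) has_derivative (\<lambda>w. cderiv c d id q (fst w)))
    (at (snd (cot_chart N c) (q, \<alpha>)))"
    "\<forall>\<^sub>F w in nhds (snd (cot_chart N c) (q, \<alpha>)). fst (chart_inv (cot_chart N c) w) \<in> fst d"
proof -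
  let ?x = "snd (cot_chart N c) (q, \<alpha>)" and ?U = "snd c ` (fst c \<inter> fst d)"
  have x: "fst ?x = snd c q" by (simp add: snd_cot_chart)
  have "open (?U \<times> (UNIV :: 'e set))"
    using diff_atlasD(2)[OF N_atlas(1)] c d by (intro open_Times) (auto simp: charts_at_def)
  moreover have "?x \<in> ?U \<times> UNIV" using x c d by (auto simp: charts_at_def mem_Times_iff)
  ultimately have "\<forall>\<^sub>F w in nhds ?x. w \<in> ?U \<times> UNIV" by (simp add: eventually_nhds_in_open)
  then have ev: "\<forall>\<^sub>F w in nhds ?x. fst (chart_inv (cot_chart N c) w) \<in> fst d \<and>
      (snd d \<circ> id \<circ> chart_inv c) (fst w) = (snd d \<circ> fst \<circ> chart_inv (cot_chart N c)) w"
  proof eventually_elim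
    case (elim w)
    then have "chart_inv (cot_chart N c) (fst w, snd w) = (chart_inv c (fst w), cov N (chart_inv c (fst w)) c (snd w))"
      using c by (intro chart_inv_cot_chart[OF N_atlas(1)]) (auto simp: charts_at_def)
    moreover have "chart_inv c (fst w) \<in> fst d"
      using elim by (auto simp: chart_inv_chart[OF diff_atlasD(1)[OF N_atlas(1) charts_atD(1)[OF c]]])
    ultimately show ?case by simp
  qed
  then show "\<forall>\<^sub>F w in nhds ?x. fst (chart_inv (cot_chart N c) w) \<in> fst d"
    by (rule eventually_mono) simp
  have "(snd d \<circ> id \<circ> chart_inv c has_derivative cderiv c d id q) (at (fst ?x))"
    unfolding x using mdiffD(4)[OF mdiff_id[OF N_atlas(1) charts_at_point[OF c]] c] d by simp
  then have "((\<lambda>w. (snd d \<circ> id \<circ> chart_inv c) (fst w)) has_derivative (\<lambda>w. cderiv c d id q (fst w))) (at ?x)"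
    by (rule has_derivative_compose[OF has_derivative_fst[OF has_derivative_ident]])
  then show "((snd d \<circ> fst \<circ> chart_inv (cot_chart N c)) has_derivative (\<lambda>w. cderiv c d id q (fst w))) (at ?x)"
    by (rule has_derivative_transform_nhds) (use ev in \<open>auto elim: eventually_mono\<close>)
qed

lemma cot_projection_mdiff:
  assumes q: "q \<in> points N" and \<alpha>: "\<alpha> \<in> cotspace N q"
  shows "mdiff (cot_bundle N) N fst (q, \<alpha>)"
  unfolding mdiff_def
proof (intro conjI ballI)
  fix C d assume "C \<in> charts_at (cot_bundle N) (q, \<alpha>)" and d: "d \<in> charts_at N (fst (q, \<alpha>))"
  then obtain c where c: "C = cot_chart N c" "c \<in> charts_at N q"
    using charts_at_cot_bundle[OF \<alpha>] by auto
  have d': "d \<in> charts_at N q" using d by simp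
  show "\<forall>\<^sub>F z in nhds (snd C (q, \<alpha>)). fst (chart_inv C z) \<in> fst d"
    unfolding c(1) by (rule cot_projection_derivative(2)[OF c(2) d' \<alpha>])
  show "snd d \<circ> fst \<circ> chart_inv C differentiable at (snd C (q, \<alpha>))"
    unfolding c(1) differentiable_def using cot_projection_derivative(1)[OF c(2) d' \<alpha>] by blast
qed (use q \<alpha> in \<open>auto simp: points_cot_bundle\<close>)

lemma tmap_cot_projection:
  assumes c: "c \<in> charts_at N q" and \<alpha>: "\<alpha> \<in> cotspace N q" and V: "V \<in> tspace (cot_bundle N) (q, \<alpha>)"
  shows "tmap (cot_bundle N) N fst (q, \<alpha>) V = chart_vec N q c (fst (V (cot_chart N c)))"
proof -
  have q: "q \<in> points N" using c by (rule charts_at_point)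
  have C: "cot_chart N c \<in> charts_at (cot_bundle N) (q, \<alpha>)"
    using charts_at_cot_bundle[OF \<alpha>] c by auto
  have "cderiv (cot_chart N c) c fst (q, \<alpha>) = (\<lambda>w. cderiv c c id q (fst w))"
    by (rule cderivI) (rule cot_projection_derivative(1)[OF c c \<alpha>])
  then have "cderiv (cot_chart N c) c fst (q, \<alpha>) (V (cot_chart N c)) = fst (V (cot_chart N c))"
    using cderiv_id_same[OF N_atlas(1) c] by simp
  then have "chart_vec N q c (fst (V (cot_chart N c))) c = cderiv (cot_chart N c) c fst (q, \<alpha>) (V (cot_chart N c))"
    by (simp only: chart_vec_same[OF N_atlas(1) c])
  then show ?thesis
    using c N_atlas(1) chart_vec_in[OF N_atlas(1) c]
    by (intro tmap_eqI[OF N_atlas(2) cot_projection_mdiff[OF q \<alpha>] V C]) simp_all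
qed

text \<open>On a constant coordinate field y the Liouville form is the linear function
  \<open>\<lambda>z. snd z \<bullet> fst y\<close>, so both derivatives in \<open>ext_deriv\<close>
  are immediate. The chart is the one that \<open>ext_deriv\<close> selects, and its definition can
  be evaluated directly.\<close>

lemma canonical_symplectic_coord:
  assumes q: "q \<in> points N" and \<alpha>: "\<alpha> \<in> cotspace N q"
    and U: "U \<in> tspace (cot_bundle N) (q, \<alpha>)" and V: "V \<in> tspace (cot_bundle N) (q, \<alpha>)"
  defines "C \<equiv> chart_at (cot_bundle N) (q, \<alpha>)"
  shows "canonical_symplectic N (q, \<alpha>) U V = snd (U C) \<bullet> fst (V C) - snd (V C) \<bullet> fst (U C)"
proof -
  have x: "(q, \<alpha>) \<in> points (cot_bundle N)" using q \<alpha> by (simp add: points_cot_bundle)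
  have C': "C \<in> charts_at (cot_bundle N) (q, \<alpha>)" unfolding C_def by (rule chart_at_in[OF x])
  then obtain c where c: "C = cot_chart N c" "c \<in> charts_at N q"
    using charts_at_cot_bundle[OF \<alpha>] by auto
  let ?a = "\<lambda>y z. liouville_form N (chart_inv C z) (chart_vec (cot_bundle N) (chart_inv C z) C y)"
  have D: "frechet_derivative (?a y) (at (snd C (q, \<alpha>))) = (\<lambda>w. snd w \<bullet> fst y)" for y
  proof -
    have "open (snd C ` fst C)" "snd C (q, \<alpha>) \<in> snd C ` fst C"
      using diff_atlasD(4)[OF N_atlas(2)] C' by (auto simp: charts_at_def)
    then have "\<forall>\<^sub>F z in nhds (snd C (q, \<alpha>)). z \<in> snd C ` fst C" by (simp add: eventually_nhds_in_open)
    then have "\<forall>\<^sub>F z in nhds (snd C (q, \<alpha>)). snd z \<bullet> fst y = ?a y z"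
    proof eventually_elim
      case (elim z)
      then obtain p \<nu> where p: "z = snd C (p, \<nu>)" "p \<in> fst c" "\<nu> \<in> cotspace N p"
        unfolding c(1) fst_cot_chart by auto
      have cp: "c \<in> charts_at N p" using p c(2) by (auto simp: charts_at_def)
      have Cp: "C \<in> charts_at (cot_bundle N) (p, \<nu>)"
        using charts_at_cot_bundle[OF p(3)] cp c(1) by auto
      have inv: "chart_inv C z = (p, \<nu>)"
        using chart_inv_chart[OF diff_atlasD(1)[OF N_atlas(2) charts_atD(1)[OF Cp]] charts_atD(2)[OF Cp]] p by simp
      have W: "chart_vec (cot_bundle N) (p, \<nu>) C y \<in> tspace (cot_bundle N) (p, \<nu>)"
        using chart_vec_in[OF N_atlas(2) Cp] .
      have "?a y z = \<nu> (tmap (cot_bundle N) N fst (p, \<nu>) (chart_vec (cot_bundle N) (p, \<nu>) C y))"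
        unfolding inv using W by (simp add: liouville_form_def)
      also have "\<dots> = \<nu> (chart_vec N p c (fst y))"
        using tmap_cot_projection[OF cp p(3) W] chart_vec_same[OF N_atlas(2) Cp] c(1) by simp
      also have "\<dots> = cov_coord N p c \<nu> \<bullet> fst y"
        using cov_coord_apply[OF N_atlas(1) cp p(3) chart_vec_in[OF N_atlas(1) cp]]
          chart_vec_same[OF N_atlas(1) cp] by simp
      finally show ?case using p(1) c(1) by (simp add: snd_cot_chart)
    qed
    moreover have "((\<lambda>z. snd z \<bullet> fst y) has_derivative (\<lambda>w. snd w \<bullet> fst y)) (at (snd C (q, \<alpha>)))"
      by (intro bounded_linear_imp_has_derivative bounded_linear_inner_left_comp bounded_linear_snd)
    ultimately have "(?a y has_derivative (\<lambda>w. snd w \<bullet> fst y)) (at (snd C (q, \<alpha>)))"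
      by (rule has_derivative_transform_nhds[rotated])
    then show ?thesis by (rule frechet_derivative_at[symmetric])
  qed
  show ?thesis
    unfolding canonical_symplectic_def ext_deriv_def Let_def C_def[symmetric] D by simp
qed

text \<open>Pairing the defining equation of the Hamiltonian vector field with vertical vectors, on which
  the magnetic term vanishes, shows that the base component is minus the fibre derivative.\<close>

lemma projected_vf_fibre_derivative:
  assumes q: "q \<in> points N" and \<alpha>: "\<gamma> q \<in> cotspace N q"
    and f: "mdiff (cot_bundle N) vector_space_atlas f (q, \<gamma> q)"
    and \<beta>: "\<And>u v w a b. u \<in> tspace N q \<Longrightarrow> v \<in> tspace N q \<Longrightarrow> w \<in> tspace N q \<Longrightarrow>
       \<beta> u (lincomb a v b w) = a * \<beta> u v + b * \<beta> u w"
    and \<Omega>: "\<And>U V. U \<in> tspace (cot_bundle N) (q, \<gamma> q) \<Longrightarrow> V \<in> tspace (cot_bundle N) (q, \<gamma> q) \<Longrightarrow>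
       \<Omega> (q, \<gamma> q) U V = canonical_symplectic N (q, \<gamma> q) U V +
         \<beta> (tmap (cot_bundle N) N fst (q, \<gamma> q) U) (tmap (cot_bundle N) N fst (q, \<gamma> q) V)"
  shows "projected_vf N \<Omega> f \<gamma> q \<in> tspace N q"
    and "\<eta> \<in> cotspace N q \<Longrightarrow> ((\<lambda>t. f (q, \<lambda>v\<in>tspace N q. \<gamma> q v + t * \<eta> v)) has_real_derivative
       - \<eta> (projected_vf N \<Omega> f \<gamma> q)) (at 0)"
proof -
  define \<alpha> where "\<alpha> = \<gamma> q"
  note hyps = \<alpha>[folded \<alpha>_def] f[folded \<alpha>_def] \<Omega>[folded \<alpha>_def]
  define C where "C = chart_at (cot_bundle N) (q, \<alpha>)"
  let ?T = "tspace (cot_bundle N) (q, \<alpha>)" and ?x = "snd C (q, \<alpha>)"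
  have x: "(q, \<alpha>) \<in> points (cot_bundle N)" using q hyps(1) by (simp add: points_cot_bundle)
  have C: "C \<in> charts_at (cot_bundle N) (q, \<alpha>)" unfolding C_def by (rule chart_at_in[OF x])
  then obtain c where c: "C = cot_chart N c" "c \<in> charts_at N q"
    using charts_at_cot_bundle[OF hyps(1)] by auto
  define D where "D = frechet_derivative (f \<circ> chart_inv C) (at ?x)"
  have "snd (UNIV, id) \<circ> f \<circ> chart_inv C = f \<circ> chart_inv C" by simp
  then have D: "(f \<circ> chart_inv C has_derivative D) (at ?x)"
    using mdiffD(4)[OF hyps(2) C, of "(UNIV, id)"] unfolding cderiv_def D_def
    by (simp add: vector_space_chart)
  have linD: "linear D" using D has_derivative_linear by blast
  \<comment> \<open>\<open>A\<close> and \<open>P\<close> are the gradients of \<open>f\<close> in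
    the position and the momentum coordinates.\<close>
  define A where "A = (\<Sum>b\<in>onb. D (b, 0) *\<^sub>R b)"
  define P where "P = (\<Sum>b\<in>onb. D (0, b) *\<^sub>R b)"
  have "linear (\<lambda>y. D (y, 0))" "linear (\<lambda>y. D (0, y))"
    using linear_compose[of "\<lambda>y. (y, 0)" D] linear_compose[of "\<lambda>y. (0, y)" D] linD
    by (auto simp: o_def linear_iff)
  then have AP: "A \<bullet> y = D (y, 0)" "P \<bullet> y = D (0, y)" for y
    by (simp_all add: A_def P_def riesz_representation)
  have D_eq: "D w = A \<bullet> fst w + P \<bullet> snd w" for w
    using linear_add[OF linD, of "(fst w, 0)" "(0, snd w)"] by (simp add: AP)
  define u where "u = chart_vec N q c (- P)"
  have cvN: "chart_vec N q c y \<in> tspace N q" "chart_vec N q c y c = y" for y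
    using chart_vec_in[OF N_atlas(1) c(2)] chart_vec_same[OF N_atlas(1) c(2)] by auto
  have cvC: "chart_vec (cot_bundle N) (q, \<alpha>) C y \<in> ?T" "chart_vec (cot_bundle N) (q, \<alpha>) C y C = y" for y
    using chart_vec_in[OF N_atlas(2) C] chart_vec_same[OF N_atlas(2) C] by auto
  \<comment> \<open>The magnetic force as a vector of the model space. It depends only on the base
    component u and corrects only the fibre component of the vector field.\<close>
  define \<rho> where "\<rho> = (\<Sum>b\<in>onb. \<beta> u (chart_vec N q c b) *\<^sub>R b)"
  have \<beta>lin: "\<beta> v (chart_vec N q c (a *\<^sub>R y + b *\<^sub>R z)) = a * \<beta> v (chart_vec N q c y) + b * \<beta> v (chart_vec N q c z)"
    if "v \<in> tspace N q" for v a b y z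
    using chart_vec_lincomb[OF N_atlas(1) c(2)] \<beta>[OF that] cvN by simp
  have \<beta>0: "\<beta> v (chart_vec N q c 0) = 0" if "v \<in> tspace N q" for v
    using \<beta>lin[OF that, of 0 0 0 0] by simp
  have u: "u \<in> tspace N q" unfolding u_def by (rule cvN)
  have "linear (\<lambda>y. \<beta> u (chart_vec N q c y))"
    using \<beta>lin[OF u, of 1 _ 1] \<beta>lin[OF u, of _ _ 0] \<beta>0[OF u] by (intro linearI) simp_all
  then have \<rho>: "\<rho> \<bullet> y = \<beta> u (chart_vec N q c y)" for y
    by (simp add: \<rho>_def riesz_representation)
  have tm: "tmap (cot_bundle N) N fst (q, \<alpha>) V = chart_vec N q c (fst (V C))" if "V \<in> ?T" for V
    using tmap_cot_projection[OF c(2) hyps(1) that] c(1) by simp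
  have \<Omega>C: "\<Omega> (q, \<alpha>) U V = snd (U C) \<bullet> fst (V C) - snd (V C) \<bullet> fst (U C)
      + \<beta> (chart_vec N q c (fst (U C))) (chart_vec N q c (fst (V C)))" if "U \<in> ?T" "V \<in> ?T" for U V
    using hyps(3)[OF that] canonical_symplectic_coord[OF q hyps(1) that] tm that by (simp add: C_def)
  \<comment> \<open>Hamilton's equations; the signs are those of the convention \<omega> =
    d\<theta>.\<close>
  define X where "X = chart_vec (cot_bundle N) (q, \<alpha>) C (- P, A - \<rho>)"
  have diff: "differential (cot_bundle N) f (q, \<alpha>) W = A \<bullet> fst (W C) + P \<bullet> snd (W C)" for W
    unfolding differential_def Let_def C_def[symmetric] D_def[symmetric] D_eq by simp
  have "hamiltonian_vf (cot_bundle N) \<Omega> f (q, \<alpha>) = X"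
    unfolding hamiltonian_vf_def
  proof (rule the_equality)
    show "X \<in> ?T \<and> (\<forall>w\<in>?T. \<Omega> (q, \<alpha>) X w = differential (cot_bundle N) f (q, \<alpha>) w)"
      using cvC by (auto simp: X_def \<Omega>C diff \<rho>[symmetric] u_def[symmetric] inner_diff_left inner_commute)
    fix Y assume Y: "Y \<in> ?T \<and> (\<forall>w\<in>?T. \<Omega> (q, \<alpha>) Y w = differential (cot_bundle N) f (q, \<alpha>) w)"
    then have eq: "snd (Y C) \<bullet> fst w - snd w \<bullet> fst (Y C) + \<beta> (chart_vec N q c (fst (Y C))) (chart_vec N q c (fst w))
        = A \<bullet> fst w + P \<bullet> snd w" for w
      using \<Omega>C[OF _ cvC(1)[of w]] diff[of "chart_vec (cot_bundle N) (q, \<alpha>) C w"] cvC by metis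
    \<comment> \<open>Vertical test vectors determine the base component. Once it is known, the
      magnetic term is \<rho>, and horizontal coordinate vectors give the fibre component.\<close>
    have "(fst (Y C) + P) \<bullet> y = 0" for y
      using eq[of "(0, y)"] \<beta>0[OF cvN(1)] by (simp add: inner_add_left inner_commute[of y])
    then have 1: "fst (Y C) = - P"
      by (metis eq_neg_iff_add_eq_0 inner_eq_zero_iff)
    have "(snd (Y C) - (A - \<rho>)) \<bullet> y = 0" for y
      using eq[of "(y, 0)"] 1 by (simp add: inner_diff_left \<rho> u_def)
    then have "snd (Y C) = A - \<rho>"
      by (metis eq_iff_diff_eq_0 inner_eq_zero_iff)
    then show "Y = X"
      using 1 Y cvC C by (intro tspace_eqI[of Y _ _ X C]) (auto simp: X_def prod_eq_iff)
  qed
  then have V: "projected_vf N \<Omega> f \<gamma> q = u"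
    using tm[of X] cvC unfolding projected_vf_def \<alpha>_def[symmetric] by (simp add: X_def u_def)
  then show "projected_vf N \<Omega> f \<gamma> q \<in> tspace N q" using u by simp
  show "((\<lambda>t. f (q, \<lambda>v\<in>tspace N q. \<gamma> q v + t * \<eta> v)) has_real_derivative
       - \<eta> (projected_vf N \<Omega> f \<gamma> q)) (at 0)" if \<eta>: "\<eta> \<in> cotspace N q"
  proof -
    let ?e = "cov_coord N q c \<eta>"
    \<comment> \<open>Adding t \<eta> inside a fibre is a straight line in the cotangent chart, so
      the derivative is \<open>D\<close> applied to its vertical direction.\<close>
    have line: "f (q, \<lambda>v\<in>tspace N q. \<gamma> q v + t * \<eta> v) = (f \<circ> chart_inv C) (?x + t *\<^sub>R (0, ?e))" for t
    proof -
      have xe: "?x + t *\<^sub>R (0, ?e) = (snd c q, cov_coord N q c \<alpha> + t *\<^sub>R ?e)"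
        by (simp add: c(1) snd_cot_chart)
      have "chart_inv C (?x + t *\<^sub>R (0, ?e)) = (q, cov N q c (cov_coord N q c \<alpha> + t *\<^sub>R ?e))"
        unfolding xe unfolding c(1) using charts_atD[OF c(2)] chart_inv_chart[OF diff_atlasD(1)[OF N_atlas(1)], of c q]
        by (subst chart_inv_cot_chart[OF N_atlas(1)]) auto
      moreover have "cov N q c (cov_coord N q c \<alpha> + t *\<^sub>R ?e) = (\<lambda>v\<in>tspace N q. \<gamma> q v + t * \<eta> v)"
        unfolding cov_def \<alpha>_def[symmetric]
        using cov_coord_apply[OF N_atlas(1) c(2) hyps(1)] cov_coord_apply[OF N_atlas(1) c(2) \<eta>]
        by (intro restrict_ext) (simp add: inner_add_left)
      ultimately show ?thesis by simp
    qed
    have "((\<lambda>t. ?x + t *\<^sub>R (0, ?e)) has_derivative (\<lambda>t. t *\<^sub>R (0, ?e))) (at 0)"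
      by (auto intro!: derivative_eq_intros)
    moreover have "(f \<circ> chart_inv C has_derivative D) (at (?x + 0 *\<^sub>R (0, ?e)))"
      using D by (simp only: scaleR_zero_left add_0_right)
    ultimately have "((\<lambda>t. (f \<circ> chart_inv C) (?x + t *\<^sub>R (0, ?e))) has_derivative (\<lambda>t. D (t *\<^sub>R (0, ?e)))) (at 0)"
      by (rule has_derivative_compose)
    moreover have "D (t *\<^sub>R (0, ?e)) = (- \<eta> (projected_vf N \<Omega> f \<gamma> q)) * t" for t
      unfolding V linear_scale[OF linD] AP(2)[symmetric]
      using cov_coord_apply[OF N_atlas(1) c(2) \<eta> u] cvN by (simp add: u_def inner_commute)
    ultimately show ?thesis
      unfolding line has_field_derivative_def by (simp only:)
  qed
qed

end

section \<open>Partial maps of products\<close>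

lemma cderiv_Pair_const:
  assumes M: "diff_atlas M" and N: "diff_atlas N" and c: "c \<in> charts_at M a" and d: "d \<in> charts_at N b"
  shows "cderiv d (fst c \<times> fst d, map_prod (snd c) (snd d)) (Pair a) b = (\<lambda>s. (0, s))"
    "cderiv c (fst c \<times> fst d, map_prod (snd c) (snd d)) (\<lambda>x. (x, b)) a = (\<lambda>s. (s, 0))"
proof -
  have "(snd d \<circ> id \<circ> chart_inv d has_derivative id) (at (snd d b))"
    using mdiffD(4)[OF mdiff_id[OF N charts_at_point[OF d]] d, of d] d by (simp add: cderiv_id_same[OF N d])
  from has_derivative_Pair[OF has_derivative_const[of "snd c a"] this]
  show "cderiv d (fst c \<times> fst d, map_prod (snd c) (snd d)) (Pair a) b = (\<lambda>s. (0, s))"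
    by (intro cderivI) (simp add: o_def)
  have "(snd c \<circ> id \<circ> chart_inv c has_derivative id) (at (snd c a))"
    using mdiffD(4)[OF mdiff_id[OF M charts_at_point[OF c]] c, of c] c by (simp add: cderiv_id_same[OF M c])
  from has_derivative_Pair[OF this has_derivative_const[of "snd d b"]]
  show "cderiv c (fst c \<times> fst d, map_prod (snd c) (snd d)) (\<lambda>x. (x, b)) a = (\<lambda>s. (s, 0))"
    by (intro cderivI) (simp add: o_def)
qed

text \<open>Makes right translations of the group continuous for \<open>mtop\<close>. The preimage
  of a generating set is again a generating set, or empty if b is outside the second chart.\<close>

lemma continuous_map_Pair_const:
  assumes b: "b \<in> points N"
  shows "continuous_map (mtop M) (mtop (prod_atlas M N)) (\<lambda>x. (x, b))"
  unfolding mtop_def[of "prod_atlas M N"]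
proof (rule continuous_on_generated_topo)
  fix U assume "U \<in> {fst e \<inter> snd e -` W | e W. e \<in> prod_atlas M N \<and> open W}"
  then obtain c d W where cd: "c \<in> M" "d \<in> N" "open W" "U = fst c \<times> fst d \<inter> map_prod (snd c) (snd d) -` W"
    unfolding prod_atlas_def by auto
  have "open ((\<lambda>z. (z, snd d b)) -` W)"
    using cd(3) by (intro open_vimage continuous_intros)
  then have "openin (mtop M) (fst c \<inter> snd c -` ((\<lambda>z. (z, snd d b)) -` W))"
    by (rule openin_chart_vimage[OF cd(1)])
  moreover have "(\<lambda>x. (x, b)) -` U \<inter> topspace (mtop M) =
      (if b \<in> fst d then fst c \<inter> snd c -` ((\<lambda>z. (z, snd d b)) -` W) else {})"
    using cd by (auto simp: mtop_topspace points_def)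
  ultimately show "openin (mtop M) ((\<lambda>x. (x, b)) -` U \<inter> topspace (mtop M))" by simp
next
  have "(\<lambda>x. (x, b)) ` points M \<subseteq> topspace (mtop (prod_atlas M N))"
    using b by (auto simp: mtop_topspace points_prod)
  then show "(\<lambda>x. (x, b)) ` topspace (mtop M) \<subseteq> \<Union> {fst e \<inter> snd e -` W | e W. e \<in> prod_atlas M N \<and> open W}"
    unfolding mtop_def[of "prod_atlas M N"] topology_generated_by_topspace by (simp add: mtop_topspace)
qed

text \<open>A basic open set chosen between \<open>p t\<close> and \<open>W t\<close> determines t.
  Disjointness enters in the weak form that \<open>p t\<close> lies in no other
  \<open>W t'\<close>.\<close>

lemma countable_disjoint_open_family:
  assumes "second_countable X" and W: "\<And>t. t \<in> T \<Longrightarrow> openin X (W t)" "\<And>t. t \<in> T \<Longrightarrow> p t \<in> W t"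
    and disj: "\<And>t t'. t \<in> T \<Longrightarrow> t' \<in> T \<Longrightarrow> p t \<in> W t' \<Longrightarrow> t = t'"
  shows "countable T"
proof -
  from assms(1) obtain \<B> where B: "countable \<B>"
    "\<forall>U x. openin X U \<and> x \<in> U \<longrightarrow> (\<exists>V\<in>\<B>. x \<in> V \<and> V \<subseteq> U)"
    unfolding second_countable_def by (elim exE conjE)
  have "\<forall>t\<in>T. \<exists>V. V \<in> \<B> \<and> p t \<in> V \<and> V \<subseteq> W t"
    using B(2)[rule_format, OF conjI[OF W]] by (auto simp: Bex_def)
  from bchoice[OF this] obtain V where V: "\<And>t. t \<in> T \<Longrightarrow> V t \<in> \<B>" "\<And>t. t \<in> T \<Longrightarrow> p t \<in> V t" "\<And>t. t \<in> T \<Longrightarrow> V t \<subseteq> W t"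
    by auto
  have "inj_on V T"
  proof (rule inj_onI)
    fix t t' assume "t \<in> T" "t' \<in> T" "V t = V t'"
    then show "t = t'" using V(2)[of t] V(3)[of t'] by (intro disj) auto
  qed
  moreover have "countable (V ` T)" using V(1) B(1) by (intro countable_subset[OF _ B(1)]) auto
  ultimately show ?thesis using countable_image_inj_on by blast
qed

section \<open>Free actions with a principal connection\<close>

locale principal_setting =
  fixes G :: "('g, 'm) monoid_scheme"
    and MG :: "('g, 'l::fin_dim_inner) atlas"
    and Exp :: "('g, 'l) tvec \<Rightarrow> 'g"
    and Q :: "('q, 'e::fin_dim_inner) atlas"
    and \<Phi> :: "'g \<Rightarrow> 'q \<Rightarrow> 'q"
    and B :: "('q set, 'b::fin_dim_inner) atlas"
    and A :: "'q \<Rightarrow> ('q, 'e) tvec \<Rightarrow> ('g, 'l) tvec"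
  assumes lie_group: "lie_group G MG"
    and exp: "exponential_map G MG Exp"
    and manifold: "smooth_manifold Q"
    and action: "smooth_action G MG Q \<Phi>"
    and quotient: "quotient_manifold G Q \<Phi> B"
    and connection: "principal_connection G MG Exp Q \<Phi> A"
begin

section \<open>The group action and the orbit projection\<close>

abbreviation "\<pi> \<equiv> orbit G \<Phi>"

lemma G_group: "group G" and G_manifold: "smooth_manifold MG" and carrier_G: "carrier G = points MG"
  and mult_smooth: "smooth_map (prod_atlas MG MG) MG (\<lambda>(x, y). x \<otimes>\<^bsub>G\<^esub> y)"
  using lie_group by (auto simp: lie_group_def)

lemma B_manifold: "smooth_manifold B" and points_B: "points B = orbits G (points Q) \<Phi>"
  and pi_submersion: "submersion Q B \<pi>"
  using quotient by (auto simp: quotient_manifold_def)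

lemma atlases: "diff_atlas MG" "diff_atlas Q" "diff_atlas B"
  using G_manifold manifold B_manifold by (auto intro: smooth_manifold_diff_atlas)

lemma act_group_action: "group_action G (points Q) \<Phi>"
  and act_smooth: "smooth_map (prod_atlas MG Q) Q (\<lambda>(g, q). \<Phi> g q)"
  using action by (auto simp: smooth_action_def)

lemma G_monoid: "monoid G"
  by (rule group.is_monoid[OF G_group])

lemma one_in: "\<one>\<^bsub>G\<^esub> \<in> carrier G" and one_point: "\<one>\<^bsub>G\<^esub> \<in> points MG"
  using monoid.one_closed[OF G_monoid] by (simp_all add: carrier_G)

lemma inv_in: "g \<in> carrier G \<Longrightarrow> inv\<^bsub>G\<^esub> g \<in> carrier G"
  by (rule group.inv_closed[OF G_group])

lemma mult_in: "g \<in> carrier G \<Longrightarrow> h \<in> carrier G \<Longrightarrow> g \<otimes>\<^bsub>G\<^esub> h \<in> carrier G"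
  by (rule monoid.m_closed[OF G_monoid])

lemma act_in: "g \<in> carrier G \<Longrightarrow> q \<in> points Q \<Longrightarrow> \<Phi> g q \<in> points Q"
  using group_action.element_image[OF act_group_action] by blast

lemma act_one: "q \<in> points Q \<Longrightarrow> \<Phi> \<one>\<^bsub>G\<^esub> q = q"
  using group_action.id_eq_one[OF act_group_action] by (metis restrict_apply')

lemma act_mult: "g \<in> carrier G \<Longrightarrow> h \<in> carrier G \<Longrightarrow> q \<in> points Q \<Longrightarrow> \<Phi> (g \<otimes>\<^bsub>G\<^esub> h) q = \<Phi> g (\<Phi> h q)"
  using group_action.composition_rule[OF act_group_action] by blast

lemma act_inv: "g \<in> carrier G \<Longrightarrow> q \<in> points Q \<Longrightarrow> \<Phi> (inv\<^bsub>G\<^esub> g) (\<Phi> g q) = q"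
  "g \<in> carrier G \<Longrightarrow> q \<in> points Q \<Longrightarrow> \<Phi> g (\<Phi> (inv\<^bsub>G\<^esub> g) q) = q"
  using act_mult[of "inv\<^bsub>G\<^esub> g" g q] act_mult[of g "inv\<^bsub>G\<^esub> g" q]
  by (simp_all add: act_one inv_in group.l_inv[OF G_group] group.r_inv[OF G_group])

lemma act_mdiff:
  assumes "g \<in> carrier G" "q \<in> points Q"
  shows "mdiff Q Q (\<Phi> g) q" "mdiff MG Q (\<lambda>g. \<Phi> g q) g"
  using smooth_map_prod_partial[OF atlases(1,2) act_smooth] assms unfolding carrier_G by blast+

lemma pi_smooth: "smooth_map Q B \<pi>" and tmap_pi_surj: "q \<in> points Q \<Longrightarrow> tmap Q B \<pi> q ` tspace Q q = tspace B (\<pi> q)"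
  using pi_submersion by (auto simp: submersion_def)

lemma pi_mdiff: "q \<in> points Q \<Longrightarrow> mdiff Q B \<pi> q"
  using smooth_map_mdiff[OF atlases(2) pi_smooth] .

lemma pi_in: "q \<in> points Q \<Longrightarrow> \<pi> q \<in> points B"
  using smooth_map_points[OF pi_smooth] .

lemma pi_act:
  assumes g: "g \<in> carrier G" and q: "q \<in> points Q"
  shows "\<pi> (\<Phi> g q) = \<pi> q"
proof -
  have "\<pi> (\<Phi> g q) \<in> orbits G (points Q) \<Phi>" "\<pi> q \<in> orbits G (points Q) \<Phi>"
    using g q act_in by (auto simp: orbits_def)
  moreover have "\<Phi> g q \<in> \<pi> (\<Phi> g q) \<inter> \<pi> q"
    using g q act_in group_action.orbit_refl[OF act_group_action] by (auto simp: orbit_def)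
  ultimately show ?thesis
    using group_action.disjoint_union[OF act_group_action] by blast
qed

lemma pi_eqD:
  assumes "q \<in> points Q" "q' \<in> points Q" "\<pi> q = \<pi> q'"
  shows "\<exists>g\<in>carrier G. q' = \<Phi> g q"
proof -
  have "q' \<in> \<pi> q" using group_action.orbit_refl[OF act_group_action assms(2)] assms(3) by simp
  then show ?thesis by (auto simp: orbit_def)
qed

lemma tmap_act_in: "g \<in> carrier G \<Longrightarrow> q \<in> points Q \<Longrightarrow> v \<in> tspace Q q \<Longrightarrow> tmap Q Q (\<Phi> g) q v \<in> tspace Q (\<Phi> g q)"
  by (rule tmap_in[OF atlases(2,2) act_mdiff(1)])

lemma tmap_pi_in: "q \<in> points Q \<Longrightarrow> v \<in> tspace Q q \<Longrightarrow> tmap Q B \<pi> q v \<in> tspace B (\<pi> q)"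
  by (rule tmap_in[OF atlases(2,3) pi_mdiff])

lemma tmap_pi_act:
  assumes g: "g \<in> carrier G" and q: "q \<in> points Q" and v: "v \<in> tspace Q q"
  shows "tmap Q B \<pi> (\<Phi> g q) (tmap Q Q (\<Phi> g) q v) = tmap Q B \<pi> q v"
proof -
  have "tmap Q B (\<pi> \<circ> \<Phi> g) q = tmap Q B \<pi> q"
    using pi_act[OF g] by (intro tmap_cong[OF atlases(2) q]) simp
  then show ?thesis
    using tmap_comp[OF atlases(2,2,3) act_mdiff(1)[OF g q] pi_mdiff[OF act_in[OF g q]] v] by simp
qed

lemma tmap_act_inv:
  assumes g: "g \<in> carrier G" and q: "q \<in> points Q" and v: "v \<in> tspace Q q"
  shows "tmap Q Q (\<Phi> (inv\<^bsub>G\<^esub> g)) (\<Phi> g q) (tmap Q Q (\<Phi> g) q v) = v"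
proof -
  have "tmap Q Q (\<Phi> (inv\<^bsub>G\<^esub> g) \<circ> \<Phi> g) q = tmap Q Q id q"
    using act_inv(1)[OF g] by (intro tmap_cong[OF atlases(2) q]) simp
  then show ?thesis
    using tmap_comp[OF atlases(2,2,2) act_mdiff(1)[OF g q] act_mdiff(1)[OF inv_in[OF g] act_in[OF g q]] v]
      tmap_id[OF atlases(2) q v] by simp
qed

lemma tmap_act_inv':
  assumes g: "g \<in> carrier G" and q: "q \<in> points Q" and v: "v \<in> tspace Q (\<Phi> g q)"
  shows "tmap Q Q (\<Phi> (inv\<^bsub>G\<^esub> g)) (\<Phi> g q) v \<in> tspace Q q"
    "tmap Q Q (\<Phi> g) q (tmap Q Q (\<Phi> (inv\<^bsub>G\<^esub> g)) (\<Phi> g q) v) = v"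
  using tmap_act_in[OF inv_in[OF g] act_in[OF g q] v] tmap_act_inv[OF inv_in[OF g] act_in[OF g q] v] g q
  by (simp_all add: act_inv group.inv_inv[OF G_group])

lemma tmap_act_mult:
  assumes g: "g \<in> carrier G" and h: "h \<in> carrier G" and q: "q \<in> points Q" and v: "v \<in> tspace Q q"
  shows "tmap Q Q (\<Phi> (g \<otimes>\<^bsub>G\<^esub> h)) q v = tmap Q Q (\<Phi> g) (\<Phi> h q) (tmap Q Q (\<Phi> h) q v)"
proof -
  have "tmap Q Q (\<Phi> (g \<otimes>\<^bsub>G\<^esub> h)) q = tmap Q Q (\<Phi> g \<circ> \<Phi> h) q"
    using act_mult[OF g h] by (intro tmap_cong[OF atlases(2) q]) simp
  then show ?thesis
    using tmap_comp[OF atlases(2,2,2) act_mdiff(1)[OF h q] act_mdiff(1)[OF g act_in[OF h q]] v] by simp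
qed

subsection \<open>Infinitesimal generators\<close>

text \<open>The infinitesimal generator expressed without the exponential map: as a tangent map of
  the orbit map it is linear in \<xi> by construction.\<close>

definition gen :: "'q \<Rightarrow> ('g, 'l) tvec \<Rightarrow> ('q, 'e) tvec" where
  "gen q \<xi> = tmap MG Q (\<lambda>g. \<Phi> g q) \<one>\<^bsub>G\<^esub> \<xi>"

lemma gen_mdiff: "q \<in> points Q \<Longrightarrow> mdiff MG Q (\<lambda>g. \<Phi> g q) \<one>\<^bsub>G\<^esub>"
  by (rule act_mdiff(2)[OF one_in])

text \<open>Chain rule for the orbit map along the one-parameter subgroup, which starts at the
  identity because its value at 0 is idempotent.\<close>

lemma inf_generator_eq:
  assumes q: "q \<in> points Q" and \<xi>: "\<xi> \<in> lie_algebra G MG"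
  shows "inf_generator Exp Q \<Phi> \<xi> q = gen q \<xi>"
proof -
  let ?\<sigma> = "\<lambda>t::real. Exp (\<lambda>c. t *\<^sub>R \<xi> c)"
  have \<sigma>: "smooth_map vector_space_atlas MG ?\<sigma>" "\<And>s t. ?\<sigma> (s + t) = ?\<sigma> s \<otimes>\<^bsub>G\<^esub> ?\<sigma> t" "velocity MG ?\<sigma> 0 = \<xi>"
    using exp \<xi> unfolding exponential_map_def Let_def by blast+
  have in_G: "?\<sigma> 0 \<in> carrier G"
    using smooth_map_points[OF \<sigma>(1), of 0] by (simp add: vector_space_chart carrier_G)
  have "?\<sigma> 0 \<otimes>\<^bsub>G\<^esub> ?\<sigma> 0 = ?\<sigma> 0" using \<sigma>(2)[of 0 0] by simp
  then have one: "?\<sigma> 0 = \<one>\<^bsub>G\<^esub>"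
    using group.l_cancel_one[OF G_group in_G in_G] by simp
  let ?e = "chart_vec vector_space_atlas (0::real) (UNIV, id) 1"
  have e: "?e \<in> tspace vector_space_atlas 0"
    by (rule chart_vec_in[OF diff_atlas_vector_space]) (simp add: vector_space_chart)
  have md: "mdiff vector_space_atlas MG ?\<sigma> 0"
    by (rule smooth_map_mdiff[OF diff_atlas_vector_space \<sigma>(1)]) (simp add: vector_space_chart)
  have "tmap vector_space_atlas Q ((\<lambda>g. \<Phi> g q) \<circ> ?\<sigma>) 0 ?e = tmap MG Q (\<lambda>g. \<Phi> g q) (?\<sigma> 0) (tmap vector_space_atlas MG ?\<sigma> 0 ?e)"
    using gen_mdiff[OF q] one by (intro tmap_comp[OF diff_atlas_vector_space atlases(1,2) md _ e]) simp
  then show ?thesis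
    using \<sigma>(3) one unfolding inf_generator_def velocity_def gen_def by (simp add: o_def)
qed

lemma gen_in: "q \<in> points Q \<Longrightarrow> \<xi> \<in> lie_algebra G MG \<Longrightarrow> gen q \<xi> \<in> tspace Q q"
  using tmap_in[OF atlases(1,2) gen_mdiff] act_one unfolding gen_def by fastforce

lemma gen_lincomb:
  "q \<in> points Q \<Longrightarrow> \<xi> \<in> lie_algebra G MG \<Longrightarrow> \<zeta> \<in> lie_algebra G MG \<Longrightarrow>
     gen q (lincomb a \<xi> b \<zeta>) = lincomb a (gen q \<xi>) b (gen q \<zeta>)"
  unfolding gen_def by (rule tmap_lincomb[OF atlases(1,2) gen_mdiff])

lemma tmap_pi_gen:
  assumes q: "q \<in> points Q" and \<xi>: "\<xi> \<in> lie_algebra G MG"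
  shows "tmap Q B \<pi> q (gen q \<xi>) = (\<lambda>_. 0)"
proof -
  have "tmap MG B (\<pi> \<circ> (\<lambda>g. \<Phi> g q)) \<one>\<^bsub>G\<^esub> = tmap MG B (\<lambda>_. \<pi> q) \<one>\<^bsub>G\<^esub>"
    using pi_act[OF _ q] carrier_G by (intro tmap_cong[OF atlases(1) one_point]) simp
  moreover have "tmap MG B (\<lambda>_. \<pi> q) \<one>\<^bsub>G\<^esub> \<xi> = (\<lambda>_. 0)"
    by (simp add: tmap_def Let_def o_def fun_eq_iff)
  ultimately show ?thesis
    using tmap_comp[OF atlases(1,2,3) gen_mdiff[OF q] _ \<xi>, of \<pi>] pi_mdiff[OF q] act_one[OF q]
    by (simp add: gen_def)
qed

lemma Ad_mdiff:
  assumes g: "g \<in> carrier G"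
  shows "mdiff MG MG (\<lambda>x. g \<otimes>\<^bsub>G\<^esub> x \<otimes>\<^bsub>G\<^esub> inv\<^bsub>G\<^esub> g) \<one>\<^bsub>G\<^esub>"
proof -
  have l: "mdiff MG MG (\<lambda>x. g \<otimes>\<^bsub>G\<^esub> x) \<one>\<^bsub>G\<^esub>"
    using smooth_map_prod_partial(1)[OF atlases(1,1) mult_smooth _ one_point] g carrier_G by simp
  have "mdiff MG MG (\<lambda>x. x \<otimes>\<^bsub>G\<^esub> inv\<^bsub>G\<^esub> g) (g \<otimes>\<^bsub>G\<^esub> \<one>\<^bsub>G\<^esub>)"
    using smooth_map_prod_partial(2)[OF atlases(1,1) mult_smooth] mult_in[OF g one_in] inv_in[OF g] carrier_G by simp
  from mdiff_chain(1)[OF atlases(1,1) l this] show ?thesis by (simp add: o_def)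
qed

lemma Ad_in:
  assumes g: "g \<in> carrier G" and \<xi>: "\<xi> \<in> lie_algebra G MG"
  shows "Ad G MG g \<xi> \<in> lie_algebra G MG"
proof -
  have "g \<otimes>\<^bsub>G\<^esub> \<one>\<^bsub>G\<^esub> \<otimes>\<^bsub>G\<^esub> inv\<^bsub>G\<^esub> g = \<one>\<^bsub>G\<^esub>"
    using g by (simp add: monoid.r_one[OF G_monoid] group.r_inv[OF G_group])
  then show ?thesis
    using tmap_in[OF atlases(1,1) Ad_mdiff[OF g] \<xi>] by (simp add: Ad_def)
qed

text \<open>Acting on \<open>\<Phi> g q\<close> by the conjugate of x under g is the same as acting
  by x and then by g; the claim is the derivative of this identity at the identity element.\<close>

lemma gen_equivariant:
  assumes g: "g \<in> carrier G" and q: "q \<in> points Q" and \<xi>: "\<xi> \<in> lie_algebra G MG"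
  shows "tmap Q Q (\<Phi> g) q (gen q \<xi>) = gen (\<Phi> g q) (Ad G MG g \<xi>)"
proof -
  let ?c = "\<lambda>x. g \<otimes>\<^bsub>G\<^esub> x \<otimes>\<^bsub>G\<^esub> inv\<^bsub>G\<^esub> g"
  have c1: "?c \<one>\<^bsub>G\<^esub> = \<one>\<^bsub>G\<^esub>"
    using g by (simp add: monoid.r_one[OF G_monoid] group.r_inv[OF G_group])
  have "\<Phi> (?c x) (\<Phi> g q) = \<Phi> g (\<Phi> x q)" if x: "x \<in> carrier G" for x
    using g q x by (simp add: act_mult mult_in inv_in act_in act_inv)
  then have "tmap MG Q ((\<lambda>x. \<Phi> x (\<Phi> g q)) \<circ> ?c) \<one>\<^bsub>G\<^esub> = tmap MG Q (\<Phi> g \<circ> (\<lambda>x. \<Phi> x q)) \<one>\<^bsub>G\<^esub>"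
    using carrier_G by (intro tmap_cong[OF atlases(1) one_point]) simp
  moreover have "tmap MG Q ((\<lambda>x. \<Phi> x (\<Phi> g q)) \<circ> ?c) \<one>\<^bsub>G\<^esub> \<xi> = gen (\<Phi> g q) (Ad G MG g \<xi>)"
    using tmap_comp[OF atlases(1,1,2) Ad_mdiff[OF g] _ \<xi>, of "\<lambda>x. \<Phi> x (\<Phi> g q)"] gen_mdiff[OF act_in[OF g q]]
    by (simp add: c1 gen_def Ad_def)
  moreover have "tmap MG Q (\<Phi> g \<circ> (\<lambda>x. \<Phi> x q)) \<one>\<^bsub>G\<^esub> \<xi> = tmap Q Q (\<Phi> g) q (gen q \<xi>)"
    using tmap_comp[OF atlases(1,2,2) gen_mdiff[OF q] _ \<xi>, of "\<Phi> g"] act_mdiff(1)[OF g q]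
    by (simp add: act_one[OF q] gen_def)
  ultimately show ?thesis by simp
qed


subsection \<open>Vertical vectors are generated by the action\<close>

lemma A_in: "q \<in> points Q \<Longrightarrow> v \<in> tspace Q q \<Longrightarrow> A q v \<in> lie_algebra G MG"
  and A_lincomb: "q \<in> points Q \<Longrightarrow> v \<in> tspace Q q \<Longrightarrow> w \<in> tspace Q q \<Longrightarrow>
        A q (lincomb a v b w) = lincomb a (A q v) b (A q w)"
  and A_smooth: "\<nu> \<in> lie_algebra_dual G MG \<Longrightarrow> one_form Q (pair_form Q \<nu> A)"
  and A_equivariant: "g \<in> carrier G \<Longrightarrow> q \<in> points Q \<Longrightarrow> v \<in> tspace Q q \<Longrightarrow>
        A (\<Phi> g q) (tmap Q Q (\<Phi> g) q v) = Ad G MG g (A q v)"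
  using connection unfolding principal_connection_def by blast+

lemma A_gen: "q \<in> points Q \<Longrightarrow> \<xi> \<in> lie_algebra G MG \<Longrightarrow> A q (gen q \<xi>) = \<xi>"
  using connection inf_generator_eq unfolding principal_connection_def by metis

text \<open>Suppose \<open>v \<noteq> 0\<close> is horizontal and tangent to the fibre through \<open>q\<close>. Solving along a horizontal
  slice gives uncountably many points \<open>p t = \<Phi> (a t) q\<close> of the fibre in a slice on which
  \<open>(g, p) \<mapsto> \<Phi> g p\<close> is injective near \<open>(\<one>, q)\<close>. So the translates by \<open>a t\<close> of a neighbourhood of
  \<open>\<one>\<close> are disjoint, which is impossible in a second countable group.\<close>

lemma horizontal_vertical_zero:
  assumes q: "q \<in> points Q" and v: "v \<in> tspace Q q" and Av: "A q v = (\<lambda>_. 0)"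
    and \<pi>v: "tmap Q B \<pi> q v = (\<lambda>_. 0)"
  shows "v = (\<lambda>_. 0)"
proof (rule ccontr)
  assume "v \<noteq> (\<lambda>_. 0)"
  define c where "c = chart_at Q q"
  define k where "k = chart_at MG \<one>\<^bsub>G\<^esub>"
  define d where "d = chart_at B (\<pi> q)"
  have c: "c \<in> charts_at Q q" and k: "k \<in> charts_at MG \<one>\<^bsub>G\<^esub>" and d: "d \<in> charts_at B (\<pi> q)"
    using chart_at_in[OF q] chart_at_in[OF one_point] chart_at_in[OF pi_in[OF q]] by (simp_all add: c_def k_def d_def)
  have ck: "is_chart c" "is_chart k" "is_chart d"
    using diff_atlasD(1)[OF atlases(2) charts_atD(1)[OF c]] diff_atlasD(1)[OF atlases(1) charts_atD(1)[OF k]]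
      diff_atlasD(1)[OF atlases(3) charts_atD(1)[OF d]] by simp_all
  define v' where "v' = v c"
  have v': "v' \<noteq> 0"
    using tspace_eqI[OF v zero_in_tspace[OF atlases(2) q] c] \<open>v \<noteq> (\<lambda>_. 0)\<close> by (auto simp: v'_def)
  \<comment> \<open>In coordinates \<open>P\<close> is the tangent map of \<pi>, \<open>D\<close>
    the generator map and \<open>H\<close> the connection form. The structure used below is
    \<open>H (D x) = x\<close> and \<open>P (D x) = 0\<close>.\<close>
  define P where "P = cderiv c d \<pi> q"
  define D where "D = cderiv k c (\<lambda>g. \<Phi> g q) \<one>\<^bsub>G\<^esub>"
  define H where "H y = (A q (chart_vec Q q c y)) k" for y
  have cq: "c \<in> charts_at Q (\<Phi> \<one>\<^bsub>G\<^esub> q)" using c act_one[OF q] by simp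
  have linP: "linear P" unfolding P_def by (rule cderiv_linear[OF pi_mdiff[OF q] c d])
  have linD: "linear D" unfolding D_def by (rule cderiv_linear[OF gen_mdiff[OF q] k cq])
  have cv: "chart_vec Q q c y \<in> tspace Q q" "chart_vec Q q c y c = y" for y
    using chart_vec_in[OF atlases(2) c] chart_vec_same[OF atlases(2) c] by auto
  have kv: "chart_vec MG \<one>\<^bsub>G\<^esub> k x \<in> lie_algebra G MG" "chart_vec MG \<one>\<^bsub>G\<^esub> k x k = x" for x
    using chart_vec_in[OF atlases(1) k] chart_vec_same[OF atlases(1) k] by auto
  have "H (a *\<^sub>R y + b *\<^sub>R z) = a *\<^sub>R H y + b *\<^sub>R H z" for a b y z
    unfolding H_def chart_vec_lincomb[OF atlases(2) c] A_lincomb[OF q cv(1) cv(1)] by (simp add: lincomb_component)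
  from this[of 1 _ 1] this[of _ _ 0] have linH: "linear H"
    by (intro linearI) simp_all
  have gen_D: "gen q \<xi> c = D (\<xi> k)" if "\<xi> \<in> lie_algebra G MG" for \<xi>
    unfolding gen_def D_def using tmap_component[OF atlases(1) gen_mdiff[OF q] that k cq] .
  have HD: "H (D x) = x" for x
  proof -
    have "chart_vec Q q c (D x) = gen q (chart_vec MG \<one>\<^bsub>G\<^esub> k x)"
      using gen_D[OF kv(1)] kv(2) cv gen_in[OF q kv(1)] by (intro tspace_eqI[OF _ _ c]) auto
    then show ?thesis unfolding H_def using A_gen[OF q kv(1)] kv(2) by simp
  qed
  have P_comp: "tmap Q B \<pi> q u d = P (u c)" if "u \<in> tspace Q q" for u
    unfolding P_def using tmap_component[OF atlases(2) pi_mdiff[OF q] that c d] .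
  have PD: "P (D x) = 0" for x
    using P_comp[OF gen_in[OF q kv(1)]] gen_D[OF kv(1)] kv(2) tmap_pi_gen[OF q kv(1)] by metis
  have "surj P"
  proof (rule surjI)
    fix y
    have "chart_vec B (\<pi> q) d y \<in> tmap Q B \<pi> q ` tspace Q q"
      using tmap_pi_surj[OF q] chart_vec_in[OF atlases(3) d] by simp
    then obtain u where "u \<in> tspace Q q" "chart_vec B (\<pi> q) d y = tmap Q B \<pi> q u" by blast
    then have "P (u c) = y" using P_comp chart_vec_same[OF atlases(3) d] by metis
    then show "P (SOME z. P z = y) = y" by (rule someI)
  qed
  then obtain R0 where R0: "linear R0" "P \<circ> R0 = id"
    using linear_surjective_right_inverse[OF linP] by blast
  \<comment> \<open>Subtracting the generator part of \<open>R0\<close> leaves a right inverse of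
    \<open>P\<close> with values in the kernel of \<open>H\<close>, so corrections along
    \<open>R\<close> stay in the horizontal slice.\<close>
  define R where "R y = R0 y - D (H (R0 y))" for y
  have linR: "linear R"
    unfolding R_def using linear_compose[OF linear_compose[OF R0(1) linH] linD] R0(1)
    by (intro linear_compose_sub) (simp_all add: o_def)
  have PR: "P (R y) = y" for y
    using fun_cong[OF R0(2), of y] by (simp add: R_def linear_diff[OF linP] PD)
  have HR: "H (R y) = 0" for y
    by (simp add: R_def linear_diff[OF linH] HD)
  have Pv: "P v' = 0" using P_comp[OF v] \<pi>v by (simp add: v'_def)
  have Hv: "H v' = 0" using chart_vec_of_component[OF atlases(2) c v] Av by (simp add: H_def v'_def)
  obtain KR where KR: "KR > 0" "\<And>y. norm (R y) \<le> norm y * KR"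
    using bounded_linear.pos_bounded[OF linear_imp_bounded_linear[OF linR]] by blast
  obtain KH where KH: "KH > 0" "\<And>y. norm (H y) \<le> norm y * KH"
    using bounded_linear.pos_bounded[OF linear_imp_bounded_linear[OF linH]] by blast
  obtain KD where KD: "KD > 0" "\<And>y. norm (D y) \<le> norm y * KD"
    using bounded_linear.pos_bounded[OF linear_imp_bounded_linear[OF linD]] by blast

  let ?kc = "(fst k \<times> fst c, map_prod (snd k) (snd c))" and ?act = "\<lambda>(g, q). \<Phi> g q"
  define F where "F = snd c \<circ> ?act \<circ> chart_inv ?kc"
  define DF where "DF = cderiv ?kc c ?act (\<one>\<^bsub>G\<^esub>, q)"
  have kc: "?kc \<in> charts_at (prod_atlas MG Q) (\<one>\<^bsub>G\<^esub>, q)"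
    using k c unfolding charts_at_prod by blast
  have act1: "c \<in> charts_at Q (?act (\<one>\<^bsub>G\<^esub>, q))" using cq by simp
  have P_atlas: "diff_atlas (prod_atlas MG Q)" by (rule diff_atlas_prod[OF atlases(1,2)])
  have F: "strict_deriv F DF (snd k \<one>\<^bsub>G\<^esub>, snd c q)"
    using smooth_map_strict_deriv[OF P_atlas act_smooth kc act1] by (simp add: F_def DF_def)
  have act_md: "mdiff (prod_atlas MG Q) Q ?act (\<one>\<^bsub>G\<^esub>, q)"
    by (rule smooth_map_mdiff[OF P_atlas act_smooth]) (use one_point q in \<open>simp add: points_prod\<close>)
  have linDF: "linear DF" unfolding DF_def by (rule cderiv_linear[OF act_md kc act1])
  have DF1: "DF (\<xi>, 0) = D \<xi>" for \<xi>
  proof -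
    have "cderiv k c (?act \<circ> (\<lambda>x. (x, q))) \<one>\<^bsub>G\<^esub> = DF \<circ> cderiv k ?kc (\<lambda>x. (x, q)) \<one>\<^bsub>G\<^esub>"
      unfolding DF_def
      by (rule mdiff_chain(2)[OF atlases(1) P_atlas mdiff_Pair_const(2)[OF atlases(1,2) one_point q] act_md k kc act1])
    then show ?thesis
      unfolding cderiv_Pair_const(2)[OF atlases(1,2) k c] by (simp add: D_def o_def fun_eq_iff)
  qed
  have DF2: "DF (0, s) = s" for s
  proof -
    have "cderiv c c (?act \<circ> Pair \<one>\<^bsub>G\<^esub>) q = DF \<circ> cderiv c ?kc (Pair \<one>\<^bsub>G\<^esub>) q"
      unfolding DF_def
      by (rule mdiff_chain(2)[OF atlases(2) P_atlas mdiff_Pair_const(1)[OF atlases(1,2) one_point q] act_md c kc act1])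
    moreover have "cderiv c c (?act \<circ> Pair \<one>\<^bsub>G\<^esub>) q = cderiv c c id q"
      by (rule cderiv_cong(1)[OF atlases(2) c]) (simp add: act_one)
    ultimately show ?thesis
      unfolding cderiv_Pair_const(1)[OF atlases(1,2) k c] cderiv_id_same[OF atlases(2) c] by (simp add: fun_eq_iff)
  qed
  have DF: "DF (\<xi>, s) = D \<xi> + s" for \<xi> s
    using linear_add[OF linDF, of "(\<xi>, 0)" "(0, s)"] by (simp add: DF1 DF2)
  \<comment> \<open>For z = \<open>DF (\<xi>, s)\<close> with s horizontal, \<open>H z\<close>
    recovers \<xi> and then s is \<open>z - D (H z)\<close>. The constant below adds the bounds for
    these two components.\<close>
  define V where "V = {w :: 'l \<times> 'e. H (snd w) = 0}"
  have "norm w \<le> (KH + (1 + KH * KD)) * norm (DF w)" if "w \<in> V" for w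
  proof -
    obtain \<xi> s where w: "w = (\<xi>, s)" by (cases w)
    let ?z = "DF w"
    have Hz: "H ?z = \<xi>" using that by (simp add: w V_def DF linear_add[OF linH] HD)
    have s: "s = ?z - D (H ?z)" using Hz by (simp add: w DF)
    have 1: "norm \<xi> \<le> norm ?z * KH" using KH(2)[of ?z] Hz by simp
    have "norm s \<le> norm ?z + norm (D (H ?z))" by (subst s) (rule norm_triangle_ineq4)
    also have "norm (D (H ?z)) \<le> norm ?z * KH * KD"
      using KD(2)[of "H ?z"] mult_right_mono[OF KH(2)[of ?z], of KD] KD(1) by linarith
    finally have "norm s \<le> norm ?z + norm ?z * KH * KD" by simp
    with 1 show ?thesis using norm_Pair_le[of \<xi> s] by (simp add: w algebra_simps)
  qed
  then obtain \<delta>1 where \<delta>1: "\<delta>1 > 0"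
    "\<And>u w. u \<in> ball (snd k \<one>\<^bsub>G\<^esub>, snd c q) \<delta>1 \<Longrightarrow> w \<in> ball (snd k \<one>\<^bsub>G\<^esub>, snd c q) \<delta>1 \<Longrightarrow> u - w \<in> V \<Longrightarrow> F u = F w \<Longrightarrow> u = w"
    using strict_deriv_locally_inj[OF F] by metis

  let ?f = "snd d \<circ> \<pi> \<circ> chart_inv c"
  have f: "strict_deriv ?f P (snd c q)"
    unfolding P_def by (rule smooth_map_strict_deriv[OF atlases(2) pi_smooth c d])
  have fq: "?f (snd c q) = snd d (\<pi> q)" using chart_inv_chart[OF ck(1) charts_atD(2)[OF c]] by simp
  obtain d0 where d0: "d0 > 0" "\<And>x w. x \<in> ball (snd c q) d0 \<Longrightarrow> norm (w - ?f x) < d0 \<Longrightarrow>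
      \<exists>y. norm y \<le> 2 * norm (w - ?f x) \<and> ?f (x + R y) = w"
    using strict_deriv_solvable[OF f linR PR] by blast
  obtain r1 where r1: "r1 > 0"
    "\<And>x y. x \<in> ball (snd c q) r1 \<Longrightarrow> y \<in> ball (snd c q) r1 \<Longrightarrow> norm (?f y - ?f x - P (y - x)) \<le> 1 * norm (y - x)"
    using f zero_less_one unfolding strict_deriv_def by metis
  have "\<forall>\<^sub>F z in nhds (snd c q). \<pi> (chart_inv c z) \<in> fst d \<and> z \<in> snd c ` fst c"
    using mdiffD(3)[OF pi_mdiff[OF q] c d] diff_atlasD(4)[OF atlases(2) charts_atD(1)[OF c]] charts_atD(2)[OF c]
    by (intro eventually_conj) (simp_all add: eventually_nhds_in_open)
  then obtain r2 where r2: "r2 > 0" "\<And>z. z \<in> ball (snd c q) r2 \<Longrightarrow> \<pi> (chart_inv c z) \<in> fst d \<and> z \<in> snd c ` fst c"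
    by (auto simp: eventually_nhds_metric dist_commute)
  \<comment> \<open>Below d0 the fibre equation can be solved, below r1 the linearisation of \<pi>
    is controlled, below r2 the charts are valid; half of \<delta>1 leaves room for the group
    component and the slice component together.\<close>
  define m where "m = min (min d0 r1) (min r2 (\<delta>1 / 2))"
  have m: "m > 0" "m \<le> d0" "m \<le> r1" "m \<le> r2" "m \<le> \<delta>1 / 2"
    using d0(1) r1(1) r2(1) \<delta>1(1) by (auto simp: m_def)
  \<comment> \<open>Since \<open>P v' = 0\<close>, moving by t v' displaces the image under \<pi> by
    at most its length. The correction y then has at most twice that length, which gives the factor
    1 + 2 KR for the total displacement.\<close>
  define t0 where "t0 = m / (norm v' * (1 + 2 * KR))"
  have t0: "t0 > 0" using m(1) v' KR(1) by (simp add: t0_def add_pos_pos)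
  have "\<exists>y. norm (t *\<^sub>R v' + R y) < m \<and> ?f (snd c q + (t *\<^sub>R v' + R y)) = snd d (\<pi> q)" if t: "t \<in> {0<..<t0}" for t
  proof -
    have "t * (norm v' * (1 + 2 * KR)) < m"
      using t v' KR(1) m(1) by (simp add: t0_def pos_less_divide_eq add_pos_pos)
    then have small: "norm (t *\<^sub>R v') + 2 * norm (t *\<^sub>R v') * KR < m"
      using t by (simp add: algebra_simps)
    have tm: "norm (t *\<^sub>R v') < m" using small KR(1) by (smt (verit) mult_nonneg_nonneg norm_ge_zero)
    let ?x = "snd c q + t *\<^sub>R v'"
    have "norm (?f ?x - ?f (snd c q) - P (?x - snd c q)) \<le> 1 * norm (?x - snd c q)"
      using tm m by (intro r1(2)) (auto simp: dist_norm)
    then have le: "norm (snd d (\<pi> q) - ?f ?x) \<le> norm (t *\<^sub>R v')"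
      using fq by (simp add: linear_scale[OF linP] Pv norm_minus_commute)
    moreover have "?x \<in> ball (snd c q) d0" using tm m by (simp add: dist_norm)
    ultimately obtain y where y: "norm y \<le> 2 * norm (snd d (\<pi> q) - ?f ?x)" "?f (?x + R y) = snd d (\<pi> q)"
      using d0(2)[of ?x "snd d (\<pi> q)"] tm m by force
    have "norm (t *\<^sub>R v' + R y) \<le> norm (t *\<^sub>R v') + norm (R y)" by (rule norm_triangle_ineq)
    also have "norm (R y) \<le> norm y * KR" by (rule KR)
    also have "norm y * KR \<le> 2 * norm (t *\<^sub>R v') * KR"
      using y(1) le KR(1) by (intro mult_right_mono) auto
    finally show ?thesis using small y(2) by (intro exI[of _ y]) (simp add: add.assoc)
  qed
  then obtain y where y: "\<And>t. t \<in> {0<..<t0} \<Longrightarrow> norm (t *\<^sub>R v' + R (y t)) < m"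
    "\<And>t. t \<in> {0<..<t0} \<Longrightarrow> ?f (snd c q + (t *\<^sub>R v' + R (y t))) = snd d (\<pi> q)"
    by metis
  define s where "s t = t *\<^sub>R v' + R (y t)" for t
  have Hs: "H (s t) = 0" for t
    by (simp add: s_def linear_add[OF linH] linear_scale[OF linH] Hv HR)
  \<comment> \<open>\<open>P\<close> recovers the correction \<open>y t\<close> from
    \<open>s t\<close>, and then v' being nonzero recovers t: different parameters give different
    points of the slice.\<close>
  have Ps: "P (s t) = y t" for t
    by (simp add: s_def linear_add[OF linP] linear_scale[OF linP] Pv PR)
  have s_inj: "t = t'" if "s t = s t'" for t t'
  proof -
    have "y t = y t'" using that Ps by metis
    then show ?thesis using that v' by (simp add: s_def)
  qed
  define p where "p t = chart_inv c (snd c q + s t)" for t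
  have norm_s: "norm (s t) < m" if "t \<in> {0<..<t0}" for t
    using y(1)[OF that] by (simp add: s_def)
  have s_img: "snd c q + s t \<in> snd c ` fst c" and s_dom: "\<pi> (p t) \<in> fst d" if "t \<in> {0<..<t0}" for t
    using r2(2)[of "snd c q + s t"] norm_s[OF that] m by (auto simp: p_def dist_norm)
  have p_in: "p t \<in> points Q" if "t \<in> {0<..<t0}" for t
    using chart_inv_image(1)[OF s_img[OF that]] charts_atD(1)[OF c] by (auto simp: p_def points_def)
  have "\<pi> (p t) = \<pi> q" if t: "t \<in> {0<..<t0}" for t
  proof -
    have "snd d (\<pi> (p t)) = snd d (\<pi> q)" using y(2)[OF t] by (simp add: p_def s_def)
    then show ?thesis
      using s_dom[OF t] charts_atD(2)[OF d] ck(3) by (auto simp: is_chart_def inj_on_def)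
  qed
  then have "\<exists>g\<in>carrier G. p t = \<Phi> g q" if "t \<in> {0<..<t0}" for t
    using that pi_eqD[OF q p_in] by metis
  then obtain a where a: "\<And>t. t \<in> {0<..<t0} \<Longrightarrow> a t \<in> carrier G" "\<And>t. t \<in> {0<..<t0} \<Longrightarrow> p t = \<Phi> (a t) q"
    by metis
  define O1 where "O1 = fst k \<inter> snd k -` ball (snd k \<one>\<^bsub>G\<^esub>) m"
  \<comment> \<open>The right translate of \<open>O1\<close> by \<open>a t\<close>.\<close>
  define W where "W t = {x \<in> topspace (mtop MG). x \<otimes>\<^bsub>G\<^esub> inv\<^bsub>G\<^esub> (a t) \<in> O1}" for t
  have O1_carrier: "O1 \<subseteq> carrier G"
    using charts_atD(1)[OF k] carrier_G by (auto simp: O1_def points_def)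
  have "countable {0<..<t0}"
  proof (rule countable_disjoint_open_family[where W = W and p = a])
    show "second_countable (mtop MG)" using G_manifold by (simp add: smooth_manifold_def)
  next
    fix t assume t: "t \<in> {0<..<t0}"
    have "inv\<^bsub>G\<^esub> (a t) \<in> points MG" using inv_in[OF a(1)[OF t]] carrier_G by simp
    then have "continuous_map (mtop MG) (mtop MG) ((\<lambda>(x, y). x \<otimes>\<^bsub>G\<^esub> y) \<circ> (\<lambda>x. (x, inv\<^bsub>G\<^esub> (a t))))"
      using mult_smooth unfolding smooth_map_def by (intro continuous_map_compose[OF continuous_map_Pair_const]) auto
    moreover have "openin (mtop MG) O1"
      unfolding O1_def by (rule openin_chart_vimage[OF charts_atD(1)[OF k]]) simp
    ultimately show "openin (mtop MG) (W t)"
      unfolding W_def using openin_continuous_map_preimage by fastforce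
    show "a t \<in> W t"
      using a(1)[OF t] charts_atD(2)[OF k] m(1)
      by (simp add: W_def O1_def mtop_topspace group.r_inv[OF G_group] flip: carrier_G)
  next
    fix t t' assume t: "t \<in> {0<..<t0}" "t' \<in> {0<..<t0}" and "a t \<in> W t'"
    then have u: "a t \<otimes>\<^bsub>G\<^esub> inv\<^bsub>G\<^esub> (a t') \<in> O1" by (simp add: W_def)
    \<comment> \<open>This element lies near the identity and moves \<open>p t'\<close> to
      \<open>p t\<close>. Both pairs have horizontal slice components, so local injectivity of
      \<open>F\<close> along \<open>V\<close> identifies them.\<close>
    define u where "u = a t \<otimes>\<^bsub>G\<^esub> inv\<^bsub>G\<^esub> (a t')"
    have uO: "u \<in> fst k" "snd k u \<in> ball (snd k \<one>\<^bsub>G\<^esub>) m" using u by (auto simp: u_def O1_def)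
    have "\<Phi> u (p t') = \<Phi> \<one>\<^bsub>G\<^esub> (p t)"
      using a t q by (simp add: u_def act_mult inv_in act_in act_inv act_one)
    moreover have Feq: "F (snd k x, snd c q + s \<tau>) = snd c (\<Phi> x (p \<tau>))" if "x \<in> fst k" "\<tau> \<in> {0<..<t0}" for x \<tau>
      unfolding F_def using that s_img[OF that(2)] chart_inv_chart[OF ck(2) that(1)]
      by (simp add: prod_chart_inv[OF _ _ ck(2,1)] p_def)
    ultimately have "F (snd k u, snd c q + s t') = F (snd k \<one>\<^bsub>G\<^esub>, snd c q + s t)"
      using uO charts_atD(2)[OF k] t by simp
    moreover have in_ball: "(x, snd c q + s \<tau>) \<in> ball (snd k \<one>\<^bsub>G\<^esub>, snd c q) \<delta>1"
      if "x \<in> ball (snd k \<one>\<^bsub>G\<^esub>) m" "\<tau> \<in> {0<..<t0}" for x \<tau>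
    proof -
      have "dist (snd k \<one>\<^bsub>G\<^esub>, snd c q) (x, snd c q + s \<tau>) \<le> dist (snd k \<one>\<^bsub>G\<^esub>) x + norm (s \<tau>)"
        using norm_Pair_le[of "snd k \<one>\<^bsub>G\<^esub> - x" "- s \<tau>"] by (simp add: dist_norm)
      then show ?thesis using that norm_s[OF that(2)] m by simp
    qed
    moreover have "(snd k u, snd c q + s t') - (snd k \<one>\<^bsub>G\<^esub>, snd c q + s t) \<in> V"
      by (simp add: V_def linear_diff[OF linH] Hs)
    ultimately have "(snd k u, snd c q + s t') = (snd k \<one>\<^bsub>G\<^esub>, snd c q + s t)"
      using uO t m(1) by (intro \<delta>1(2)) auto
    then show "t = t'" using s_inj[of t t'] by simp
  qed
  then show False using t0 uncountable_open_interval by blast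
qed


subsection \<open>Horizontal lifts\<close>

abbreviation "hor \<equiv> horizontal_lift G Q \<Phi> B A"

text \<open>Uniqueness behind the definite description in \<open>horizontal_lift\<close>: the
  difference of the two vectors is horizontal and vertical at once.\<close>

lemma horizontal_eqI:
  assumes q: "q \<in> points Q" and v: "v \<in> tspace Q q" "w \<in> tspace Q q"
    and eq: "A q v = A q w" "tmap Q B \<pi> q v = tmap Q B \<pi> q w"
  shows "v = w"
proof -
  have "lincomb 1 v (-1) w = (\<lambda>_. 0)"
  proof (rule horizontal_vertical_zero[OF q])
    show "lincomb 1 v (-1) w \<in> tspace Q q" by (rule lincomb_in[OF atlases(2) q v])
    show "A q (lincomb 1 v (-1) w) = (\<lambda>_. 0)"
      unfolding A_lincomb[OF q v] eq by (simp add: lincomb_def)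
    show "tmap Q B \<pi> q (lincomb 1 v (-1) w) = (\<lambda>_. 0)"
      unfolding tmap_lincomb[OF atlases(2,3) pi_mdiff[OF q] v] eq by (simp add: lincomb_def)
  qed
  then show ?thesis by (simp add: lincomb_def fun_eq_iff)
qed

lemma hor_eqI:
  assumes q: "q \<in> points Q" and v: "v \<in> tspace Q q" "A q v = (\<lambda>_. 0)" "tmap Q B \<pi> q v = w"
  shows "hor q w = v"
  unfolding horizontal_lift_def using assms horizontal_eqI[OF q] by (intro the_equality) auto

lemma horizontal_part:
  assumes q: "q \<in> points Q" and u: "u \<in> tspace Q q"
  shows "lincomb 1 u (-1) (gen q (A q u)) \<in> tspace Q q" "A q (lincomb 1 u (-1) (gen q (A q u))) = (\<lambda>_. 0)"
    "tmap Q B \<pi> q (lincomb 1 u (-1) (gen q (A q u))) = tmap Q B \<pi> q u"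
proof -
  note g = gen_in[OF q A_in[OF q u]]
  show "lincomb 1 u (-1) (gen q (A q u)) \<in> tspace Q q" by (rule lincomb_in[OF atlases(2) q u g])
  show "A q (lincomb 1 u (-1) (gen q (A q u))) = (\<lambda>_. 0)"
    unfolding A_lincomb[OF q u g] A_gen[OF q A_in[OF q u]] by (simp add: lincomb_def)
  show "tmap Q B \<pi> q (lincomb 1 u (-1) (gen q (A q u))) = tmap Q B \<pi> q u"
    unfolding tmap_lincomb[OF atlases(2,3) pi_mdiff[OF q] u g] tmap_pi_gen[OF q A_in[OF q u]]
    by (simp add: lincomb_def)
qed

text \<open>Every tangent vector of the base has the form T\<pi> u, so this formula yields existence
  as well as the values of all horizontal lifts.\<close>

lemma hor_tmap:
  assumes "q \<in> points Q" "u \<in> tspace Q q"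
  shows "hor q (tmap Q B \<pi> q u) = lincomb 1 u (-1) (gen q (A q u))"
  using horizontal_part[OF assms] by (intro hor_eqI[OF assms(1)]) auto

lemma hor_props:
  assumes q: "q \<in> points Q" and w: "w \<in> tspace B (\<pi> q)"
  shows "hor q w \<in> tspace Q q" "A q (hor q w) = (\<lambda>_. 0)" "tmap Q B \<pi> q (hor q w) = w"
proof -
  have "w \<in> tmap Q B \<pi> q ` tspace Q q" using w tmap_pi_surj[OF q] by simp
  then obtain u where u: "u \<in> tspace Q q" "w = tmap Q B \<pi> q u" by blast
  show "hor q w \<in> tspace Q q" "A q (hor q w) = (\<lambda>_. 0)" "tmap Q B \<pi> q (hor q w) = w"
    unfolding u(2) hor_tmap[OF q u(1)] by (rule horizontal_part[OF q u(1)])+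
qed

lemma horizontal_decomposition:
  assumes q: "q \<in> points Q" and v: "v \<in> tspace Q q"
  shows "lincomb 1 (hor q (tmap Q B \<pi> q v)) 1 (gen q (A q v)) = v"
  unfolding hor_tmap[OF assms] by (simp add: lincomb_def fun_eq_iff)

subsection \<open>The lifted action and the momentum map\<close>

abbreviation "lift_act \<equiv> lifted_action G Q \<Phi>"
abbreviation "J \<equiv> momentum_map G MG Exp Q \<Phi>"
abbreviation "coad \<equiv> coAd G MG"

lemma momentum_apply: "q \<in> points Q \<Longrightarrow> J (q, \<alpha>) = (\<lambda>\<xi>\<in>lie_algebra G MG. \<alpha> (gen q \<xi>))"
  unfolding momentum_map_def by (auto simp: inf_generator_eq intro: restrict_ext)

lemma momentum_in:
  assumes q: "q \<in> points Q" and \<alpha>: "\<alpha> \<in> cotspace Q q"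
  shows "J (q, \<alpha>) \<in> lie_algebra_dual G MG"
  unfolding momentum_apply[OF q]
  by (intro cotspaceI)
    (simp_all add: lincomb_in[OF atlases(1) one_point] gen_lincomb[OF q] gen_in[OF q] cotspace_lincomb[OF \<alpha>])

lemma lifted_apply:
  "lift_act g (q, \<alpha>) = (\<Phi> g q, \<lambda>v\<in>tspace Q (\<Phi> g q). \<alpha> (tmap Q Q (\<Phi> (inv\<^bsub>G\<^esub> g)) (\<Phi> g q) v))"
  by (simp add: lifted_action_def)

lemma lifted_in:
  assumes g: "g \<in> carrier G" and q: "q \<in> points Q" and \<alpha>: "\<alpha> \<in> cotspace Q q"
  shows "(\<lambda>v\<in>tspace Q (\<Phi> g q). \<alpha> (tmap Q Q (\<Phi> (inv\<^bsub>G\<^esub> g)) (\<Phi> g q) v)) \<in> cotspace Q (\<Phi> g q)"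
proof -
  note tl = tmap_lincomb[OF atlases(2,2) act_mdiff(1)[OF inv_in[OF g] act_in[OF g q]]]
  show ?thesis
    by (intro cotspaceI)
      (simp_all add: lincomb_in[OF atlases(2) act_in[OF g q]] tl tmap_act_inv'(1)[OF g q] cotspace_lincomb[OF \<alpha>])
qed

lemma lifted_mult:
  assumes g: "g \<in> carrier G" and h: "h \<in> carrier G" and q: "q \<in> points Q"
  shows "lift_act g (lift_act h (q, \<alpha>)) = lift_act (g \<otimes>\<^bsub>G\<^esub> h) (q, \<alpha>)"
proof -
  have inv: "inv\<^bsub>G\<^esub> (g \<otimes>\<^bsub>G\<^esub> h) = inv\<^bsub>G\<^esub> h \<otimes>\<^bsub>G\<^esub> inv\<^bsub>G\<^esub> g"
    by (rule group.inv_mult_group[OF G_group g h])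
  have hq: "\<Phi> h q \<in> points Q" by (rule act_in[OF h q])
  have ghq: "\<Phi> g (\<Phi> h q) \<in> points Q" by (rule act_in[OF g hq])
  show ?thesis
    unfolding lifted_apply act_mult[OF g h q] inv
    by (intro arg_cong2[where f = Pair] restrict_ext)
      (simp_all add: tmap_act_mult[OF inv_in[OF h] inv_in[OF g] ghq] act_inv(1)[OF g hq] tmap_act_inv'(1)[OF g hq])
qed

lemma lifted_one:
  assumes q: "q \<in> points Q" and \<alpha>: "\<alpha> \<in> cotspace Q q"
  shows "lift_act \<one>\<^bsub>G\<^esub> (q, \<alpha>) = (q, \<alpha>)"
proof -
  have "tmap Q Q (\<Phi> \<one>\<^bsub>G\<^esub>) q = tmap Q Q id q"
    by (rule tmap_cong[OF atlases(2) q]) (simp add: act_one)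
  then have "tmap Q Q (\<Phi> \<one>\<^bsub>G\<^esub>) q v = v" if "v \<in> tspace Q q" for v
    using tmap_id[OF atlases(2) q that] by simp
  moreover have "inv\<^bsub>G\<^esub> \<one>\<^bsub>G\<^esub> = \<one>\<^bsub>G\<^esub>" by (rule monoid.inv_one[OF G_monoid])
  ultimately have "(\<lambda>v\<in>tspace Q q. \<alpha> (tmap Q Q (\<Phi> (inv\<^bsub>G\<^esub> \<one>\<^bsub>G\<^esub>)) q v)) = \<alpha>"
    using \<alpha> by (intro extensionalityI[of _ "tspace Q q"]) (simp_all add: cotspace_def)
  then show ?thesis
    unfolding lifted_apply act_one[OF q] by simp
qed

text \<open>The lifted covector is evaluated on a generator by moving the generator back to q, which
  is \<open>gen_equivariant\<close> for the inverse of g.\<close>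

lemma lifted_momentum:
  assumes g: "g \<in> carrier G" and q: "q \<in> points Q"
  shows "J (lift_act g (q, \<alpha>)) = coad g (J (q, \<alpha>))"
  unfolding lifted_apply momentum_apply[OF act_in[OF g q]] momentum_apply[OF q] coAd_def
  by (rule restrict_ext)
    (simp add: gen_in[OF act_in[OF g q]] gen_equivariant[OF inv_in[OF g] act_in[OF g q]] act_inv(1)[OF g q] Ad_in[OF inv_in[OF g]])

section \<open>Orbits of the lifted action and their representatives\<close>

lemma cot_orbit_eq: "cot_orbit G Q \<Phi> x = {lift_act g x | g. g \<in> carrier G}"
  by (simp add: cot_orbit_def orbit_def)

lemma cot_orbit_lifted:
  assumes g: "g \<in> carrier G" and q: "q \<in> points Q" and \<alpha>: "\<alpha> \<in> cotspace Q q"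
  shows "cot_orbit G Q \<Phi> (lift_act g (q, \<alpha>)) = cot_orbit G Q \<Phi> (q, \<alpha>)"
proof -
  have 1: "lift_act h (lift_act g (q, \<alpha>)) = lift_act (h \<otimes>\<^bsub>G\<^esub> g) (q, \<alpha>)" if "h \<in> carrier G" for h
    by (rule lifted_mult[OF that g q])
  have 2: "lift_act h (q, \<alpha>) = lift_act (h \<otimes>\<^bsub>G\<^esub> inv\<^bsub>G\<^esub> g) (lift_act g (q, \<alpha>))" if h: "h \<in> carrier G" for h
    using 1[OF mult_in[OF h inv_in[OF g]]] monoid.m_assoc[OF G_monoid h inv_in[OF g] g]
    by (simp add: group.l_inv[OF G_group g] monoid.r_one[OF G_monoid h])
  show ?thesis
  proof (intro equalityI subsetI)
    fix x assume "x \<in> cot_orbit G Q \<Phi> (lift_act g (q, \<alpha>))"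
    then obtain h where "h \<in> carrier G" "x = lift_act h (lift_act g (q, \<alpha>))" unfolding cot_orbit_eq by blast
    then show "x \<in> cot_orbit G Q \<Phi> (q, \<alpha>)" unfolding cot_orbit_eq using 1[of h] mult_in[OF _ g] by blast
  next
    fix x assume "x \<in> cot_orbit G Q \<Phi> (q, \<alpha>)"
    then obtain h where "h \<in> carrier G" "x = lift_act h (q, \<alpha>)" unfolding cot_orbit_eq by blast
    then show "x \<in> cot_orbit G Q \<Phi> (lift_act g (q, \<alpha>))"
      unfolding cot_orbit_eq using 2[of h] mult_in[OF _ inv_in[OF g]] by blast
  qed
qed

text \<open>\<open>reduction_map\<close> evaluates an arbitrary element of the orbit; it is a
  translate of the given one, and equivariance absorbs the translation.\<close>

lemma cot_orbit_rep:
  assumes q: "q \<in> points Q" and \<alpha>: "\<alpha> \<in> cotspace Q q"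
  shows "\<exists>g\<in>carrier G. (SOME x. x \<in> cot_orbit G Q \<Phi> (q, \<alpha>)) = lift_act g (q, \<alpha>)"
proof -
  have "lift_act \<one>\<^bsub>G\<^esub> (q, \<alpha>) \<in> cot_orbit G Q \<Phi> (q, \<alpha>)" using one_in by (auto simp: cot_orbit_eq)
  then have "(SOME x. x \<in> cot_orbit G Q \<Phi> (q, \<alpha>)) \<in> cot_orbit G Q \<Phi> (q, \<alpha>)" by (rule someI)
  then show ?thesis by (auto simp: cot_orbit_eq)
qed

abbreviation "red \<equiv> reduction_map G MG Exp Q \<Phi> B A"

lemma reduction_map_rep:
  assumes "(SOME x. x \<in> X) = (q, \<alpha>)"
  shows "red X = ((\<pi> q, \<lambda>w\<in>tspace B (\<pi> q). \<alpha> (hor q w)), assoc_class G MG \<Phi> q (J (q, \<alpha>)))"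
  unfolding reduction_map_def assms by (simp add: Let_def)

subsection \<open>Covectors with a fixed momentum\<close>

text \<open>The inverse of \<Psi> over the class of (q, \<mu>), known as the momentum shift: the
  covector at q with horizontal part \<alpha> and momentum \<mu>.\<close>

definition shift :: "('g, 'l) covec \<Rightarrow> 'q \<Rightarrow> ('q set, 'b) covec \<Rightarrow> ('q, 'e) covec" where
  "shift \<mu> q \<alpha> = (\<lambda>v\<in>tspace Q q. \<alpha> (tmap Q B \<pi> q v) + \<mu> (A q v))"

lemma shift_in:
  assumes q: "q \<in> points Q" and \<alpha>: "\<alpha> \<in> cotspace B (\<pi> q)" and \<mu>: "\<mu> \<in> lie_algebra_dual G MG"
  shows "shift \<mu> q \<alpha> \<in> cotspace Q q"
  unfolding shift_def
  by (intro cotspaceI)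
    (simp_all add: lincomb_in[OF atlases(2) q] tmap_lincomb[OF atlases(2,3) pi_mdiff[OF q]] A_lincomb[OF q]
      cotspace_lincomb[OF \<alpha>] cotspace_lincomb[OF \<mu>] tmap_pi_in[OF q] A_in[OF q] algebra_simps)

lemma cotspace_zero:
  assumes "diff_atlas M" "q \<in> points M" "\<alpha> \<in> cotspace M q"
  shows "\<alpha> (\<lambda>_. 0) = 0"
  using cotspace_lincomb[OF assms(3) zero_in_tspace[OF assms(1,2)] zero_in_tspace[OF assms(1,2)], of 0 0]
  by (simp add: lincomb_def)

lemma shift_momentum:
  assumes q: "q \<in> points Q" and \<alpha>: "\<alpha> \<in> cotspace B (\<pi> q)" and \<mu>: "\<mu> \<in> lie_algebra_dual G MG"
  shows "J (q, shift \<mu> q \<alpha>) = \<mu>"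
proof (rule cotspace_eqI[OF momentum_in[OF q shift_in[OF assms]] \<mu>])
  fix \<xi> assume "\<xi> \<in> lie_algebra G MG"
  then show "J (q, shift \<mu> q \<alpha>) \<xi> = \<mu> \<xi>"
    by (simp add: momentum_apply[OF q] shift_def gen_in[OF q] tmap_pi_gen[OF q] A_gen[OF q]
        cotspace_zero[OF atlases(3) pi_in[OF q] \<alpha>])
qed

lemma shift_hor:
  assumes q: "q \<in> points Q" and \<alpha>: "\<alpha> \<in> cotspace B (\<pi> q)" and \<mu>: "\<mu> \<in> lie_algebra_dual G MG"
  shows "(\<lambda>w\<in>tspace B (\<pi> q). shift \<mu> q \<alpha> (hor q w)) = \<alpha>"
proof -
  have "shift \<mu> q \<alpha> (hor q w) = \<alpha> w" if "w \<in> tspace B (\<pi> q)" for w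
    using hor_props[OF q that] by (simp add: shift_def cotspace_zero[OF atlases(1) one_point \<mu>])
  then show ?thesis
    using \<alpha> by (auto simp: cotspace_def extensional_def fun_eq_iff)
qed

text \<open>A vector is the horizontal lift of its projection plus a generator; the first part sees
  the reduced covector, the second the momentum.\<close>

lemma shift_of_momentum:
  assumes q: "q \<in> points Q" and \<alpha>: "\<alpha> \<in> cotspace Q q"
  shows "shift (J (q, \<alpha>)) q (\<lambda>w\<in>tspace B (\<pi> q). \<alpha> (hor q w)) = \<alpha>"
proof -
  have "\<alpha> (hor q (tmap Q B \<pi> q v)) + \<alpha> (gen q (A q v)) = \<alpha> v" if v: "v \<in> tspace Q q" for v
    using cotspace_lincomb[OF \<alpha> hor_props(1)[OF q tmap_pi_in[OF q v]] gen_in[OF q A_in[OF q v]], of 1 1]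
      horizontal_decomposition[OF q v] by simp
  then have "shift (J (q, \<alpha>)) q (\<lambda>w\<in>tspace B (\<pi> q). \<alpha> (hor q w)) v = \<alpha> v" if "v \<in> tspace Q q" for v
    using that by (simp add: shift_def momentum_apply[OF q] tmap_pi_in[OF q] A_in[OF q])
  then show ?thesis
    using \<alpha> by (intro extensionalityI[of _ "tspace Q q"]) (auto simp: shift_def cotspace_def)
qed

text \<open>The part pulled back along \<pi> is invariant, and the pairing of \<mu> with the
  connection is invariant because \<mu> is fixed by the coadjoint action.\<close>

lemma lifted_shift:
  assumes g: "g \<in> carrier G" and q: "q \<in> points Q" and fixed: "coad g \<mu> = \<mu>"
  shows "lift_act g (q, shift \<mu> q \<alpha>) = (\<Phi> g q, shift \<mu> (\<Phi> g q) \<alpha>)"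
proof -
  let ?g = "\<Phi> (inv\<^bsub>G\<^esub> g)" and ?q = "\<Phi> g q"
  have gq: "?q \<in> points Q" by (rule act_in[OF g q])
  have "shift \<mu> q \<alpha> (tmap Q Q ?g ?q v) = \<alpha> (tmap Q B \<pi> ?q v) + \<mu> (A ?q v)" if v: "v \<in> tspace Q ?q" for v
  proof -
    have 1: "tmap Q B \<pi> q (tmap Q Q ?g ?q v) = tmap Q B \<pi> ?q v"
      using tmap_pi_act[OF inv_in[OF g] gq v] act_inv(1)[OF g q] by simp
    have 2: "A q (tmap Q Q ?g ?q v) = Ad G MG (inv\<^bsub>G\<^esub> g) (A ?q v)"
      using A_equivariant[OF inv_in[OF g] gq v] act_inv(1)[OF g q] by simp
    have "\<mu> (Ad G MG (inv\<^bsub>G\<^esub> g) (A ?q v)) = coad g \<mu> (A ?q v)"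
      using A_in[OF gq v] by (simp add: coAd_def)
    then show ?thesis
      using tmap_act_inv'(1)[OF g q v] by (simp add: shift_def 1 2 fixed)
  qed
  then show ?thesis
    unfolding lifted_apply shift_def[of \<mu> ?q] by (simp cong: restrict_cong)
qed

lemma assoc_class_fixed:
  assumes "\<And>g. g \<in> carrier G \<Longrightarrow> coad g \<mu> = \<mu>"
  shows "assoc_class G MG \<Phi> q \<mu> = \<pi> q \<times> {\<mu>}"
  using assms unfolding assoc_class_def orbit_def by auto

lemma cot_orbit_shift_rep:
  assumes q: "q \<in> points Q" and \<alpha>: "\<alpha> \<in> cotspace B (\<pi> q)" and \<mu>: "\<mu> \<in> lie_algebra_dual G MG"
    and fixed: "\<And>g. g \<in> carrier G \<Longrightarrow> coad g \<mu> = \<mu>"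
  shows "red (cot_orbit G Q \<Phi> (q, shift \<mu> q \<alpha>)) = ((\<pi> q, \<alpha>), \<pi> q \<times> {\<mu>})"
proof -
  obtain g where g: "g \<in> carrier G"
      "(SOME x. x \<in> cot_orbit G Q \<Phi> (q, shift \<mu> q \<alpha>)) = (\<Phi> g q, shift \<mu> (\<Phi> g q) \<alpha>)"
    using cot_orbit_rep[OF q shift_in[OF q \<alpha> \<mu>]] lifted_shift[OF _ q fixed] by metis
  have gq: "\<Phi> g q \<in> points Q" and \<pi>gq: "\<pi> (\<Phi> g q) = \<pi> q"
    using act_in[OF g(1) q] pi_act[OF g(1) q] by auto
  then have \<alpha>': "\<alpha> \<in> cotspace B (\<pi> (\<Phi> g q))" using \<alpha> by simp
  have "assoc_class G MG \<Phi> (\<Phi> g q) \<mu> = \<pi> (\<Phi> g q) \<times> {\<mu>}"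
    by (rule assoc_class_fixed) (rule fixed)
  then show ?thesis
    unfolding reduction_map_rep[OF g(2)] shift_hor[OF gq \<alpha>' \<mu>] shift_momentum[OF gq \<alpha>' \<mu>]
    by (simp add: \<pi>gq)
qed

text \<open>\<open>\<Psi>\<close> is only inverted over \<open>[q, \<mu>]\<close> with \<open>\<mu>\<close> fixed, where momentum and horizontal part determine
  the covector.\<close>

lemma reduced_hamiltonian_eq:
  assumes q: "q \<in> points Q" and \<alpha>: "\<alpha> \<in> cotspace B (\<pi> q)" and \<mu>: "\<mu> \<in> lie_algebra_dual G MG"
    and fixed: "\<And>g. g \<in> carrier G \<Longrightarrow> coad g \<mu> = \<mu>"
    and h: "\<And>g x. g \<in> carrier G \<Longrightarrow> x \<in> points (cot_bundle Q) \<Longrightarrow> h (lift_act g x) = h x"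
    and hG: "\<And>x. x \<in> points (cot_bundle Q) \<Longrightarrow> hG (cot_orbit G Q \<Phi> x) = h x"
  shows "reduced_hamiltonian G MG Exp Q \<Phi> B A \<mu> hG (\<pi> q, \<alpha>) = h (q, shift \<mu> q \<alpha>)"
proof -
  define q0 where "q0 = (SOME q'. q' \<in> points Q \<and> \<pi> q' = \<pi> q)"
  have q0: "q0 \<in> points Q" "\<pi> q0 = \<pi> q"
    using someI[of "\<lambda>q'. q' \<in> points Q \<and> \<pi> q' = \<pi> q" q] q by (auto simp: q0_def)
  define X where "X = inv_into (cot_orbits G Q \<Phi>) red ((\<pi> q, \<alpha>), \<pi> q \<times> {\<mu>})"
  have "cot_orbit G Q \<Phi> (q, shift \<mu> q \<alpha>) \<in> cot_orbits G Q \<Phi>"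
    using q shift_in[OF q \<alpha> \<mu>] unfolding cot_orbits_def orbits_def cot_orbit_def by (auto simp: points_cot_bundle)
  then have in_img: "((\<pi> q, \<alpha>), \<pi> q \<times> {\<mu>}) \<in> red ` cot_orbits G Q \<Phi>"
    using cot_orbit_shift_rep[OF q \<alpha> \<mu> fixed] by (metis image_eqI)
  have X: "X \<in> cot_orbits G Q \<Phi>" "red X = ((\<pi> q, \<alpha>), \<pi> q \<times> {\<mu>})"
    unfolding X_def by (rule inv_into_into[OF in_img], rule f_inv_into_f[OF in_img])
  then obtain q1 \<alpha>1 where x1: "q1 \<in> points Q" "\<alpha>1 \<in> cotspace Q q1" "X = cot_orbit G Q \<Phi> (q1, \<alpha>1)"
    unfolding cot_orbits_def orbits_def cot_orbit_def by (auto simp: points_cot_bundle)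
  obtain g where g: "g \<in> carrier G" "(SOME x. x \<in> X) = lift_act g (q1, \<alpha>1)"
    using cot_orbit_rep[OF x1(1,2)] unfolding x1(3) by blast
  obtain q2 \<alpha>2 where x2: "lift_act g (q1, \<alpha>1) = (q2, \<alpha>2)" by (cases "lift_act g (q1, \<alpha>1)")
  have q2: "q2 \<in> points Q" and \<alpha>2: "\<alpha>2 \<in> cotspace Q q2"
    using x2 act_in[OF g(1) x1(1)] lifted_in[OF g(1) x1(1,2)] unfolding lifted_apply by auto
  have redX: "((\<pi> q2, \<lambda>w\<in>tspace B (\<pi> q2). \<alpha>2 (hor q2 w)), assoc_class G MG \<Phi> q2 (J (q2, \<alpha>2))) =
      ((\<pi> q, \<alpha>), \<pi> q \<times> {\<mu>})"
    using reduction_map_rep[of X q2 \<alpha>2] unfolding X(2) g(2) x2 by (rule sym) simp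
  then have \<pi>q2: "\<pi> q2 = \<pi> q" and \<alpha>_eq: "(\<lambda>w\<in>tspace B (\<pi> q2). \<alpha>2 (hor q2 w)) = \<alpha>"
    and assoc: "assoc_class G MG \<Phi> q2 (J (q2, \<alpha>2)) = \<pi> q \<times> {\<mu>}"
    by auto
  \<comment> \<open>The identity element exhibits the momentum inside its own class. The coadjoint
    action of the identity is then removed through equivariance of \<open>J\<close> and
    \<open>lifted_one\<close>.\<close>
  have "(\<Phi> \<one>\<^bsub>G\<^esub> q2, coad \<one>\<^bsub>G\<^esub> (J (q2, \<alpha>2))) \<in> assoc_class G MG \<Phi> q2 (J (q2, \<alpha>2))"
    unfolding assoc_class_def orbit_def using one_in by force
  then have "coad \<one>\<^bsub>G\<^esub> (J (q2, \<alpha>2)) = \<mu>" unfolding assoc by simp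
  then have J2: "J (q2, \<alpha>2) = \<mu>"
    using lifted_momentum[OF one_in q2, of \<alpha>2] lifted_one[OF q2 \<alpha>2] by simp
  then have \<alpha>2_eq: "\<alpha>2 = shift \<mu> q2 \<alpha>" using shift_of_momentum[OF q2 \<alpha>2] \<alpha>_eq by simp
  obtain g' where g': "g' \<in> carrier G" "q2 = \<Phi> g' q" using pi_eqD[OF q q2] \<pi>q2 by auto
  have "reduced_hamiltonian G MG Exp Q \<Phi> B A \<mu> hG (\<pi> q, \<alpha>) = hG X"
    using assoc_class_fixed[OF fixed, of q0]
    unfolding reduced_hamiltonian_def Let_def fst_conv q0_def[symmetric] q0(2) X_def by simp
  also have "X = cot_orbit G Q \<Phi> (q2, \<alpha>2)"
    using cot_orbit_lifted[OF g(1) x1(1,2)] x1(3) x2 by simp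
  also have "hG (cot_orbit G Q \<Phi> (q2, \<alpha>2)) = h (q2, \<alpha>2)"
    using q2 \<alpha>2 by (intro hG) (simp add: points_cot_bundle)
  also have "(q2, \<alpha>2) = lift_act g' (q, shift \<mu> q \<alpha>)"
    unfolding lifted_shift[OF g'(1) q fixed[OF g'(1)]] \<alpha>2_eq g'(2) ..
  also have "h (lift_act g' (q, shift \<mu> q \<alpha>)) = h (q, shift \<mu> q \<alpha>)"
    using q shift_in[OF q \<alpha> \<mu>] by (intro h g') (simp add: points_cot_bundle)
  finally show ?thesis .
qed


subsection \<open>Differentiability of the reduced Hamiltonian\<close>

text \<open>In coordinates the shift is affine in p: the transposed Jacobian of \<pi>, plus the
  components of the pairing of \<mu> with the connection. Both coefficients depend differentiably on
  the point.\<close>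

lemma shift_coord:
  assumes q: "q \<in> points Q" and c: "c \<in> charts_at Q q" and d: "d \<in> charts_at B (\<pi> q)"
    and \<mu>: "\<mu> \<in> lie_algebra_dual G MG"
  shows "cov_coord Q q c (shift \<mu> q (cov B (\<pi> q) d p)) =
    (\<Sum>b\<in>onb. (p \<bullet> cderiv c d \<pi> q b) *\<^sub>R b) + cov_coord Q q c (pair_form Q \<mu> A q)"
proof (rule cov_coord_eqI[OF atlases(2) c])
  fix v assume v: "v \<in> tspace Q q"
  have lin: "linear (cderiv c d \<pi> q)" by (rule cderiv_linear[OF pi_mdiff[OF q] c d])
  then have "linear (\<lambda>y. p \<bullet> cderiv c d \<pi> q y)"
    by (intro linearI) (simp_all add: linear_add linear_scale inner_add_right)
  then have 1: "(\<Sum>b\<in>onb. (p \<bullet> cderiv c d \<pi> q b) *\<^sub>R b) \<bullet> v c = p \<bullet> cderiv c d \<pi> q (v c)"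
    by (rule riesz_representation)
  have pf: "(q, pair_form Q \<mu> A q) \<in> points (cot_bundle Q)"
    using smooth_map_points[OF A_smooth[OF \<mu>, unfolded one_form_def] q] .
  have "pair_form Q \<mu> A q v = cov_coord Q q c (pair_form Q \<mu> A q) \<bullet> v c"
    using pf by (intro cov_coord_apply[OF atlases(2) c _ v]) (simp add: points_cot_bundle)
  then show "shift \<mu> q (cov B (\<pi> q) d p) v =
      ((\<Sum>b\<in>onb. (p \<bullet> cderiv c d \<pi> q b) *\<^sub>R b) + cov_coord Q q c (pair_form Q \<mu> A q)) \<bullet> v c"
    using v tmap_component[OF atlases(2) pi_mdiff[OF q] v c d]
    by (simp add: shift_def cov_apply tmap_pi_in[OF q] inner_add_left 1 pair_form_def)
qed

text \<open>In coordinates \<open>f\<close> is \<open>h\<close> composed with the map that lifts along a local section of \<open>\<pi>\<close>; the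
  section need only be differentiable at one point.\<close>

lemma reduced_function_mdiff:
  assumes q: "q \<in> points Q" and \<alpha>: "\<alpha> \<in> cotspace B (\<pi> q)" and \<mu>: "\<mu> \<in> lie_algebra_dual G MG"
    and h: "mdiff (cot_bundle Q) vector_space_atlas h (q, shift \<mu> q \<alpha>)"
    and f: "\<And>q \<alpha>. q \<in> points Q \<Longrightarrow> \<alpha> \<in> cotspace B (\<pi> q) \<Longrightarrow> f (\<pi> q, \<alpha>) = h (q, shift \<mu> q \<alpha>)"
  shows "mdiff (cot_bundle B) (vector_space_atlas :: (real, real) atlas) f (\<pi> q, \<alpha>)"
  unfolding mdiff_def
proof (intro conjI ballI)
  show "(\<pi> q, \<alpha>) \<in> points (cot_bundle B)" using pi_in[OF q] \<alpha> by (simp add: points_cot_bundle)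
  show "f (\<pi> q, \<alpha>) \<in> points vector_space_atlas" by (simp add: vector_space_chart)
  fix C e assume C: "C \<in> charts_at (cot_bundle B) (\<pi> q, \<alpha>)"
    and "e \<in> charts_at (vector_space_atlas :: (real, real) atlas) (f (\<pi> q, \<alpha>))"
  then have e: "e = (UNIV, id)" by (simp add: vector_space_chart)
  show "\<forall>\<^sub>F z in nhds (snd C (\<pi> q, \<alpha>)). f (chart_inv C z) \<in> fst e" by (simp add: e)
  obtain d where d: "C = cot_chart B d" "d \<in> charts_at B (\<pi> q)"
    using C charts_at_cot_bundle[OF \<alpha>] by auto
  define c where "c = chart_at Q q"
  have c: "c \<in> charts_at Q q" unfolding c_def by (rule chart_at_in[OF q])
  note cM = charts_atD(1)[OF c] and dM = charts_atD(1)[OF d(2)]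
  have ic: "is_chart c" and id: "is_chart d"
    using diff_atlasD(1)[OF atlases(2) cM] diff_atlasD(1)[OF atlases(3) dM] by auto
  let ?p = "snd d \<circ> \<pi> \<circ> chart_inv c" and ?x0 = "snd c q"
  let ?U = "snd c ` (fst c \<inter> \<pi> -` fst d)"
  have U: "open ?U" "?x0 \<in> ?U"
    using smooth_map_chart_open[OF atlases(2) pi_smooth cM dM] charts_atD(2)[OF c] charts_atD(2)[OF d(2)] by auto
  have p_smooth: "smooth_on ?U ?p" using pi_smooth cM dM by (simp add: smooth_map_def)
  have inv0: "chart_inv c ?x0 = q" using chart_inv_chart[OF ic charts_atD(2)[OF c]] .
  have p0: "?p ?x0 = snd d (\<pi> q)" by (simp add: inv0)
  have lin: "linear (cderiv c d \<pi> q)" by (rule cderiv_linear[OF pi_mdiff[OF q] c d(2)])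
  have "surj (cderiv c d \<pi> q)"
  proof (rule surjI)
    fix y
    have "chart_vec B (\<pi> q) d y \<in> tmap Q B \<pi> q ` tspace Q q"
      using tmap_pi_surj[OF q] chart_vec_in[OF atlases(3) d(2)] by simp
    then obtain u where "u \<in> tspace Q q" "chart_vec B (\<pi> q) d y = tmap Q B \<pi> q u" by blast
    then have "cderiv c d \<pi> q (u c) = y"
      using tmap_component[OF atlases(2) pi_mdiff[OF q] _ c d(2)] chart_vec_same[OF atlases(3) d(2)] by metis
    then show "cderiv c d \<pi> q (SOME z. cderiv c d \<pi> q z = y) = y" by (rule someI)
  qed
  then obtain R where R: "linear R" "cderiv c d \<pi> q \<circ> R = id"
    using linear_surjective_right_inverse[OF lin] by blast
  have "cderiv c d \<pi> q (R y) = y" for y using fun_cong[OF R(2), of y] by simp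
  from strict_deriv_local_section[OF smooth_map_strict_deriv[OF atlases(2) pi_smooth c d(2)] R(1) this]
  obtain \<sigma> where \<sigma>: "(\<sigma> has_derivative R) (at (snd d (\<pi> q)))" "\<sigma> (snd d (\<pi> q)) = ?x0"
    "\<forall>\<^sub>F z in nhds (snd d (\<pi> q)). ?p (\<sigma> z) = z"
    unfolding p0 by blast
  define m where "m x = cov_coord Q (chart_inv c x) c (pair_form Q \<mu> A (chart_inv c x))" for x
  \<comment> \<open>By \<open>shift_coord\<close> this is the map sending a covector over \<pi> x to
    its shift at x, in coordinates and with x taken along the section \<sigma>.\<close>
  define \<Theta> where "\<Theta> w = (\<sigma> (fst w), (\<Sum>b\<in>onb. (snd w \<bullet> frechet_derivative ?p (at (\<sigma> (fst w))) b) *\<^sub>R b) + m (\<sigma> (fst w)))" for w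
  let ?w0 = "snd C (\<pi> q, \<alpha>)"
  have w0: "?w0 = (snd d (\<pi> q), cov_coord B (\<pi> q) d \<alpha>)" by (simp add: d(1) snd_cot_chart)
  have \<sigma>_diff: "\<sigma> differentiable (at (snd d (\<pi> q)))" using \<sigma>(1) differentiable_def by blast
  have comp: "(\<lambda>w. g (\<sigma> (fst w))) differentiable (at ?w0)" if "g differentiable (at ?x0)" for g :: "'e \<Rightarrow> 'z::real_normed_vector"
  proof -
    have "(g \<circ> \<sigma>) differentiable (at (snd d (\<pi> q)))"
      using that \<sigma>_diff \<sigma>(2) by (intro differentiable_chain_at) simp_all
    then show ?thesis
      using differentiable_compose_fst[of "g \<circ> \<sigma>" ?w0] by (simp add: w0 o_def)
  qed
  have m_diff: "m differentiable (at ?x0)"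
  proof -
    let ?s = "\<lambda>q. (q, pair_form Q \<mu> A q)"
    have s: "mdiff Q (cot_bundle Q) ?s q"
      using smooth_map_mdiff[OF atlases(2) A_smooth[OF \<mu>, unfolded one_form_def] q] .
    then have "pair_form Q \<mu> A q \<in> cotspace Q q" using mdiffD(2)[OF s] by (simp add: points_cot_bundle)
    then have "cot_chart Q c \<in> charts_at (cot_bundle Q) (?s q)"
      using charts_at_cot_bundle[of "pair_form Q \<mu> A q" Q q] c by simp
    then have "(snd (cot_chart Q c) \<circ> ?s \<circ> chart_inv c) differentiable (at ?x0)"
      using s c unfolding mdiff_def by blast
    then obtain D where "(snd (cot_chart Q c) \<circ> ?s \<circ> chart_inv c has_derivative D) (at ?x0)"
      unfolding differentiable_def by blast
    from has_derivative_snd[OF this] show ?thesis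
      unfolding differentiable_def m_def by (auto simp: snd_cot_chart o_def)
  qed
  have \<Theta>_diff: "\<Theta> differentiable (at ?w0)"
    unfolding \<Theta>_def
  proof (intro differentiable_Pair_at differentiable_add differentiable_inner_scaleR_onb)
    show "(\<lambda>w. \<sigma> (fst w)) differentiable (at ?w0)" using comp[of "\<lambda>x. x"] by simp
    show "snd differentiable (at ?w0)" by (simp add: bounded_linear_imp_differentiable bounded_linear_snd)
    show "(\<lambda>w. m (\<sigma> (fst w))) differentiable (at ?w0)" by (rule comp[OF m_diff])
    show "(\<lambda>w. frechet_derivative ?p (at (\<sigma> (fst w))) b) differentiable (at ?w0)" for b
      by (rule comp[OF smooth_on_differentiable[OF smooth_on_frechet_derivative[OF p_smooth] U(2)]])
  qed
  have near: "\<forall>\<^sub>F w in nhds ?w0. ?p (\<sigma> (fst w)) = fst w \<and> \<sigma> (fst w) \<in> ?U"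
  proof -
    have "(\<sigma> \<longlongrightarrow> \<sigma> (snd d (\<pi> q))) (nhds (snd d (\<pi> q)))"
      using has_derivative_continuous[OF \<sigma>(1)] by (simp only: continuous_at tendsto_at_iff_tendsto_nhds)
    then have "\<forall>\<^sub>F z in nhds (snd d (\<pi> q)). \<sigma> z \<in> ?U"
      using U \<sigma>(2) by (intro topological_tendstoD) auto
    with \<sigma>(3) have "\<forall>\<^sub>F z in nhds (snd d (\<pi> q)). ?p (\<sigma> z) = z \<and> \<sigma> z \<in> ?U" by (rule eventually_conj)
    moreover have "(fst \<longlongrightarrow> snd d (\<pi> q)) (nhds ?w0)"
      using tendsto_fst[OF filterlim_ident[of "nhds ?w0"]] by (simp add: w0)
    ultimately show ?thesis by (rule eventually_compose_filterlim)
  qed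
  let ?K = "h \<circ> chart_inv (cot_chart Q c)"
  \<comment> \<open>The hypothesis on \<open>f\<close> holds at every point of a fibre, so the value
    of \<open>h\<close> is the same whichever point \<sigma> selects.\<close>
  have key: "\<forall>\<^sub>F w in nhds ?w0. (?K \<circ> \<Theta>) w = (snd e \<circ> f \<circ> chart_inv C) w"
    using near
  proof eventually_elim
    case (elim w)
    then obtain x where x: "x \<in> fst c" "\<pi> x \<in> fst d" "\<sigma> (fst w) = snd c x" by auto
    have xc: "c \<in> charts_at Q x" and xd: "d \<in> charts_at B (\<pi> x)" and xQ: "x \<in> points Q"
      using x cM dM by (auto simp: charts_at_def points_def)
    have inv: "chart_inv c (snd c x) = x" using chart_inv_chart[OF ic x(1)] .
    have fw: "fst w = snd d (\<pi> x)" using elim x(3) inv by simp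
    have "chart_inv C (snd d (\<pi> x), snd w) = (\<pi> x, cov B (\<pi> x) d (snd w))"
      using chart_inv_cot_chart[OF atlases(3) dM, of "snd d (\<pi> x)" "snd w"] x(2) chart_inv_chart[OF id x(2)]
      by (simp add: d(1))
    then have "chart_inv C w = (\<pi> x, cov B (\<pi> x) d (snd w))"
      by (metis fw prod.collapse)
    then have "(snd e \<circ> f \<circ> chart_inv C) w = h (x, shift \<mu> x (cov B (\<pi> x) d (snd w)))"
      using f[OF xQ cov_in[OF atlases(3) pi_in[OF xQ]]] by (simp add: e)
    moreover have "\<Theta> w = (snd c x, cov_coord Q x c (shift \<mu> x (cov B (\<pi> x) d (snd w))))"
      unfolding shift_coord[OF xQ xc xd \<mu>] by (simp add: \<Theta>_def m_def x(3) inv cderiv_def)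
    moreover have "chart_inv (cot_chart Q c) (snd c x, cov_coord Q x c (shift \<mu> x (cov B (\<pi> x) d (snd w)))) =
        (x, shift \<mu> x (cov B (\<pi> x) d (snd w)))"
      using chart_inv_cot_chart[OF atlases(2) cM, of "snd c x"] x(1) inv
        cov_of_coord[OF atlases(2) xc shift_in[OF xQ cov_in[OF atlases(3) pi_in[OF xQ]] \<mu>]] by simp
    ultimately show ?case by simp
  qed
  have "\<Theta> ?w0 = snd (cot_chart Q c) (q, shift \<mu> q \<alpha>)"
  proof -
    have "cov B (\<pi> q) d (cov_coord B (\<pi> q) d \<alpha>) = \<alpha>" by (rule cov_of_coord[OF atlases(3) d(2) \<alpha>])
    then show ?thesis
      using shift_coord[OF q c d(2) \<mu>, of "cov_coord B (\<pi> q) d \<alpha>"]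
      by (simp add: \<Theta>_def w0 \<sigma>(2) m_def inv0 snd_cot_chart cderiv_def)
  qed
  moreover have "?K differentiable (at (snd (cot_chart Q c) (q, shift \<mu> q \<alpha>)))"
  proof -
    have "cot_chart Q c \<in> charts_at (cot_bundle Q) (q, shift \<mu> q \<alpha>)"
      using charts_at_cot_bundle[OF shift_in[OF q \<alpha> \<mu>]] c by simp
    then have "(snd (UNIV, id) \<circ> h \<circ> chart_inv (cot_chart Q c)) differentiable (at (snd (cot_chart Q c) (q, shift \<mu> q \<alpha>)))"
      using h unfolding mdiff_def by (auto simp: vector_space_chart)
    then show ?thesis by simp
  qed
  ultimately have "(?K \<circ> \<Theta>) differentiable (at ?w0)"
    using \<Theta>_diff by (intro differentiable_chain_at) simp_all
  then show "snd e \<circ> f \<circ> chart_inv C differentiable at ?w0"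
    using key by (rule differentiable_transform_eventually)
qed

end

text \<open>Test with the covector whose coordinate vector is the difference of the two
  components.\<close>

lemma covector_separates:
  assumes N: "diff_atlas N" and q: "q \<in> points N" and v: "v \<in> tspace N q" "w \<in> tspace N q"
    and eq: "\<And>\<eta>. \<eta> \<in> cotspace N q \<Longrightarrow> \<eta> v = \<eta> w"
  shows "v = w"
proof (rule tspace_eqI[OF v chart_at_in[OF q]])
  let ?c = "chart_at N q"
  have "(v ?c - w ?c) \<bullet> v ?c = (v ?c - w ?c) \<bullet> w ?c"
    using eq[OF cov_in[OF N q, of ?c "v ?c - w ?c"]] v by (simp add: cov_apply)
  then have "(v ?c - w ?c) \<bullet> (v ?c - w ?c) = 0" by (simp add: inner_diff_right)
  then show "v ?c = w ?c" by simp
qed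

section \<open>The projected vector fields\<close>

theorem mainTheorem3:
  fixes G :: "('g, 'm) monoid_scheme"
    and MG :: "('g, 'l::fin_dim_inner) atlas"
    and Exp :: "('g, 'l) tvec \<Rightarrow> 'g"
    and Q :: "('q, 'e::fin_dim_inner) atlas"
    and \<Phi> :: "'g \<Rightarrow> 'q \<Rightarrow> 'q"
    and B :: "('q set, 'b::fin_dim_inner) atlas"
    and A :: "'q \<Rightarrow> ('q, 'e) tvec \<Rightarrow> ('g, 'l) tvec"
    and h :: "'q \<times> ('q, 'e) covec \<Rightarrow> real"
    and hG :: "('q \<times> ('q, 'e) covec) set \<Rightarrow> real"
    and \<gamma> :: "'q \<Rightarrow> ('q, 'e) covec"
    and \<mu> :: "('g, 'l) covec"
    and \<gamma>t :: "'q set \<Rightarrow> ('q set, 'b) covec"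
    and \<beta> :: "'q set \<Rightarrow> ('q set, 'b) tvec \<Rightarrow> ('q set, 'b) tvec \<Rightarrow> real"
  assumes lie_group: "lie_group G MG"
    and connected: "connected_space (mtop MG)"
    and exp: "exponential_map G MG Exp"
    and manifold: "smooth_manifold Q"
    and action: "smooth_action G MG Q \<Phi>" "free_action G Q \<Phi>" "proper_action MG Q \<Phi>"
    and quotient: "quotient_manifold G Q \<Phi> B"
    and connection: "principal_connection G MG Exp Q \<Phi> A"
    and h_smooth: "smooth_fun (cot_bundle Q) h"
    and h_invariant:
      "\<forall>g\<in>carrier G. \<forall>x\<in>points (cot_bundle Q). h (lifted_action G Q \<Phi> g x) = h x"
    and hG: "\<forall>x\<in>points (cot_bundle Q). hG (cot_orbit G Q \<Phi> x) = h x"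
    and \<gamma>: "one_form Q \<gamma>"
    and L_solution: "HJ_solution Q h (form_image Q \<gamma>)"
    and L_invariant:
      "\<forall>g\<in>carrier G. lifted_action G Q \<Phi> g ` form_image Q \<gamma> = form_image Q \<gamma>"
    and L_momentum: "momentum_map G MG Exp Q \<Phi> ` form_image Q \<gamma> = {\<mu>}"
    and \<gamma>t: "one_form B \<gamma>t"
      "form_image B \<gamma>t = reduced_set G MG Exp Q \<Phi> B A (form_image Q \<gamma>)"
    and \<beta>: "two_form B \<beta>"
      "\<forall>q\<in>points Q. \<forall>u\<in>tspace Q q. \<forall>v\<in>tspace Q q.
         pullback2 Q B (orbit G \<Phi>) \<beta> q u v = ext_deriv Q (pair_form Q \<mu> A) q u v"
  shows "let X = projected_vf Q (canonical_symplectic Q) h \<gamma>;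
             Xt = projected_vf B (magnetic_symplectic B \<beta>)
                    (reduced_hamiltonian G MG Exp Q \<Phi> B A \<mu> hG) \<gamma>t
         in (\<forall>q\<in>points Q. tmap Q B (orbit G \<Phi>) q (X q) = Xt (orbit G \<Phi> q)) \<and>
            (\<forall>g\<in>carrier G. \<forall>q\<in>points Q. tmap Q Q (\<Phi> g) q (X q) = X (\<Phi> g q))"
proof -
  interpret principal_setting G MG Exp Q \<Phi> B A
    by unfold_locales (fact lie_group exp manifold action(1) quotient connection)+
  define X where "X = projected_vf Q (canonical_symplectic Q) h \<gamma>"
  define ht where "ht = reduced_hamiltonian G MG Exp Q \<Phi> B A \<mu> hG"
  define Xt where "Xt = projected_vf B (magnetic_symplectic B \<beta>) ht \<gamma>t"
  have \<gamma>_in: "\<gamma> q \<in> cotspace Q q" if "q \<in> points Q" for q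
    using smooth_map_points[OF \<gamma>[unfolded one_form_def] that] by (simp add: points_cot_bundle)
  have \<gamma>t_in: "\<gamma>t b \<in> cotspace B b" if "b \<in> points B" for b
    using smooth_map_points[OF \<gamma>t(1)[unfolded one_form_def] that] by (simp add: points_cot_bundle)
  have J_\<gamma>: "J (q, \<gamma> q) = \<mu>" if "q \<in> points Q" for q
    using L_momentum that unfolding form_image_def by blast
  have lift_\<gamma>: "lift_act g (q, \<gamma> q) = (\<Phi> g q, \<gamma> (\<Phi> g q))" if "g \<in> carrier G" "q \<in> points Q" for g q
  proof -
    have "lift_act g (q, \<gamma> q) \<in> form_image Q \<gamma>" using L_invariant that unfolding form_image_def by blast
    then show ?thesis by (auto simp: form_image_def lifted_apply)
  qed
  have "form_image Q \<gamma> \<noteq> {}" using L_momentum by auto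
  then obtain q0 where q0: "q0 \<in> points Q" by (auto simp: form_image_def)
  have \<mu>: "\<mu> \<in> lie_algebra_dual G MG"
    using momentum_in[OF q0 \<gamma>_in[OF q0]] J_\<gamma>[OF q0] by simp
  \<comment> \<open>A translate of a point of L lies on L again, where the momentum is still \<mu>;
    equivariance of \<open>J\<close> does the rest.\<close>
  have fixed: "coad g \<mu> = \<mu>" if "g \<in> carrier G" for g
    using lifted_momentum[OF that q0, of "\<gamma> q0"] lift_\<gamma>[OF that q0] J_\<gamma>[OF q0] J_\<gamma>[OF act_in[OF that q0]] by simp
  have ht: "ht (\<pi> q, \<alpha>) = h (q, shift \<mu> q \<alpha>)" if "q \<in> points Q" "\<alpha> \<in> cotspace B (\<pi> q)" for q \<alpha>
    unfolding ht_def using h_invariant hG by (intro reduced_hamiltonian_eq[OF that \<mu> fixed]) auto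
  \<comment> \<open>\<open>\<gamma>t\<close> is known only through its image, hence through some
    representative q2 over \<pi> q. The identity holds at q2 by \<open>shift_of_momentum\<close> and
    is transported to q by equivariance of both sides.\<close>
  have \<gamma>_shift: "\<gamma> q = shift \<mu> q (\<gamma>t (\<pi> q))" if q: "q \<in> points Q" for q
  proof -
    have "(\<pi> q, \<gamma>t (\<pi> q)) \<in> reduced_set G MG Exp Q \<Phi> B A (form_image Q \<gamma>)"
      using \<gamma>t(2) pi_in[OF q] unfolding form_image_def[of B] by blast
    then obtain q1 where q1: "q1 \<in> points Q" "(\<pi> q, \<gamma>t (\<pi> q)) = fst (red (cot_orbit G Q \<Phi> (q1, \<gamma> q1)))"
      unfolding reduced_set_def form_image_def by blast
    obtain g where g: "g \<in> carrier G" "(SOME x. x \<in> cot_orbit G Q \<Phi> (q1, \<gamma> q1)) = (\<Phi> g q1, \<gamma> (\<Phi> g q1))"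
      using cot_orbit_rep[OF q1(1) \<gamma>_in[OF q1(1)]] lift_\<gamma>[OF _ q1(1)] by metis
    define q2 where "q2 = \<Phi> g q1"
    have q2: "q2 \<in> points Q" unfolding q2_def by (rule act_in[OF g(1) q1(1)])
    have eq: "\<pi> q = \<pi> q2" "\<gamma>t (\<pi> q) = (\<lambda>w\<in>tspace B (\<pi> q2). \<gamma> q2 (hor q2 w))"
      using q1(2) unfolding reduction_map_rep[OF g(2)] q2_def[symmetric] by auto
    have \<gamma>2: "\<gamma> q2 = shift \<mu> q2 (\<gamma>t (\<pi> q))"
      using shift_of_momentum[OF q2 \<gamma>_in[OF q2]] J_\<gamma>[OF q2] eq(2) by simp
    obtain g' where g': "g' \<in> carrier G" "q = \<Phi> g' q2" using pi_eqD[OF q2 q] eq(1) by auto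
    show ?thesis
      using lifted_shift[OF g'(1) q2 fixed[OF g'(1)], of "\<gamma>t (\<pi> q)"] lift_\<gamma>[OF g'(1) q2] \<gamma>2 g'(2) by simp
  qed
  have h_mdiff: "mdiff (cot_bundle Q) vector_space_atlas h (q, \<gamma> q)" if q: "q \<in> points Q" for q
    using h_smooth \<gamma>_in[OF q] q diff_atlas_cot_bundle[OF manifold]
    unfolding smooth_fun_def by (intro smooth_map_mdiff) (auto simp: points_cot_bundle)
  have ht_mdiff: "mdiff (cot_bundle B) vector_space_atlas ht (\<pi> q, \<gamma>t (\<pi> q))" if q: "q \<in> points Q" for q
  proof (rule reduced_function_mdiff[OF q \<gamma>t_in[OF pi_in[OF q]] \<mu>])
    show "mdiff (cot_bundle Q) vector_space_atlas h (q, shift \<mu> q (\<gamma>t (\<pi> q)))"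
      using h_mdiff[OF q] \<gamma>_shift[OF q] by simp
  qed (rule ht)
  have X: "X q \<in> tspace Q q"
    "\<eta> \<in> cotspace Q q \<Longrightarrow> ((\<lambda>t. h (q, \<lambda>v\<in>tspace Q q. \<gamma> q v + t * \<eta> v)) has_real_derivative - \<eta> (X q)) (at 0)"
    if q: "q \<in> points Q" for q \<eta>
    unfolding X_def
    \<comment> \<open>The canonical form is the case of zero magnetic term.\<close>
    by (rule projected_vf_fibre_derivative[where N = Q and q = q and \<gamma> = \<gamma> and f = h and \<beta> = "\<lambda>u v. 0"
          and \<Omega> = "canonical_symplectic Q", OF manifold q \<gamma>_in[OF q] h_mdiff[OF q]]; simp)+
  have Xt: "Xt b \<in> tspace B b"
    "\<eta> \<in> cotspace B b \<Longrightarrow> ((\<lambda>t. ht (b, \<lambda>v\<in>tspace B b. \<gamma>t b v + t * \<eta> v)) has_real_derivative - \<eta> (Xt b)) (at 0)"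
    if q: "q \<in> points Q" and b: "b = \<pi> q" for q b \<eta>
  proof -
    have bB: "b \<in> points B" using pi_in[OF q] b by simp
    have bilin: "\<beta> b u (lincomb a v a' w) = a * \<beta> b u v + a' * \<beta> b u w"
      if "u \<in> tspace B b" "v \<in> tspace B b" "w \<in> tspace B b" for u v w a a'
    proof -
      \<comment> \<open>\<open>two_form\<close> states linearity in the first argument; antisymmetry
        moves it to the second.\<close>
      have anti: "\<beta> b u v = - \<beta> b v u" if "u \<in> tspace B b" "v \<in> tspace B b" for u v
        using \<beta>(1) bB that unfolding two_form_def by blast
      have "\<beta> b (lincomb a v a' w) u = a * \<beta> b v u + a' * \<beta> b w u"
        using \<beta>(1) bB that unfolding two_form_def by blast
      then show ?thesis
        using that anti[of u "lincomb a v a' w"] anti[of u v] anti[of u w] lincomb_in[OF atlases(3) bB that(2,3)]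
        by simp
    qed
    note * = projected_vf_fibre_derivative[where N = B and q = b and \<gamma> = \<gamma>t and f = ht and \<beta> = "\<beta> b"
        and \<Omega> = "magnetic_symplectic B \<beta>", OF B_manifold bB \<gamma>t_in[OF bB] ht_mdiff[OF q, folded b] bilin]
    show "Xt b \<in> tspace B b" unfolding Xt_def by (rule *(1)) (simp_all add: magnetic_symplectic_def pullback2_def)
    show "((\<lambda>t. ht (b, \<lambda>v\<in>tspace B b. \<gamma>t b v + t * \<eta> v)) has_real_derivative - \<eta> (Xt b)) (at 0)" if "\<eta> \<in> cotspace B b"
      unfolding Xt_def by (rule *(2)) (simp_all add: magnetic_symplectic_def pullback2_def that)
  qed
  have "tmap Q B \<pi> q (X q) = Xt (\<pi> q)" if q: "q \<in> points Q" for q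
  proof (rule covector_separates[OF atlases(3) pi_in[OF q] tmap_pi_in[OF q X(1)[OF q]] Xt(1)[OF q refl]])
    fix \<eta> assume \<eta>: "\<eta> \<in> cotspace B (\<pi> q)"
    \<comment> \<open>The shift is affine, so moving \<open>\<gamma>t\<close> by t \<eta> downstairs
      is moving \<gamma> by t times the pullback of \<eta> upstairs. The two Hamiltonians agree
      along these lines, and so do their derivatives at 0.\<close>
    define \<eta>' where "\<eta>' = (\<lambda>v\<in>tspace Q q. \<eta> (tmap Q B \<pi> q v))"
    have \<eta>': "\<eta>' \<in> cotspace Q q"
      unfolding \<eta>'_def
      by (intro cotspaceI)
        (simp_all add: lincomb_in[OF atlases(2) q] tmap_lincomb[OF atlases(2,3) pi_mdiff[OF q]]
          cotspace_lincomb[OF \<eta>] tmap_pi_in[OF q])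
    have "ht (\<pi> q, \<lambda>w\<in>tspace B (\<pi> q). \<gamma>t (\<pi> q) w + t * \<eta> w) = h (q, \<lambda>v\<in>tspace Q q. \<gamma> q v + t * \<eta>' v)" for t
    proof -
      have "(\<lambda>w\<in>tspace B (\<pi> q). \<gamma>t (\<pi> q) w + t * \<eta> w) \<in> cotspace B (\<pi> q)"
        by (intro cotspaceI)
          (simp_all add: lincomb_in[OF atlases(3) pi_in[OF q]] cotspace_lincomb[OF \<eta>]
            cotspace_lincomb[OF \<gamma>t_in[OF pi_in[OF q]]] algebra_simps)
      moreover have "shift \<mu> q (\<lambda>w\<in>tspace B (\<pi> q). \<gamma>t (\<pi> q) w + t * \<eta> w) = (\<lambda>v\<in>tspace Q q. \<gamma> q v + t * \<eta>' v)"
        unfolding \<gamma>_shift[OF q] \<eta>'_def shift_def by (rule restrict_ext) (simp add: tmap_pi_in[OF q])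
      ultimately show ?thesis using ht[OF q] by simp
    qed
    then have "- \<eta> (Xt (\<pi> q)) = - \<eta>' (X q)"
      using Xt(2)[OF q refl \<eta>] by (intro DERIV_unique[OF _ X(2)[OF q \<eta>']]) simp
    then show "\<eta> (tmap Q B \<pi> q (X q)) = \<eta> (Xt (\<pi> q))"
      using X(1)[OF q] by (simp add: \<eta>'_def)
  qed
  moreover have "tmap Q Q (\<Phi> g) q (X q) = X (\<Phi> g q)" if g: "g \<in> carrier G" and q: "q \<in> points Q" for g q
  proof (rule covector_separates[OF atlases(2) act_in[OF g q] tmap_act_in[OF g q X(1)[OF q]] X(1)[OF act_in[OF g q]]])
    note gq = act_in[OF g q]
    fix \<eta> assume \<eta>: "\<eta> \<in> cotspace Q (\<Phi> g q)"
    \<comment> \<open>The lifted action is linear on fibres and carries the line through \<gamma> at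
      q in direction \<open>\<eta>'\<close> to the line through \<gamma> at
      \<open>\<Phi> g q\<close> in direction \<eta>; h is invariant, so the derivatives
      agree.\<close>
    define \<eta>' where "\<eta>' = (\<lambda>v\<in>tspace Q q. \<eta> (tmap Q Q (\<Phi> g) q v))"
    have \<eta>': "\<eta>' \<in> cotspace Q q"
      unfolding \<eta>'_def
      by (intro cotspaceI)
        (simp_all add: lincomb_in[OF atlases(2) q] tmap_lincomb[OF atlases(2,2) act_mdiff(1)[OF g q]]
          cotspace_lincomb[OF \<eta>] tmap_act_in[OF g q])
    have \<gamma>gq: "\<gamma> (\<Phi> g q) = (\<lambda>v\<in>tspace Q (\<Phi> g q). \<gamma> q (tmap Q Q (\<Phi> (inv\<^bsub>G\<^esub> g)) (\<Phi> g q) v))"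
      using lift_\<gamma>[OF g q] by (simp add: lifted_apply)
    have "h (q, \<lambda>v\<in>tspace Q q. \<gamma> q v + t * \<eta>' v) = h (\<Phi> g q, \<lambda>v\<in>tspace Q (\<Phi> g q). \<gamma> (\<Phi> g q) v + t * \<eta> v)" for t
    proof -
      have "(\<lambda>v\<in>tspace Q q. \<gamma> q v + t * \<eta>' v) \<in> cotspace Q q"
        by (intro cotspaceI)
          (simp_all add: lincomb_in[OF atlases(2) q] cotspace_lincomb[OF \<eta>'] cotspace_lincomb[OF \<gamma>_in[OF q]] algebra_simps)
      then have "h (lift_act g (q, \<lambda>v\<in>tspace Q q. \<gamma> q v + t * \<eta>' v)) = h (q, \<lambda>v\<in>tspace Q q. \<gamma> q v + t * \<eta>' v)"
        using h_invariant g q by (simp add: points_cot_bundle)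
      moreover have "lift_act g (q, \<lambda>v\<in>tspace Q q. \<gamma> q v + t * \<eta>' v) = (\<Phi> g q, \<lambda>v\<in>tspace Q (\<Phi> g q). \<gamma> (\<Phi> g q) v + t * \<eta> v)"
        unfolding lifted_apply \<gamma>gq
        by (intro arg_cong2[where f = Pair] restrict_ext refl) (simp add: tmap_act_inv'[OF g q] \<eta>'_def)
      ultimately show ?thesis by simp
    qed
    then have "- \<eta>' (X q) = - \<eta> (X (\<Phi> g q))"
      using X(2)[OF q \<eta>'] by (intro DERIV_unique[OF _ X(2)[OF gq \<eta>]]) simp
    then show "\<eta> (tmap Q Q (\<Phi> g) q (X q)) = \<eta> (X (\<Phi> g q))"
      using X(1)[OF q] by (simp add: \<eta>'_def)
  qed
  ultimately show ?thesis
    unfolding Let_def X_def[symmetric] ht_def[symmetric] Xt_def[symmetric] by blast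
qed

end
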